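(* Let $G$ be a $3$-dimensional unimodular Lie group equipped with a left invariant pseudo-Riemannian metric $q$ (of any signature). The following assertions are equivalent: (i) the Euler equation of $q$ is complete (equivalently, $q$ is geodesically complete); (ii) all geodesics of $q$ that run on $1$-parameter subgroups of $G$ are complete; (iii) the Euler vector field of $q$ has no idempotents.
   Context: Let $\mathfrak{g}=T_\epsilon G$ be the Lie algebra of $G$ ($\epsilon$ the identity). Unimodular means $\mathrm{tr}(\mathrm{ad}_X)=0$ for all $X\in\mathfrak{g}$. Let $\langle\cdot,\cdot\rangle$ be the nondegenerate symmetric bilinear form on $\mathfrak{g}$ given by $q_\epsilon$, and $\phi:\mathfrak{g}\to\mathfrak{g}^*$, $\phi(x)=\langle x,\cdot\rangle$. The Euler equation of $q$ is the differential equation on $\mathfrak{g}^*$ $$\dot\xi=-\mathrm{ad}^*_{\phi^{-1}\xi}\,\xi,$$ where $\mathrm{ad}^*$ is the coadjoint representation, $(\mathrm{ad}^*_x\xi)(z)=-\xi([x,z])$; thus $\dot\xi(z)=\xi([\phi^{-1}\xi,z])$. Its right-hand side is the Euler vector field. It is equivalent, via $\xi=\phi(x)$, to the geodesic equation $\dot x=-x\cdot x$ on $\mathfrak{g}$, where $x\cdot y$ is the Levi-Civita product ($(x\cdot y)^+=\nabla_{x^+}y^+$ for left invariant vector fields): a curve $c(t)$ in $G$ is a geodesic if and only if $x(t)=(L_{c(t)})^{-1}_{*}c'(t)$ solves this equation. Geodesic completeness of $q$ is equivalent to completeness of the Euler equation. A vector field whose coordinate functions are homogeneous polynomials of degree $2$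 (a homogeneous quadratic vector field) is complete if all solutions of the corresponding differential equation are defined for all $t\in\mathbb{R}$. An idempotent of a homogeneous quadratic vector field $F$ is a vector $X\neq 0$ such that $X$ and $F(X)$ are linearly dependent and $F(X)\neq 0$ (equivalently, up to rescaling $X$, a nonzero solution of $F(X)=X$). A geodesic runs on a $1$-parameter subgroup if its image is contained in a $1$-parameter subgroup $\{\exp(sX_0): s\in\mathbb{R}\}$ of $G$; it is complete if, when maximally extended as a geodesic, it is defined for all $t\in\mathbb{R}$. *)

theory Defs
  imports "HOL-Analysis.Analysis" "HOL-Algebra.Group"
begin

section \<open>Smooth manifolds given by atlases\<close>

text \<open>For functions on open subsets of Euclidean spaces; all uses below are of this kind.\<close>

primrec Ck_on :: "nat \<Rightarrow> ('a::real_normed_vector \<Rightarrow> 'b::real_normed_vector) \<Rightarrow> 'a set \<Rightarrow> bool" where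
  "Ck_on 0 f S \<longleftrightarrow> continuous_on S f"
| "Ck_on (Suc k) f S \<longleftrightarrow>
     (\<exists>f'. (\<forall>x\<in>S. (f has_derivative f' x) (at x)) \<and> (\<forall>v. Ck_on k (\<lambda>x. f' x v) S))"

definition smooth_on :: "'a::real_normed_vector set \<Rightarrow> ('a \<Rightarrow> 'b::real_normed_vector) \<Rightarrow> bool" where
  "smooth_on S f \<longleftrightarrow> (\<forall>k. Ck_on k f S)"

text \<open>A chart is a pair of its domain and its coordinate map. A tangent vector at a point \<open>p\<close> is
  represented by its coordinates in a chart around \<open>p\<close>.\<close>

type_synonym ('m, 'e) chart = "'m set \<times> ('m \<Rightarrow> 'e)"

definition chart_inv :: "('m, 'e) chart \<Rightarrow> 'e \<Rightarrow> 'm" where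
  "chart_inv c = inv_into (fst c) (snd c)"

definition smooth_manifold :: "'m topology \<Rightarrow> ('m, 'e::euclidean_space) chart set \<Rightarrow> bool" where
  "smooth_manifold T A \<longleftrightarrow>
     Hausdorff_space T \<and> second_countable T \<and> topspace T = (\<Union>c\<in>A. fst c) \<and>
     (\<forall>(U, \<phi>)\<in>A. openin T U \<and> open (\<phi> ` U) \<and>
        homeomorphic_map (subtopology T U) (top_of_set (\<phi> ` U)) \<phi>) \<and>
     (\<forall>c\<in>A. \<forall>c'\<in>A. smooth_on (snd c ` (fst c \<inter> fst c')) (snd c' \<circ> chart_inv c))"

definition smooth_map ::
  "'m topology \<Rightarrow> ('m, 'd::euclidean_space) chart set \<Rightarrow>
   'n topology \<Rightarrow> ('n, 'e::euclidean_space) chart set \<Rightarrow> ('m \<Rightarrow> 'n) \<Rightarrow> bool" where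
  "smooth_map S A T B f \<longleftrightarrow> continuous_map S T f \<and>
     (\<forall>c\<in>A. \<forall>c'\<in>B. smooth_on (snd c ` {p \<in> fst c. f p \<in> fst c'}) (snd c' \<circ> f \<circ> chart_inv c))"

definition prod_atlas ::
  "('m, 'd) chart set \<Rightarrow> ('n, 'e) chart set \<Rightarrow> ('m \<times> 'n, 'd \<times> 'e) chart set" where
  "prod_atlas A B = {(U \<times> V, map_prod \<phi> \<psi>) |U \<phi> V \<psi>. (U, \<phi>) \<in> A \<and> (V, \<psi>) \<in> B}"

text \<open>The differential of \<open>f\<close> at \<open>p\<close>, from coordinates in \<open>c\<close> to coordinates in \<open>c'\<close>.\<close>

definition differential ::
  "('m, 'd::real_normed_vector) chart \<Rightarrow> ('n, 'e::real_normed_vector) chart \<Rightarrow> ('m \<Rightarrow> 'n) \<Rightarrow> 'm \<Rightarrow> 'd \<Rightarrow> 'e" where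
  "differential c c' f p = frechet_derivative (snd c' \<circ> f \<circ> chart_inv c) (at (snd c p))"

definition open_interval :: "real set \<Rightarrow> bool" where
  "open_interval I \<longleftrightarrow> open I \<and> is_interval I \<and> I \<noteq> {}"

definition smooth_curve ::
  "'m topology \<Rightarrow> ('m, 'e::euclidean_space) chart set \<Rightarrow> real set \<Rightarrow> (real \<Rightarrow> 'm) \<Rightarrow> bool" where
  "smooth_curve T A I \<gamma> \<longleftrightarrow> smooth_map (top_of_set I) {(I, id)} T A \<gamma>"


section \<open>Pseudo-Riemannian metrics and geodesics\<close>

text \<open>A field of bilinear forms: \<open>q c p v w\<close> is the value at \<open>p\<close> on the tangent vectors with
  coordinates \<open>v\<close> and \<open>w\<close> in the chart \<open>c\<close>; only charts of the atlas that contain \<open>p\<close> matter.\<close>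

type_synonym ('m, 'e) metric = "('m, 'e) chart \<Rightarrow> 'm \<Rightarrow> 'e \<Rightarrow> 'e \<Rightarrow> real"

definition pseudo_riemannian_metric ::
  "('m, 'e::euclidean_space) chart set \<Rightarrow> ('m, 'e) metric \<Rightarrow> bool" where
  "pseudo_riemannian_metric A q \<longleftrightarrow>
     (\<forall>c\<in>A. \<forall>p\<in>fst c. bilinear (q c p) \<and> (\<forall>v w. q c p v w = q c p w v) \<and>
        (\<forall>v. (\<forall>w. q c p v w = 0) \<longrightarrow> v = 0)) \<and>
     (\<forall>c\<in>A. \<forall>v w. smooth_on (snd c ` fst c) (\<lambda>x. q c (chart_inv c x) v w)) \<and>
     (\<forall>c\<in>A. \<forall>c'\<in>A. \<forall>p\<in>fst c \<inter> fst c'. \<forall>v w.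
        q c' p (differential c c' (\<lambda>m. m) p v) (differential c c' (\<lambda>m. m) p w) = q c p v w)"

text \<open>\<open>metric_deriv q c p u v w\<close> is the derivative in the direction \<open>u\<close> of the coefficient
  \<open>q(v, w)\<close>, for \<open>v\<close>, \<open>w\<close> constant in the chart \<open>c\<close>.\<close>

definition metric_deriv ::
  "('m, 'e::euclidean_space) metric \<Rightarrow> ('m, 'e) chart \<Rightarrow> 'm \<Rightarrow> 'e \<Rightarrow> 'e \<Rightarrow> 'e \<Rightarrow> real" where
  "metric_deriv q c p u v w =
     frechet_derivative (\<lambda>x. q c (chart_inv c x) v w) (at (snd c p)) u"

text \<open>The Levi-Civita derivative at \<open>p\<close> of the constant coordinate field \<open>w\<close> in the direction
  \<open>v\<close>, by the Koszul formula (coordinate fields commute): in a basis, the Christoffel symbols.\<close>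

definition christoffel ::
  "('m, 'e::euclidean_space) metric \<Rightarrow> ('m, 'e) chart \<Rightarrow> 'm \<Rightarrow> 'e \<Rightarrow> 'e \<Rightarrow> 'e" where
  "christoffel q c p v w =
     (THE z. \<forall>u. 2 * q c p z u =
        metric_deriv q c p v w u + metric_deriv q c p w v u - metric_deriv q c p u v w)"

definition geodesic ::
  "'m topology \<Rightarrow> ('m, 'e::euclidean_space) chart set \<Rightarrow> ('m, 'e) metric \<Rightarrow> real set \<Rightarrow> (real \<Rightarrow> 'm) \<Rightarrow> bool" where
  "geodesic T A q I \<gamma> \<longleftrightarrow> open_interval I \<and> smooth_curve T A I \<gamma> \<and>
     (\<forall>c\<in>A. \<forall>t\<in>I. \<gamma> t \<in> fst c \<longrightarrow>
        (let x' = (\<lambda>s. vector_derivative (snd c \<circ> \<gamma>) (at s))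
         in vector_derivative x' (at t) + christoffel q c (\<gamma> t) (x' t) (x' t) = 0))"

definition complete_geodesic ::
  "'m topology \<Rightarrow> ('m, 'e::euclidean_space) chart set \<Rightarrow> ('m, 'e) metric \<Rightarrow> real set \<Rightarrow> (real \<Rightarrow> 'm) \<Rightarrow> bool" where
  "complete_geodesic T A q I \<gamma> \<longleftrightarrow> (\<exists>\<delta>. geodesic T A q UNIV \<delta> \<and> (\<forall>t\<in>I. \<delta> t = \<gamma> t))"

definition geodesically_complete ::
  "'m topology \<Rightarrow> ('m, 'e::euclidean_space) chart set \<Rightarrow> ('m, 'e) metric \<Rightarrow> bool" where
  "geodesically_complete T A q \<longleftrightarrow> (\<forall>I \<gamma>. geodesic T A q I \<gamma> \<longrightarrow> complete_geodesic T A q I \<gamma>)"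


section \<open>Lie groups\<close>

definition lie_group :: "'g monoid \<Rightarrow> 'g topology \<Rightarrow> ('g, 'e::euclidean_space) chart set \<Rightarrow> bool" where
  "lie_group G T A \<longleftrightarrow> group G \<and> topspace T = carrier G \<and> smooth_manifold T A \<and>
     smooth_map (prod_topology T T) (prod_atlas A A) T A (\<lambda>(g, h). g \<otimes>\<^bsub>G\<^esub> h) \<and>
     smooth_map T A T A (\<lambda>g. inv\<^bsub>G\<^esub> g)"

definition left_invariant ::
  "'g monoid \<Rightarrow> ('g, 'e::euclidean_space) chart set \<Rightarrow> ('g, 'e) metric \<Rightarrow> bool" where
  "left_invariant G A q \<longleftrightarrow>
     (\<forall>g\<in>carrier G. \<forall>c\<in>A. \<forall>c'\<in>A. \<forall>p\<in>fst c. g \<otimes>\<^bsub>G\<^esub> p \<in> fst c' \<longrightarrow>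
        (\<forall>v w. q c' (g \<otimes>\<^bsub>G\<^esub> p) (differential c c' (\<lambda>h. g \<otimes>\<^bsub>G\<^esub> h) p v)
                                (differential c c' (\<lambda>h. g \<otimes>\<^bsub>G\<^esub> h) p w) = q c p v w))"

text \<open>From here on, the Lie algebra is the model space \<open>'e\<close>, identified with the tangent space at
  the identity by a chart \<open>c\<close> around the identity.

  \<open>left_inv_field G c X\<close> is the left invariant vector field extending \<open>X\<close>, in the chart \<open>c\<close>.\<close>

definition left_inv_field ::
  "'g monoid \<Rightarrow> ('g, 'e::euclidean_space) chart \<Rightarrow> 'e \<Rightarrow> 'e \<Rightarrow> 'e" where
  "left_inv_field G c X x = differential c c (\<lambda>h. chart_inv c x \<otimes>\<^bsub>G\<^esub> h) \<one>\<^bsub>G\<^esub> X"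

definition field_bracket ::
  "('e::euclidean_space \<Rightarrow> 'e) \<Rightarrow> ('e \<Rightarrow> 'e) \<Rightarrow> 'e \<Rightarrow> 'e" where
  "field_bracket V W x = frechet_derivative W (at x) (V x) - frechet_derivative V (at x) (W x)"

definition lie_bracket ::
  "'g monoid \<Rightarrow> ('g, 'e::euclidean_space) chart \<Rightarrow> 'e \<Rightarrow> 'e \<Rightarrow> 'e" where
  "lie_bracket G c X Y = field_bracket (left_inv_field G c X) (left_inv_field G c Y) (snd c \<one>\<^bsub>G\<^esub>)"

definition unimodular :: "'g monoid \<Rightarrow> ('g, real ^ 'n) chart \<Rightarrow> bool" where
  "unimodular G c \<longleftrightarrow> (\<forall>X. trace (matrix (lie_bracket G c X)) = 0)"

definition one_parameter_hom ::
  "'g monoid \<Rightarrow> 'g topology \<Rightarrow> ('g, 'e::euclidean_space) chart set \<Rightarrow> (real \<Rightarrow> 'g) \<Rightarrow> bool" where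
  "one_parameter_hom G T A \<gamma> \<longleftrightarrow>
     smooth_curve T A UNIV \<gamma> \<and> (\<forall>s t. \<gamma> (s + t) = \<gamma> s \<otimes>\<^bsub>G\<^esub> \<gamma> t)"

definition lie_exp ::
  "'g monoid \<Rightarrow> 'g topology \<Rightarrow> ('g, 'e::euclidean_space) chart set \<Rightarrow> ('g, 'e) chart \<Rightarrow> 'e \<Rightarrow> 'g" where
  "lie_exp G T A c X =
     (THE \<gamma>. one_parameter_hom G T A \<gamma> \<and> vector_derivative (snd c \<circ> \<gamma>) (at 0) = X) 1"

definition one_parameter_subgroup ::
  "'g monoid \<Rightarrow> 'g topology \<Rightarrow> ('g, 'e::euclidean_space) chart set \<Rightarrow> ('g, 'e) chart \<Rightarrow> 'e \<Rightarrow> 'g set" where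
  "one_parameter_subgroup G T A c X = range (\<lambda>s. lie_exp G T A c (s *\<^sub>R X))"

definition runs_on_one_parameter_subgroup ::
  "'g monoid \<Rightarrow> 'g topology \<Rightarrow> ('g, 'e::euclidean_space) chart set \<Rightarrow> ('g, 'e) chart \<Rightarrow>
   real set \<Rightarrow> (real \<Rightarrow> 'g) \<Rightarrow> bool" where
  "runs_on_one_parameter_subgroup G T A c I \<gamma> \<longleftrightarrow>
     (\<exists>X. \<gamma> ` I \<subseteq> one_parameter_subgroup G T A c X)"


section \<open>The Euler equation\<close>

text \<open>The dual of the Lie algebra is \<open>'e \<Rightarrow>\<^sub>L real\<close>; in finite dimension all linear forms are bounded.\<close>

definition flat ::
  "'g monoid \<Rightarrow> ('g, 'e::euclidean_space) chart \<Rightarrow> ('g, 'e) metric \<Rightarrow> 'e \<Rightarrow> ('e \<Rightarrow>\<^sub>L real)" where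
  "flat G c q x = Blinfun (\<lambda>y. q c \<one>\<^bsub>G\<^esub> x y)"

definition coad ::
  "'g monoid \<Rightarrow> ('g, 'e::euclidean_space) chart \<Rightarrow> 'e \<Rightarrow> ('e \<Rightarrow>\<^sub>L real) \<Rightarrow> ('e \<Rightarrow>\<^sub>L real)" where
  "coad G c x \<xi> = Blinfun (\<lambda>z. - blinfun_apply \<xi> (lie_bracket G c x z))"

definition euler_field ::
  "'g monoid \<Rightarrow> ('g, 'e::euclidean_space) chart \<Rightarrow> ('g, 'e) metric \<Rightarrow> ('e \<Rightarrow>\<^sub>L real) \<Rightarrow> ('e \<Rightarrow>\<^sub>L real)" where
  "euler_field G c q \<xi> = - coad G c (inv_into UNIV (flat G c q) \<xi>) \<xi>"

definition solves :: "('v::real_normed_vector \<Rightarrow> 'v) \<Rightarrow> real set \<Rightarrow> (real \<Rightarrow> 'v) \<Rightarrow> bool" where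
  "solves F I x \<longleftrightarrow> open_interval I \<and> (\<forall>t\<in>I. (x has_vector_derivative F (x t)) (at t))"

definition complete_field :: "('v::real_normed_vector \<Rightarrow> 'v) \<Rightarrow> bool" where
  "complete_field F \<longleftrightarrow> (\<forall>I x. solves F I x \<longrightarrow> (\<exists>y. solves F UNIV y \<and> (\<forall>t\<in>I. y t = x t)))"

text \<open>Linear dependence is that of the family, not of the set: \<open>F X = X\<close> is allowed.\<close>

definition idempotent_of :: "('v::real_vector \<Rightarrow> 'v) \<Rightarrow> 'v \<Rightarrow> bool" where
  "idempotent_of F X \<longleftrightarrow> X \<noteq> 0 \<and> F X \<noteq> 0 \<and>
     (\<exists>a b. (a \<noteq> 0 \<or> b \<noteq> 0) \<and> a *\<^sub>R X + b *\<^sub>R F X = 0)"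

end

theory Submission
  imports Defs
begin

text \<open>
  The proof runs in a cycle: completeness of the Euler equation implies geodesic completeness, this
  implies completeness of the geodesics on one-parameter subgroups, this excludes idempotents, and
  the absence of idempotents implies completeness of the Euler equation.

  A curve in the group is described by its logarithmic derivative, its velocity translated back to the
  Lie algebra. A continuous function on \<open>\<real>\<close> with values in the Lie algebra is the logarithmic
  derivative of a curve defined for all time, unique up to its initial point
  (\<open>log_deriv_existence\<close>, \<open>log_deriv_unique\<close>): the local solutions at the identity can be
  moved everywhere by left translation. A curve is a geodesic if and only if its logarithmic
  derivative solves the Euler equation (\<open>euler_geodesic_identity\<close>). So if the solutions of the Euler
  equation can be continued, the geodesics can be.

  An idempotent \<open>v\<close>, with \<open>F v = k v\<close> and \<open>k \<noteq> 0\<close>, gives the solution \<open>v / (1 - k t)\<close>, which blows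
  up. It belongs to a geodesic that only changes the speed along a one-parameter subgroup
  (\<open>incomplete_geodesic_of_idempotent\<close>).

  Unimodularity and dimension three enter only in the last implication. They give the bracket the form
  \<open>[x, y] = M (x \<times> y)\<close> with a symmetric matrix \<open>M\<close>, and the Euler field the form
  \<open>F v = Mv \<times> Nv\<close>, where \<open>N\<close> is the inverse of the metric. The quadratic forms \<open>vMv\<close> and
  \<open>vNv\<close> are conserved. If they have no common zero \<open>v \<noteq> 0\<close>, all solutions are bounded. At a common
  zero \<open>v\<close>, \<open>F v\<close> is a multiple of \<open>v\<close>, hence \<open>F v = 0\<close> if there are no idempotents: the two conics
  in the projective plane do not meet transversally there. In a basis adapted to such a point the
  system becomes triangular (\<open>F_components\<close>), the remaining intersections of the conics decide the sign of a discriminant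
  (\<open>discriminant_nonpos\<close>), and for that sign the solutions stay bounded on bounded time intervals
  (\<open>triangular_system_bound\<close>). Such solutions can be continued to all of \<open>\<real>\<close>
  (\<open>complete_field_of_a_priori_bounds\<close>).
\<close>

section \<open>Calculus of smooth maps\<close>

lemma Ck_on_SucI:
  assumes "\<And>x. x \<in> S \<Longrightarrow> (f has_derivative f' x) (at x)" "\<And>v. Ck_on k (\<lambda>x. f' x v) S"
  shows "Ck_on (Suc k) f S"
  using assms by auto

lemma Ck_on_Suc_imp: "Ck_on (Suc k) f S \<Longrightarrow> Ck_on k f S"
proof (induction k arbitrary: f)
  case 0
  then show ?case
    by (auto intro!: continuous_at_imp_continuous_on) (metis has_derivative_continuous)
next
  case (Suc k)
  from Suc.prems obtain f' where f': "\<forall>x\<in>S. (f has_derivative f' x) (at x)"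
      "\<forall>v. Ck_on (Suc k) (\<lambda>x. f' x v) S"
    by (auto simp only: Ck_on.simps(2)[of "Suc k"])
  have "Ck_on k (\<lambda>x. f' x v) S" for v
    by (rule Suc.IH[OF f'(2)[rule_format]])
  then show ?case
    by (intro Ck_on_SucI[where f' = f'] f'(1)[rule_format])
qed

lemma Ck_on_cong_open:
  assumes "open S" "\<And>x. x \<in> S \<Longrightarrow> f x = g x" "Ck_on k f S"
  shows "Ck_on k g S"
proof (cases k)
  case 0
  then show ?thesis
    using assms continuous_on_cong[of S S f g] by simp
next
  case (Suc l)
  obtain f' where "\<forall>x\<in>S. (f has_derivative f' x) (at x)" "\<forall>v. Ck_on l (\<lambda>x. f' x v) S"
    using assms(3)[unfolded Suc] unfolding Ck_on.simps by blast
  note f' = this(1)[rule_format] this(2)[rule_format]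
  show ?thesis
    unfolding Suc
  proof (rule Ck_on_SucI[OF _ f'(2)])
    fix x assume "x \<in> S"
    then show "(g has_derivative f' x) (at x)"
      using has_derivative_transform_within_open[OF f'(1) assms(1)] assms(2) by blast
  qed
qed

lemma Ck_on_subset: "Ck_on k f S \<Longrightarrow> S' \<subseteq> S \<Longrightarrow> Ck_on k f S'"
proof (induction k arbitrary: f)
  case 0
  then show ?case by (auto intro: continuous_on_subset)
next
  case (Suc k)
  obtain f' where f': "\<forall>x\<in>S. (f has_derivative f' x) (at x)" "\<forall>v. Ck_on k (\<lambda>x. f' x v) S"
    using Suc.prems(1) unfolding Ck_on.simps by blast
  show ?case
  proof (rule Ck_on_SucI[where f' = f'])
    show "Ck_on k (\<lambda>x. f' x v) S'" for v
      by (rule Suc.IH[OF f'(2)[rule_format] Suc.prems(2)])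
  qed (use f' Suc.prems(2) in blast)
qed

lemma Ck_on_const: "Ck_on k (\<lambda>x. c) S"
  by (induction k arbitrary: c) (auto intro!: exI[of _ "\<lambda>_ _. 0"])

lemma Ck_on_bounded_linear_compose:
  assumes "bounded_linear h" "Ck_on k f S"
  shows "Ck_on k (\<lambda>x. h (f x)) S"
  using assms(2)
proof (induction k arbitrary: f)
  case 0
  then show ?case
    using bounded_linear.continuous_on[OF assms(1)] by simp
next
  case (Suc k)
  obtain f' where "\<forall>x\<in>S. (f has_derivative f' x) (at x)" "\<forall>v. Ck_on k (\<lambda>x. f' x v) S"
    using Suc.prems unfolding Ck_on.simps by blast
  note f' = this(1)[rule_format] this(2)[rule_format]
  show ?case
    by (rule Ck_on_SucI[of _ _ "\<lambda>x v. h (f' x v)"])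
       (auto intro: bounded_linear.has_derivative[OF assms(1)] f' Suc.IH)
qed

lemma Ck_on_id: "Ck_on k (\<lambda>x. x) S"
proof (cases k)
  case (Suc l)
  show ?thesis unfolding Suc
    by (rule Ck_on_SucI[of _ _ "\<lambda>x v. v"]) (auto intro: Ck_on_const)
qed simp

lemma Ck_on_add:
  "Ck_on k f S \<Longrightarrow> Ck_on k g S \<Longrightarrow> Ck_on k (\<lambda>x. f x + g x) S"
proof (induction k arbitrary: f g)
  case 0
  then show ?case by (simp add: continuous_on_add)
next
  case (Suc k)
  obtain f' where "\<forall>x\<in>S. (f has_derivative f' x) (at x)" "\<forall>v. Ck_on k (\<lambda>x. f' x v) S"
    using Suc.prems(1) unfolding Ck_on.simps by blast
  note f' = this(1)[rule_format] this(2)[rule_format]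
  obtain g' where "\<forall>x\<in>S. (g has_derivative g' x) (at x)" "\<forall>v. Ck_on k (\<lambda>x. g' x v) S"
    using Suc.prems(2) unfolding Ck_on.simps by blast
  note g' = this(1)[rule_format] this(2)[rule_format]
  show ?case
    by (rule Ck_on_SucI[of _ _ "\<lambda>x v. f' x v + g' x v"])
       (auto intro: has_derivative_add f' g' Suc.IH)
qed

lemma Ck_on_sum:
  "(\<And>i. i \<in> I \<Longrightarrow> Ck_on k (f i) S) \<Longrightarrow> Ck_on k (\<lambda>x. \<Sum>i\<in>I. f i x) S"
  by (induction I rule: infinite_finite_induct) (auto intro: Ck_on_const Ck_on_add)

lemma Ck_on_bilinear:
  assumes "bounded_bilinear B"
  shows "Ck_on k f S \<Longrightarrow> Ck_on k g S \<Longrightarrow> Ck_on k (\<lambda>x. B (f x) (g x)) S"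
proof (induction k arbitrary: f g)
  case 0
  then show ?case using bounded_bilinear.continuous_on[OF assms] by simp
next
  case (Suc k)
  obtain f' where "\<forall>x\<in>S. (f has_derivative f' x) (at x)" "\<forall>v. Ck_on k (\<lambda>x. f' x v) S"
    using Suc.prems(1) unfolding Ck_on.simps by blast
  note f' = this(1)[rule_format] this(2)[rule_format]
  obtain g' where "\<forall>x\<in>S. (g has_derivative g' x) (at x)" "\<forall>v. Ck_on k (\<lambda>x. g' x v) S"
    using Suc.prems(2) unfolding Ck_on.simps by blast
  note g' = this(1)[rule_format] this(2)[rule_format]
  show ?case
  proof (rule Ck_on_SucI[of _ _ "\<lambda>x v. B (f x) (g' x v) + B (f' x v) (g x)"])
    show "((\<lambda>x. B (f x) (g x)) has_derivative (\<lambda>v. B (f x) (g' x v) + B (f' x v) (g x))) (at x)" if "x \<in> S" for x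
      using bounded_bilinear.FDERIV[OF assms f'(1)[OF that] g'(1)[OF that]] .
    show "Ck_on k (\<lambda>x. B (f x) (g' x v) + B (f' x v) (g x)) S" for v
      by (rule Ck_on_add[OF Suc.IH[OF Ck_on_Suc_imp[OF Suc.prems(1)] g'(2)]
            Suc.IH[OF f'(2) Ck_on_Suc_imp[OF Suc.prems(2)]]])
  qed
qed

lemma Ck_on_Pair:
  "Ck_on k f S \<Longrightarrow> Ck_on k g S \<Longrightarrow> Ck_on k (\<lambda>x. (f x, g x)) S"
proof (induction k arbitrary: f g)
  case 0
  then show ?case by (simp add: continuous_on_Pair)
next
  case (Suc k)
  obtain f' where "\<forall>x\<in>S. (f has_derivative f' x) (at x)" "\<forall>v. Ck_on k (\<lambda>x. f' x v) S"
    using Suc.prems(1) unfolding Ck_on.simps by blast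
  note f' = this(1)[rule_format] this(2)[rule_format]
  obtain g' where "\<forall>x\<in>S. (g has_derivative g' x) (at x)" "\<forall>v. Ck_on k (\<lambda>x. g' x v) S"
    using Suc.prems(2) unfolding Ck_on.simps by blast
  note g' = this(1)[rule_format] this(2)[rule_format]
  show ?case
    by (rule Ck_on_SucI[of _ _ "\<lambda>x v. (f' x v, g' x v)"])
       (auto intro: has_derivative_Pair f' g' Suc.IH)
qed

lemma linear_basis_expansion:
  fixes h :: "'a::euclidean_space \<Rightarrow> 'b::real_vector"
  assumes "linear h"
  shows "h v = (\<Sum>b\<in>Basis. (v \<bullet> b) *\<^sub>R h b)"
  using euclidean_representation[of v] linear_sum[OF assms, of "\<lambda>b. (v \<bullet> b) *\<^sub>R b" Basis]
  by (simp add: linear_scale[OF assms])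

text \<open>In the derivative \<open>g' (f x) (f' x v)\<close> of a composition the direction depends on \<open>x\<close>.
  Expanding it in the standard basis leaves only derivatives of \<open>g\<close> in constant directions, to
  which the induction hypothesis applies.\<close>

lemma Ck_on_compose:
  fixes f :: "'a::real_normed_vector \<Rightarrow> 'b::euclidean_space"
  assumes "f ` S \<subseteq> U"
  shows "Ck_on k f S \<Longrightarrow> Ck_on k g U \<Longrightarrow> Ck_on k (\<lambda>x. g (f x)) S"
proof (induction k arbitrary: g)
  case 0
  then show ?case using assms by (auto intro: continuous_on_compose2)
next
  case (Suc k)
  obtain f' where "\<forall>x\<in>S. (f has_derivative f' x) (at x)" "\<forall>v. Ck_on k (\<lambda>x. f' x v) S"
    using Suc.prems(1) unfolding Ck_on.simps by blast
  note f' = this(1)[rule_format] this(2)[rule_format]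
  obtain g' where "\<forall>x\<in>U. (g has_derivative g' x) (at x)" "\<forall>v. Ck_on k (\<lambda>x. g' x v) U"
    using Suc.prems(2) unfolding Ck_on.simps by blast
  note g' = this(1)[rule_format] this(2)[rule_format]
  show ?case
  proof (rule Ck_on_SucI[of _ _ "\<lambda>x v. \<Sum>b\<in>Basis. (f' x v \<bullet> b) *\<^sub>R g' (f x) b"])
    fix x assume x: "x \<in> S"
    then have U: "f x \<in> U" using assms by auto
    have eq: "g' (f x) (f' x v) = (\<Sum>b\<in>Basis. (f' x v \<bullet> b) *\<^sub>R g' (f x) b)" for v
      by (rule linear_basis_expansion[OF has_derivative_linear[OF g'(1)[OF U]]])
    have "((\<lambda>x. g (f x)) has_derivative (\<lambda>v. g' (f x) (f' x v))) (at x)"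
      by (rule has_derivative_compose[OF f'(1)[OF x] g'(1)[OF U]])
    then show "((\<lambda>x. g (f x)) has_derivative (\<lambda>v. \<Sum>b\<in>Basis. (f' x v \<bullet> b) *\<^sub>R g' (f x) b)) (at x)"
      unfolding eq .
  next
    fix v
    show "Ck_on k (\<lambda>x. \<Sum>b\<in>Basis. (f' x v \<bullet> b) *\<^sub>R g' (f x) b) S"
      by (rule Ck_on_sum, rule Ck_on_bilinear[OF bounded_bilinear_scaleR
            Ck_on_bounded_linear_compose[OF bounded_linear_inner_left f'(2)]
            Suc.IH[OF Ck_on_Suc_imp[OF Suc.prems(1)] g'(2)]])
  qed
qed

lemma smooth_on_compose:
  fixes f :: "'a::real_normed_vector \<Rightarrow> 'b::euclidean_space"
  shows "smooth_on S f \<Longrightarrow> smooth_on U g \<Longrightarrow> f ` S \<subseteq> U \<Longrightarrow> smooth_on S (\<lambda>x. g (f x))"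
  by (simp add: smooth_on_def Ck_on_compose)

lemma smooth_on_cong_open:
  "open S \<Longrightarrow> (\<And>x. x \<in> S \<Longrightarrow> f x = g x) \<Longrightarrow> smooth_on S f \<Longrightarrow> smooth_on S g"
  unfolding smooth_on_def using Ck_on_cong_open by blast

lemma smooth_on_const: "smooth_on S (\<lambda>x. c)"
  by (simp add: smooth_on_def Ck_on_const)

lemma smooth_on_id: "smooth_on S (\<lambda>x. x)"
  by (simp add: smooth_on_def Ck_on_id)

lemma smooth_on_Pair: "smooth_on S f \<Longrightarrow> smooth_on S g \<Longrightarrow> smooth_on S (\<lambda>x. (f x, g x))"
  by (simp add: smooth_on_def Ck_on_Pair)

lemma smooth_on_imp_continuous_on: "smooth_on S f \<Longrightarrow> continuous_on S f"
  unfolding smooth_on_def by (metis Ck_on.simps(1))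

lemma smooth_on_has_derivative:
  "smooth_on S f \<Longrightarrow> x \<in> S \<Longrightarrow> (f has_derivative frechet_derivative f (at x)) (at x)"
proof -
  assume "smooth_on S f" "x \<in> S"
  then have "f differentiable (at x)"
    unfolding smooth_on_def differentiable_def using Ck_on.simps(2)[of 0 f S] by blast
  then show ?thesis
    by (rule frechet_derivative_works[THEN iffD1])
qed

lemma smooth_on_frechet_derivative:
  assumes "open S" "smooth_on S f"
  shows "smooth_on S (\<lambda>x. frechet_derivative f (at x) v)"
  unfolding smooth_on_def
proof
  fix k
  obtain f' where "\<forall>x\<in>S. (f has_derivative f' x) (at x)" "\<forall>v. Ck_on k (\<lambda>x. f' x v) S"
    using assms(2)[unfolded smooth_on_def, rule_format, of "Suc k"] unfolding Ck_on.simps by blast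
  note f' = this(1)[rule_format] this(2)[rule_format]
  show "Ck_on k (\<lambda>x. frechet_derivative f (at x) v) S"
    by (rule Ck_on_cong_open[OF assms(1) _ f'(2)]) (simp add: frechet_derivative_at[OF f'(1), symmetric])
qed

lemma smooth_on_vector_derivative:
  fixes f :: "real \<Rightarrow> 'b::real_normed_vector"
  assumes "open S" "smooth_on S f"
  shows "t \<in> S \<Longrightarrow> (f has_vector_derivative vector_derivative f (at t)) (at t)"
    and "smooth_on S (\<lambda>t. vector_derivative f (at t))"
proof -
  have 1: "(f has_vector_derivative frechet_derivative f (at t) 1) (at t)" if "t \<in> S" for t
  proof -
    note D = smooth_on_has_derivative[OF assms(2) that]
    have "frechet_derivative f (at t) h = h *\<^sub>R frechet_derivative f (at t) 1" for h
      using linear_scale[OF has_derivative_linear[OF D], of h 1]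
      unfolding real_scaleR_def mult_1_right .
    then have "frechet_derivative f (at t) = (\<lambda>h. h *\<^sub>R frechet_derivative f (at t) 1)" ..
    then show ?thesis
      using D unfolding has_vector_derivative_def by metis
  qed
  then have 2: "frechet_derivative f (at t) 1 = vector_derivative f (at t)" if "t \<in> S" for t
    using that vector_derivative_at by metis
  show "t \<in> S \<Longrightarrow> (f has_vector_derivative vector_derivative f (at t)) (at t)"
    using 1 2 by metis
  show "smooth_on S (\<lambda>t. vector_derivative f (at t))"
    by (rule smooth_on_cong_open[OF assms(1) 2 smooth_on_frechet_derivative[OF assms]])
qed

lemma Ck_on_Suc_real:
  fixes f :: "real \<Rightarrow> 'b::real_normed_vector"
  assumes "\<And>t. t \<in> S \<Longrightarrow> (f has_vector_derivative f' t) (at t)" "Ck_on k f' S"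
  shows "Ck_on (Suc k) f S"
  by (rule Ck_on_SucI[of _ _ "\<lambda>t v. v *\<^sub>R f' t"])
     (use assms in \<open>auto simp: has_vector_derivative_def intro: Ck_on_bounded_linear_compose[OF bounded_linear_scaleR_right]\<close>)

text \<open>The partial derivative is the total one in a vertical direction, restricted to a slice.\<close>

lemma smooth_on_partial_derivative:
  fixes f :: "'a::euclidean_space \<times> 'b::euclidean_space \<Rightarrow> 'c::real_normed_vector"
  assumes "open W" "smooth_on W f" "\<And>x. x \<in> S \<Longrightarrow> (x, y) \<in> W" "open S"
  shows "smooth_on S (\<lambda>x. frechet_derivative (\<lambda>y. f (x, y)) (at y) v)"
proof (rule smooth_on_cong_open[OF \<open>open S\<close>])
  show "smooth_on S (\<lambda>x. frechet_derivative f (at (x, y)) (0, v))"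
    by (rule smooth_on_compose[OF _ smooth_on_frechet_derivative[OF assms(1,2)], of S "\<lambda>x. (x, y)"])
       (use assms(3) in \<open>auto intro: smooth_on_Pair smooth_on_id smooth_on_const\<close>)
next
  fix x assume "x \<in> S"
  then have "(f has_derivative frechet_derivative f (at (x, y))) (at (x, y))"
    using assms by (intro smooth_on_has_derivative)
  moreover have "((\<lambda>y. (x, y)) has_derivative (\<lambda>v. (0, v))) (at y)"
    by (rule has_derivative_Pair[OF has_derivative_const has_derivative_ident])
  ultimately have "((\<lambda>y. f (x, y)) has_derivative (\<lambda>v. frechet_derivative f (at (x, y)) (0, v))) (at y)"
    using has_derivative_compose[of "\<lambda>y. (x, y)" "\<lambda>v. (0, v)" y UNIV f] by blast
  then show "frechet_derivative f (at (x, y)) (0, v) = frechet_derivative (\<lambda>y. f (x, y)) (at y) v"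
    by (metis frechet_derivative_at)
qed

text \<open>Two applications of the mean value theorem to the second difference over a small
  parallelogram.\<close>

lemma second_difference_mean_value:
  fixes f :: "'a::real_normed_vector \<Rightarrow> real"
  assumes S: "ball x r \<subseteq> S" and h: "h > 0" "h * (norm v + norm w) < r"
    and A: "\<And>y. y \<in> S \<Longrightarrow> (f has_derivative A y) (at y)"
    and B: "\<And>y. y \<in> S \<Longrightarrow> ((\<lambda>y. A y v) has_derivative B y) (at y)"
  shows "\<exists>p\<in>ball x r. f (x + h *\<^sub>R v + h *\<^sub>R w) - f (x + h *\<^sub>R v) - f (x + h *\<^sub>R w) + f x = h * h * B p w"
proof -
  have mem: "x + s *\<^sub>R v + t *\<^sub>R w \<in> ball x r" if "0 \<le> s" "s \<le> h" "0 \<le> t" "t \<le> h" for s t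
  proof -
    have "norm (s *\<^sub>R v + t *\<^sub>R w) \<le> s * norm v + t * norm w"
      using norm_triangle_ineq[of "s *\<^sub>R v" "t *\<^sub>R w"] that by simp
    also have "\<dots> \<le> h * norm v + h * norm w"
      using that by (intro add_mono mult_right_mono) auto
    finally show ?thesis using h by (simp add: dist_norm norm_minus_commute algebra_simps)
  qed
  have line: "((\<lambda>s. g (q + s *\<^sub>R z)) has_real_derivative g' z) (at s)"
    if "(g has_derivative g') (at (q + s *\<^sub>R z))" for g :: "'a \<Rightarrow> real" and g' q z s
  proof -
    have "((\<lambda>s. q + s *\<^sub>R z) has_derivative (\<lambda>s. s *\<^sub>R z)) (at s)"
      by (auto intro!: derivative_eq_intros)
    from has_derivative_compose[OF this that]
    have "((\<lambda>s. g (q + s *\<^sub>R z)) has_derivative (\<lambda>s. g' (s *\<^sub>R z))) (at s)" .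
    moreover have "(\<lambda>s. g' (s *\<^sub>R z)) = (*) (g' z)"
      using linear_scale[OF has_derivative_linear[OF that]] by (simp add: fun_eq_iff)
    ultimately show ?thesis
      by (simp only: has_field_derivative_def)
  qed
  let ?\<phi> = "\<lambda>s. f (x + h *\<^sub>R w + s *\<^sub>R v) - f (x + s *\<^sub>R v)"
  have "\<exists>s. 0 < s \<and> s < h \<and> ?\<phi> h - ?\<phi> 0 = (h - 0) * (A (x + h *\<^sub>R w + s *\<^sub>R v) v - A (x + s *\<^sub>R v) v)"
  proof (rule MVT2[OF h(1)])
    fix s assume s: "0 \<le> s" "s \<le> h"
    show "DERIV ?\<phi> s :> A (x + h *\<^sub>R w + s *\<^sub>R v) v - A (x + s *\<^sub>R v) v"
      using mem[OF s, of h] mem[OF s, of 0] S h(1)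
      by (intro DERIV_diff line A) (auto simp: algebra_simps)
  qed
  then obtain s where s: "0 < s" "s < h"
    "?\<phi> h - ?\<phi> 0 = h * (A (x + h *\<^sub>R w + s *\<^sub>R v) v - A (x + s *\<^sub>R v) v)" by auto
  let ?\<psi> = "\<lambda>t. A (x + s *\<^sub>R v + t *\<^sub>R w) v"
  have "\<exists>t. 0 < t \<and> t < h \<and> ?\<psi> h - ?\<psi> 0 = (h - 0) * B (x + s *\<^sub>R v + t *\<^sub>R w) w"
  proof (rule MVT2[OF h(1)])
    fix t assume t: "0 \<le> t" "t \<le> h"
    show "DERIV ?\<psi> t :> B (x + s *\<^sub>R v + t *\<^sub>R w) w"
      using mem[OF _ _ t, of s] s S by (intro line[of "\<lambda>y. A y v"] B) auto
  qed
  then obtain t where t: "0 < t" "t < h" "?\<psi> h - ?\<psi> 0 = h * B (x + s *\<^sub>R v + t *\<^sub>R w) w" by auto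
  show ?thesis
  proof
    show "x + s *\<^sub>R v + t *\<^sub>R w \<in> ball x r" using s t by (intro mem) auto
    show "f (x + h *\<^sub>R v + h *\<^sub>R w) - f (x + h *\<^sub>R v) - f (x + h *\<^sub>R w) + f x
        = h * h * B (x + s *\<^sub>R v + t *\<^sub>R w) w"
      using s(3) t(3) by (simp add: add.commute add.left_commute)
  qed
qed

lemma mixed_derivatives_equal_real:
  fixes f :: "'a::real_normed_vector \<Rightarrow> real"
  assumes S: "open S" "x \<in> S"
    and A: "\<And>y. y \<in> S \<Longrightarrow> (f has_derivative A y) (at y)"
    and B: "\<And>y. y \<in> S \<Longrightarrow> ((\<lambda>y. A y v) has_derivative B y) (at y)"
    and C: "\<And>y. y \<in> S \<Longrightarrow> ((\<lambda>y. A y w) has_derivative C y) (at y)"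
    and cont: "continuous_on S (\<lambda>y. B y w)" "continuous_on S (\<lambda>y. C y v)"
  shows "B x w = C x v"
proof (rule ccontr)
  assume ne: "B x w \<noteq> C x v"
  define e where "e = \<bar>B x w - C x v\<bar> / 2"
  have e: "e > 0" using ne by (simp add: e_def)
  have "isCont (\<lambda>y. B y w) x" "isCont (\<lambda>y. C y v) x"
    using cont S by (simp_all add: continuous_on_eq_continuous_at)
  then have "\<exists>d>0. \<forall>y. dist y x < d \<longrightarrow> dist (B y w) (B x w) < e"
    "\<exists>d>0. \<forall>y. dist y x < d \<longrightarrow> dist (C y v) (C x v) < e"
    using e unfolding continuous_at_eps_delta by blast+
  then obtain d1 d2 where d: "d1 > 0" "d2 > 0" "\<And>y. dist y x < d1 \<Longrightarrow> dist (B y w) (B x w) < e"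
    "\<And>y. dist y x < d2 \<Longrightarrow> dist (C y v) (C x v) < e" by blast
  obtain d3 where d3: "d3 > 0" "ball x d3 \<subseteq> S" using S by (metis openE)
  define r where "r = min d1 (min d2 d3)"
  have r: "r > 0" "ball x r \<subseteq> S" using d d3 by (auto simp: r_def)
  define h where "h = r / (norm v + norm w + 1)"
  have n: "norm v + norm w + 1 > 0" by (smt (verit) norm_ge_zero)
  have h: "h > 0" "h * (norm v + norm w) < r" "h * (norm w + norm v) < r"
    using r n by (auto simp: h_def field_simps)
  obtain p where p: "p \<in> ball x r"
    "f (x + h *\<^sub>R v + h *\<^sub>R w) - f (x + h *\<^sub>R v) - f (x + h *\<^sub>R w) + f x = h * h * B p w"
    using second_difference_mean_value[OF r(2) h(1,2) A B] by blast
  obtain p' where p': "p' \<in> ball x r"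
    "f (x + h *\<^sub>R w + h *\<^sub>R v) - f (x + h *\<^sub>R w) - f (x + h *\<^sub>R v) + f x = h * h * C p' v"
    using second_difference_mean_value[OF r(2) h(1,3) A C] by blast
  have swap: "x + h *\<^sub>R w + h *\<^sub>R v = x + h *\<^sub>R v + h *\<^sub>R w" by simp
  have "(h * h) * B p w = (h * h) * C p' v"
    using p(2) p'(2)[unfolded swap] by linarith
  then have "B p w = C p' v" using h(1) by simp
  moreover have "dist (B p w) (B x w) < e" "dist (C p' v) (C x v) < e"
    using p p' d by (auto simp: r_def dist_commute)
  ultimately have "\<bar>B x w - C x v\<bar> < e + e" unfolding dist_real_def by arith
  then show False by (simp add: e_def)
qed

text \<open>Both orders of differentiation are limits of the same second difference.\<close>

theorem symmetric_second_derivative: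
  fixes f :: "'a::real_normed_vector \<Rightarrow> 'b::euclidean_space"
  assumes S: "open S" "x \<in> S" and f: "smooth_on S f"
  shows "frechet_derivative (\<lambda>y. frechet_derivative f (at y) v) (at x) w
       = frechet_derivative (\<lambda>y. frechet_derivative f (at y) w) (at x) v"
proof (rule euclidean_eqI)
  fix b :: 'b
  let ?D = "\<lambda>v y. frechet_derivative f (at y) v"
  let ?D2 = "\<lambda>v y. frechet_derivative (?D v) (at y)"
  have 1: "smooth_on S (?D v)" for v by (rule smooth_on_frechet_derivative[OF S(1) f])
  have in_b: "((\<lambda>y. g y \<bullet> b) has_derivative (\<lambda>v. g' v \<bullet> b)) (at y)" if "(g has_derivative g') (at y)"
    for g :: "'a \<Rightarrow> 'b" and g' y
    by (rule bounded_linear.has_derivative[OF bounded_linear_inner_left that])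
  show "?D2 v x w \<bullet> b = ?D2 w x v \<bullet> b"
  proof (rule mixed_derivatives_equal_real[OF S, of "\<lambda>y. f y \<bullet> b" "\<lambda>y v. ?D v y \<bullet> b"
        v "\<lambda>y w. ?D2 v y w \<bullet> b" w "\<lambda>y v. ?D2 w y v \<bullet> b"])
    show "continuous_on S (\<lambda>y. ?D2 v y w \<bullet> b)" "continuous_on S (\<lambda>y. ?D2 w y v \<bullet> b)"
      by (intro continuous_on_inner continuous_on_const smooth_on_imp_continuous_on
          smooth_on_frechet_derivative S 1)+
  qed (intro in_b smooth_on_has_derivative[OF f] smooth_on_has_derivative[OF 1]; simp)+
qed

section \<open>Ordinary differential equations\<close>

lemma gronwall_forward:
  fixes d :: "real \<Rightarrow> 'v::real_inner"
  assumes "t0 \<le> t"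
    and der: "\<And>s. t0 \<le> s \<Longrightarrow> s \<le> t \<Longrightarrow> (d has_vector_derivative d' s) (at s)"
    and le: "\<And>s. t0 \<le> s \<Longrightarrow> s \<le> t \<Longrightarrow> norm (d' s) \<le> L * norm (d s)"
  shows "norm (d t) \<le> norm (d t0) * exp (L * (t - t0))"
proof -
  define h where "h s = (d s \<bullet> d s) * exp (- (2 * L * (s - t0)))" for s
  have "h t \<le> h t0"
  proof (rule DERIV_nonpos_imp_nonincreasing[OF \<open>t0 \<le> t\<close>])
    fix s assume s: "t0 \<le> s" "s \<le> t"
    have 1: "((\<lambda>s. d s \<bullet> d s) has_real_derivative (d s \<bullet> d' s + d' s \<bullet> d s)) (at s)"
      unfolding has_real_derivative_iff_has_vector_derivative
      by (rule bounded_bilinear.has_vector_derivative[OF bounded_bilinear_inner der[OF s] der[OF s]])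
    have 2: "(h has_real_derivative
      ((d s \<bullet> d' s + d' s \<bullet> d s) * exp (- (2 * L * (s - t0))) +
       (- (2 * L) * exp (- (2 * L * (s - t0)))) * (d s \<bullet> d s))) (at s)"
      unfolding h_def
      by (rule DERIV_mult[OF 1]) (auto intro!: derivative_eq_intros)
    have "d s \<bullet> d' s \<le> norm (d s) * norm (d' s)"
      by (rule norm_cauchy_schwarz)
    also have "\<dots> \<le> norm (d s) * (L * norm (d s))"
      by (rule mult_left_mono[OF le[OF s]]) simp
    also have "\<dots> = L * (d s \<bullet> d s)"
      by (simp add: dot_square_norm power2_eq_square)
    finally have "d s \<bullet> d' s + d' s \<bullet> d s - 2 * L * (d s \<bullet> d s) \<le> 0"
      by (simp add: inner_commute)
    then have "(d s \<bullet> d' s + d' s \<bullet> d s - 2 * L * (d s \<bullet> d s)) * exp (- (2 * L * (s - t0))) \<le> 0"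
      by (simp add: mult_le_0_iff)
    then have "(d s \<bullet> d' s + d' s \<bullet> d s) * exp (- (2 * L * (s - t0))) +
       (- (2 * L) * exp (- (2 * L * (s - t0)))) * (d s \<bullet> d s) \<le> 0"
      by (simp add: algebra_simps)
    then show "\<exists>y. DERIV h s :> y \<and> y \<le> 0"
      using 2 by blast
  qed
  then have "(d t \<bullet> d t) * exp (- (2 * L * (t - t0))) \<le> d t0 \<bullet> d t0"
    by (simp add: h_def)
  then have "(d t \<bullet> d t) * exp (- (2 * L * (t - t0))) * exp (2 * L * (t - t0))
      \<le> (d t0 \<bullet> d t0) * exp (2 * L * (t - t0))"
    by (rule mult_right_mono) simp
  then have "(norm (d t))\<^sup>2 \<le> (norm (d t0) * exp (L * (t - t0)))\<^sup>2"
    by (simp add: dot_square_norm power_mult_distrib exp_double[symmetric] mult.assoc flip: exp_add)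
  then show ?thesis
    by (rule power2_le_imp_le) simp
qed

lemma has_vector_derivative_reflect:
  assumes "(d has_vector_derivative d') (at (- s))"
  shows "((\<lambda>s. d (- s)) has_vector_derivative - d') (at s)"
proof -
  have "((\<lambda>s::real. - s) has_vector_derivative - 1) (at s)"
    by (auto intro!: derivative_eq_intros)
  from vector_diff_chain_at[OF this assms] show ?thesis
    by (simp add: o_def)
qed

text \<open>The norm can grow at most exponentially because the derivative of the squared norm is at
  most \<open>2L\<close> times the squared norm. This gives both uniqueness of solutions and a priori bounds.\<close>

lemma gronwall:
  fixes d :: "real \<Rightarrow> 'v::real_inner"
  assumes I: "is_interval I" "t0 \<in> I" "t \<in> I"
    and der: "\<And>s. s \<in> I \<Longrightarrow> (d has_vector_derivative d' s) (at s)"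
    and le: "\<And>s. s \<in> I \<Longrightarrow> norm (d' s) \<le> L * norm (d s)"
  shows "norm (d t) \<le> norm (d t0) * exp (L * \<bar>t - t0\<bar>)"
proof (cases "t0 \<le> t")
  case True
  have "s \<in> I" if "t0 \<le> s" "s \<le> t" for s
    using I that by (metis mem_is_interval_1_I)
  then show ?thesis
    using gronwall_forward[OF True, of d d' L] der le True by simp
next
  case False
  have "s \<in> I" if "t \<le> s" "s \<le> t0" for s
    using I that by (metis mem_is_interval_1_I)
  then have "norm (d (- (- t))) \<le> norm (d (- (- t0))) * exp (L * (- t - - t0))"
    by (intro gronwall_forward[of "- t0" "- t" "\<lambda>s. d (- s)" "\<lambda>s. - d' (- s)"])
       (use False in \<open>auto intro!: has_vector_derivative_reflect der le\<close>)
  then show ?thesis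
    using False by simp
qed

lemma antiderivative_on_reals:
  fixes g :: "real \<Rightarrow> 'e::euclidean_space"
  assumes "continuous_on UNIV g"
  shows "\<exists>G. G t0 = 0 \<and> (\<forall>t. (G has_vector_derivative g t) (at t))"
proof -
  let ?G = "\<lambda>u::real. LBINT y=t0..u. g y"
  have "(?G has_vector_derivative g t) (at t)" for t
  proof -
    let ?a = "min t t0 - 1" and ?b = "max t t0 + 1"
    have "(?G has_vector_derivative g t) (at t within {?a..?b})"
      by (rule interval_integral_FTC2) (auto intro: continuous_on_subset[OF assms])
    then show ?thesis
      using at_within_Icc_at[of ?a t ?b] by simp
  qed
  then show ?thesis
    by (intro exI[of _ ?G] conjI allI) simp_all
qed

text \<open>Integrating an exponential bound of rate \<open>a\<close> gains the factor \<open>1 / a\<close>. This is what makes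
  the Picard operator below a contraction.\<close>

lemma exponential_bound_forward:
  fixes D :: "real \<Rightarrow> 'v::real_normed_vector"
  assumes "t0 \<le> t" "a > 0" "K \<ge> 0" "D t0 = 0"
    and der: "\<And>s. (D has_vector_derivative d s) (at s)"
    and le: "\<And>s. t0 \<le> s \<Longrightarrow> norm (d s) \<le> K * exp (a * (s - t0))"
  shows "norm (D t) \<le> K / a * exp (a * (t - t0))"
proof (cases "t0 = t")
  case True
  then show ?thesis using assms by simp
next
  case False
  have "norm (D t - D t0) \<le> K / a * exp (a * (t - t0)) - K / a * exp (a * (t0 - t0))"
  proof (rule differentiable_bound_general[where \<phi>' = "\<lambda>s. K * exp (a * (s - t0))"])
    show "continuous_on {t0..t} D"
      using der by (meson continuous_at_imp_continuous_on has_vector_derivative_continuous)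
    show "((\<lambda>s. K / a * exp (a * (s - t0))) has_vector_derivative K * exp (a * (s - t0))) (at s)" for s
      unfolding has_real_derivative_iff_has_vector_derivative[symmetric]
      using \<open>a > 0\<close> by (auto intro!: derivative_eq_intros)
  qed (use assms False in \<open>auto intro!: continuous_intros\<close>)
  then show ?thesis
    using assms by (smt (verit, best) divide_nonneg_pos exp_ge_zero mult_nonneg_nonneg diff_zero)
qed

lemma exponential_bound:
  fixes D :: "real \<Rightarrow> 'v::real_normed_vector"
  assumes "a > 0" "K \<ge> 0" "D t0 = 0"
    and der: "\<And>s. (D has_vector_derivative d s) (at s)"
    and le: "\<And>s. norm (d s) \<le> K * exp (a * \<bar>s - t0\<bar>)"
  shows "norm (D t) \<le> K / a * exp (a * \<bar>t - t0\<bar>)"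
proof (cases "t0 \<le> t")
  case True
  then show ?thesis
    using exponential_bound_forward[OF True assms(1-4)] le by (smt (verit))
next
  case False
  have "norm (D (- (- t))) \<le> K / a * exp (a * (- t - - t0))"
  proof (rule exponential_bound_forward[where D = "\<lambda>s. D (- s)" and d = "\<lambda>s. - d (- s)"])
    show "norm (- d (- s)) \<le> K * exp (a * (s - - t0))" if "- t0 \<le> s" for s
      using le[of "- s"] that by (cases "s = - t0") (simp_all add: abs_if add.commute split: if_splits)
  qed (use False assms in \<open>auto intro!: has_vector_derivative_reflect der\<close>)
  then show ?thesis
    using False by simp
qed

text \<open>For a field that is bounded and Lipschitz in space, the Picard operator is a contraction on
  all of \<open>\<real>\<close> at once in the weighted norm \<open>sup \<bar>x t\<bar> exp (- a \<bar>t - t0\<bar>)\<close>, for a large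
  rate \<open>a\<close>. The fixed point below is the solution multiplied by this weight.\<close>

theorem global_solution_bounded_lipschitz:
  fixes F :: "real \<Rightarrow> 'e::euclidean_space \<Rightarrow> 'e"
  assumes cont: "continuous_on UNIV (\<lambda>p. F (fst p) (snd p))"
    and bdd: "\<And>t z. norm (F t z) \<le> B"
    and lip: "\<And>t z z'. norm (F t z - F t z') \<le> L * norm (z - z')"
  shows "\<exists>x. x t0 = x0 \<and> (\<forall>t. (x has_vector_derivative F t (x t)) (at t))"
proof -
  \<comment> \<open>The rate \<open>a \<ge> 2\<bar>L\<bar>\<close> makes the contraction constant \<open>\<bar>L\<bar> / a \<le> 1/2\<close>, and \<open>a > 0\<close> even for \<open>L = 0\<close>.\<close>
  define a where "a = 2 * (\<bar>L\<bar> + 1)"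
  define w where "w t = exp (a * \<bar>t - t0\<bar>)" for t
  have a: "a > 0" and w: "w t > 0" "w t \<ge> 1" for t
    by (auto simp: a_def w_def)
  have cw: "continuous_on UNIV w"
    unfolding w_def by (intro continuous_intros)
  define J where "J g = (SOME G. G t0 = 0 \<and> (\<forall>t. (G has_vector_derivative g t) (at t)))"
    for g :: "real \<Rightarrow> 'e"
  have J: "J g t0 = 0" "(J g has_vector_derivative g t) (at t)" if "continuous_on UNIV g" for g t
    using someI_ex[OF antiderivative_on_reals[OF that, of t0]] unfolding J_def by auto
  define \<Gamma> where "\<Gamma> u = (\<lambda>s. F s (w s *\<^sub>R apply_bcontfun u s))" for u :: "real \<Rightarrow>\<^sub>C 'e"
  have c\<Gamma>: "continuous_on UNIV (\<Gamma> u)" for u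
  proof -
    have "continuous_on UNIV (\<lambda>s. (\<lambda>p. F (fst p) (snd p)) (s, w s *\<^sub>R apply_bcontfun u s))"
      by (rule continuous_on_compose2[OF cont]) (auto intro!: continuous_intros cw)
    then show ?thesis by (simp add: \<Gamma>_def)
  qed
  have B: "B \<ge> 0"
    using bdd[of 0 0] norm_ge_zero order_trans by blast
  have bJ: "norm (J (\<Gamma> u) t) \<le> B / a * w t" for u t
    unfolding w_def
  proof (rule exponential_bound[OF a B J(1)[OF c\<Gamma>] J(2)[OF c\<Gamma>]])
    fix s
    show "norm (\<Gamma> u s) \<le> B * exp (a * \<bar>s - t0\<bar>)"
      using bdd[of s] w(2)[of s] B unfolding \<Gamma>_def w_def
      by (metis mult_left_mono mult.right_neutral order_trans)
  qed
  define \<Phi> where "\<Phi> u = (\<lambda>t. (1 / w t) *\<^sub>R (x0 + J (\<Gamma> u) t))" for u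
  have b\<Phi>: "\<Phi> u \<in> bcontfun" for u
  proof (rule bcontfun_normI)
    have "continuous_on UNIV (J (\<Gamma> u))"
      using J(2)[OF c\<Gamma>] by (meson continuous_at_imp_continuous_on has_vector_derivative_continuous)
    then show "continuous_on UNIV (\<Phi> u)"
      unfolding \<Phi>_def using w by (intro continuous_intros cw) (auto simp: less_imp_neq[symmetric])
    fix t
    have "norm (x0 + J (\<Gamma> u) t) \<le> norm x0 + B / a * w t"
      using bJ[of u t] norm_triangle_ineq[of x0] by (meson add_left_mono order_trans)
    also have "\<dots> \<le> (norm x0 + B / a) * w t"
      using w(2)[of t] by (simp add: algebra_simps mult_le_cancel_left1)
    finally show "norm (\<Phi> u t) \<le> norm x0 + B / a"
      using w(1)[of t] by (simp add: \<Phi>_def pos_divide_le_eq del: scaleR_add_right)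
  qed
  have "\<exists>!u. Bcontfun (\<Phi> u) = u"
  proof (rule banach_fix_type[of "1/2"])
    show "\<forall>u v. dist (Bcontfun (\<Phi> u)) (Bcontfun (\<Phi> v)) \<le> 1 / 2 * dist u v"
    proof (intro allI dist_bound)
      fix u v t
      have "norm (J (\<Gamma> u) t - J (\<Gamma> v) t) \<le> (\<bar>L\<bar> * dist u v) / a * exp (a * \<bar>t - t0\<bar>)"
      proof (rule exponential_bound[OF a, where d = "\<lambda>s. \<Gamma> u s - \<Gamma> v s"])
        show "((\<lambda>t. J (\<Gamma> u) t - J (\<Gamma> v) t) has_vector_derivative \<Gamma> u s - \<Gamma> v s) (at s)" for s
          by (intro has_vector_derivative_diff J c\<Gamma>)
        fix s
        have "norm (\<Gamma> u s - \<Gamma> v s) \<le> L * norm (w s *\<^sub>R apply_bcontfun u s - w s *\<^sub>R apply_bcontfun v s)"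
          unfolding \<Gamma>_def by (rule lip)
        also have "\<dots> = L * (w s * dist (apply_bcontfun u s) (apply_bcontfun v s))"
          using w(1)[of s] by (simp add: dist_norm flip: scaleR_diff_right)
        also have "\<dots> \<le> \<bar>L\<bar> * (w s * dist u v)"
          using w(1)[of s] by (intro mult_mono dist_bounded) auto
        finally show "norm (\<Gamma> u s - \<Gamma> v s) \<le> \<bar>L\<bar> * dist u v * exp (a * \<bar>s - t0\<bar>)"
          by (simp add: w_def mult_ac)
      qed (use J(1) c\<Gamma> in auto)
      also have "\<dots> \<le> 1 / 2 * dist u v * w t"
      proof -
        have "\<bar>L\<bar> / a \<le> 1 / 2"
          by (simp add: a_def field_simps)
        then have "\<bar>L\<bar> / a * (dist u v * w t) \<le> 1 / 2 * (dist u v * w t)"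
          using w(1)[of t] by (intro mult_right_mono) auto
        then show ?thesis by (simp add: w_def mult_ac)
      qed
      finally have *: "norm (J (\<Gamma> u) t - J (\<Gamma> v) t) / w t \<le> 1 / 2 * dist u v"
        using w(1)[of t] by (simp add: field_simps)
      have "dist (apply_bcontfun (Bcontfun (\<Phi> u)) t) (apply_bcontfun (Bcontfun (\<Phi> v)) t)
          = norm ((1 / w t) *\<^sub>R (J (\<Gamma> u) t - J (\<Gamma> v) t))"
        by (simp add: Bcontfun_inverse b\<Phi> dist_norm) (simp add: \<Phi>_def flip: scaleR_diff_right)
      then show "dist (apply_bcontfun (Bcontfun (\<Phi> u)) t) (apply_bcontfun (Bcontfun (\<Phi> v)) t)
          \<le> 1 / 2 * dist u v"
        using * w(1)[of t] by simp
    qed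
  qed auto
  then obtain u where u: "Bcontfun (\<Phi> u) = u" by blast
  define x where "x t = w t *\<^sub>R apply_bcontfun u t" for t
  have x: "x t = x0 + J (\<Gamma> u) t" for t
  proof -
    have "apply_bcontfun u t = \<Phi> u t"
      by (metis u Bcontfun_inverse b\<Phi>)
    then show ?thesis
      using w(1)[of t] by (simp add: x_def \<Phi>_def)
  qed
  have "(x has_vector_derivative F t (x t)) (at t)" for t
  proof -
    have "((\<lambda>t. x0 + J (\<Gamma> u) t) has_vector_derivative \<Gamma> u t) (at t)"
      using J(2)[OF c\<Gamma>, of u t] by (auto intro!: derivative_eq_intros)
    then show ?thesis
      by (simp add: x[abs_def, symmetric]) (simp add: \<Gamma>_def x_def)
  qed
  moreover have "x t0 = x0"
    by (simp add: x J(1)[OF c\<Gamma>])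
  ultimately show ?thesis by blast
qed

lemma has_vector_derivative_cong_open:
  assumes "open S" "t \<in> S" "\<And>s. s \<in> S \<Longrightarrow> f s = g s"
  shows "(f has_vector_derivative v) (at t) \<longleftrightarrow> (g has_vector_derivative v) (at t)"
  using has_vector_derivative_transform_within_open[OF _ assms(1,2)] assms(3) by metis

lemma open_interval_Int: "open_interval I \<Longrightarrow> open_interval J \<Longrightarrow> t \<in> I \<inter> J \<Longrightarrow> open_interval (I \<inter> J)"
  by (auto simp: open_interval_def is_interval_Int)

lemma open_interval_ball: "r > 0 \<Longrightarrow> open_interval (ball t r)" for t r :: real
  by (simp add: open_interval_def is_interval_ball_real)

text \<open>The equation is solved on all of \<open>\<real>\<close> after composing the field with the projection to a ball
  larger than the a priori bound \<open>K\<close>.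
  The component of \<open>t0\<close> among the times at which that solution stays in this larger ball is open and
  closed, since a solution of the original equation does not even leave the smaller one.\<close>

lemma solution_on_ball:
  fixes F :: "'v::euclidean_space \<Rightarrow> 'v"
  assumes lip: "\<And>R. \<exists>L. \<forall>z\<in>cball 0 R. \<forall>z'\<in>cball 0 R. norm (F z - F z') \<le> L * norm (z - z')"
    and K: "\<And>I x t. solves F I x \<Longrightarrow> t0 \<in> I \<Longrightarrow> x t0 = x0 \<Longrightarrow> t \<in> I \<Longrightarrow> \<bar>t - t0\<bar> \<le> r \<Longrightarrow> norm (x t) \<le> K"
    and "r > 0" "norm x0 \<le> K"
  shows "\<exists>y. y t0 = x0 \<and> solves F (ball t0 r) y"
proof -
  have K0: "K \<ge> 0" using assms(4) norm_ge_zero order_trans by blast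
  define P where "P = closest_point (cball (0::'v) (K + 1))"
  have P: "P z \<in> cball 0 (K + 1)" for z
    unfolding P_def using K0 by (intro closest_point_in_set) auto
  have P_id: "P z = z" if "norm z \<le> K + 1" for z
    unfolding P_def using that by (intro closest_point_self) auto
  have P_lip: "norm (P z - P z') \<le> norm (z - z')" for z z'
    using closest_point_lipschitz[of "cball (0::'v) (K + 1)" z z'] K0
    by (simp add: P_def dist_norm)
  obtain L0 where L0: "\<And>z z'. z \<in> cball 0 (K + 1) \<Longrightarrow> z' \<in> cball 0 (K + 1) \<Longrightarrow> norm (F z - F z') \<le> L0 * norm (z - z')"
    using lip by blast
  have L: "norm (F (P z) - F (P z')) \<le> \<bar>L0\<bar> * norm (z - z')" for z z'
  proof -
    have "norm (F (P z) - F (P z')) \<le> L0 * norm (P z - P z')"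
      by (rule L0[OF P P])
    also have "\<dots> \<le> \<bar>L0\<bar> * norm (z - z')"
      using P_lip by (intro mult_mono) auto
    finally show ?thesis .
  qed
  have contF: "continuous_on UNIV (\<lambda>z. F (P z))"
    by (rule lipschitz_on_continuous_on[of "\<bar>L0\<bar>"]) (use L in \<open>auto intro!: lipschitz_onI simp: dist_norm\<close>)
  have bd: "norm (F (P z)) \<le> norm (F (P 0)) + \<bar>L0\<bar> * (K + 1)" for z
  proof -
    have "P 0 = 0" using K0 by (intro P_id) simp
    then have "norm (F (P z) - F (P 0)) \<le> L0 * norm (P z)"
      using L0[OF P P, of z 0] by simp
    also have "\<dots> \<le> \<bar>L0\<bar> * (K + 1)"
      using P[of z] by (intro mult_mono) auto
    finally show ?thesis
      using norm_triangle_sub[of "F (P z)" "F (P 0)"] by linarith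
  qed
  have "\<exists>y. y t0 = x0 \<and> (\<forall>t. (y has_vector_derivative F (P (y t))) (at t))"
  proof (rule global_solution_bounded_lipschitz[OF _ bd L])
    show "continuous_on UNIV (\<lambda>p::real \<times> 'v. F (P (snd p)))"
      by (rule continuous_on_compose2[OF contF]) (auto intro: continuous_intros)
  qed
  then obtain y where y0: "y t0 = x0" and y: "\<And>t. (y has_vector_derivative F (P (y t))) (at t)"
    by blast
  have cy: "continuous_on UNIV y"
    using y by (meson continuous_at_imp_continuous_on has_vector_derivative_continuous)
  define U where "U = {s. s \<in> ball t0 r \<and> norm (y s) < K + 1}"
  have "open {s. norm (y s) < K + 1}"
    using cy by (intro open_Collect_less continuous_intros)
  moreover have "U = ball t0 r \<inter> {s. norm (y s) < K + 1}"
    by (auto simp: U_def)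
  ultimately have U: "open U"
    by auto
  have t0U: "t0 \<in> U" using y0 assms by (simp add: U_def)
  define C where "C = connected_component_set U t0"
  have CU: "C \<subseteq> U" unfolding C_def by (rule connected_component_subset)
  have C: "open C" "connected C" "t0 \<in> C"
    using U t0U by (auto simp: C_def open_connected_component)
  have solC: "solves F C y"
    unfolding solves_def open_interval_def
  proof (intro conjI ballI)
    fix t assume "t \<in> C"
    then have "norm (y t) \<le> K + 1" using CU by (auto simp: U_def)
    then show "(y has_vector_derivative F (y t)) (at t)"
      using y[of t] by (simp add: P_id)
  qed (use C in \<open>auto simp: is_interval_connected_1\<close>)
  have "C = ball t0 r"
  proof (rule ccontr)
    assume ne: "C \<noteq> ball t0 r"
    have sub: "C \<subseteq> ball t0 r" using CU by (auto simp: U_def)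
    have "\<exists>s. s \<in> ball t0 r \<and> s \<notin> C \<and> s \<in> closure C"
    proof (rule ccontr)
      assume "\<not> ?thesis"
      then have "closedin (top_of_set (ball t0 r)) C"
        unfolding closedin_closed using sub closure_subset[of C]
        by (intro exI[of _ "closure C"]) auto
      moreover have "openin (top_of_set (ball t0 r)) C"
        using C sub by (simp add: open_subset)
      ultimately show False
        using ne C(3) connected_ball[of t0 r] unfolding connected_clopen by fast
    qed
    then obtain s where s: "s \<in> ball t0 r" "s \<notin> C" "s \<in> closure C" by blast
    have "norm (y t) \<le> K" if "t \<in> C" for t
    proof -
      have "\<bar>t - t0\<bar> \<le> r" using that sub by (auto simp: dist_real_def)
      then show ?thesis using K[OF solC C(3) y0 that] by simp
    qed
    then have "closure C \<subseteq> {t. norm (y t) \<le> K}"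
      by (intro closure_minimal closed_Collect_le continuous_intros cy) auto
    then have "s \<in> U" using s by (auto simp: U_def)
    moreover have "connected (insert s C)"
      by (rule connected_intermediate_closure[of C]) (use C(2) s(3) closure_subset[of C] in auto)
    ultimately have "insert s C \<subseteq> connected_component_set U t0"
      using C(3) CU by (intro connected_component_maximal) simp_all
    then show False using s(2) by (simp add: C_def)
  qed
  then show ?thesis using solC y0 by blast
qed

lemma glue_increasing_balls:
  assumes "\<And>n m t. n \<le> m \<Longrightarrow> \<bar>t - t0\<bar> < real (Suc n) \<Longrightarrow> f n t = f m t"
  shows "\<exists>g. \<forall>n t. \<bar>t - t0\<bar> < real (Suc n) \<longrightarrow> g t = f n t"
proof (intro exI allI impI)
  fix n t assume "\<bar>t - t0\<bar> < real (Suc n)"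
  moreover have "\<bar>t - t0\<bar> < real (Suc (nat \<lceil>\<bar>t - t0\<bar>\<rceil>))" by linarith
  ultimately show "f (nat \<lceil>\<bar>t - t0\<bar>\<rceil>) t = f n t"
    using assms[of n "nat \<lceil>\<bar>t - t0\<bar>\<rceil>" t] assms[of "nat \<lceil>\<bar>t - t0\<bar>\<rceil>" n t] by (metis le_cases)
qed

text \<open>A bound that depends only on the initial value and on the length of time excludes blow-up in
  finite time. The solutions on the balls of radius \<open>n + 1\<close> fit together by uniqueness, for which
  the same bound provides a Lipschitz constant.\<close>

theorem complete_field_of_a_priori_bounds:
  fixes F :: "'v::euclidean_space \<Rightarrow> 'v"
  assumes lip: "\<And>R. \<exists>L. \<forall>z\<in>cball 0 R. \<forall>z'\<in>cball 0 R. norm (F z - F z') \<le> L * norm (z - z')"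
    and bound: "\<And>x0 r. \<exists>K. \<forall>I x t0 t. solves F I x \<and> t0 \<in> I \<and> x t0 = x0 \<and> t \<in> I \<and> \<bar>t - t0\<bar> \<le> r
      \<longrightarrow> norm (x t) \<le> K"
  shows "complete_field F"
  unfolding complete_field_def
proof (intro allI impI)
  fix I x assume x: "solves F I x"
  then obtain t0 where t0: "t0 \<in> I" by (auto simp: solves_def open_interval_def)
  obtain K0 where K0: "\<And>r I' y t1 t. solves F I' y \<Longrightarrow> t1 \<in> I' \<Longrightarrow> y t1 = x t0 \<Longrightarrow> t \<in> I' \<Longrightarrow> \<bar>t - t1\<bar> \<le> r
      \<Longrightarrow> norm (y t) \<le> K0 r"
    using bound[of "x t0"] by metis
  have unique: "y t = z t" if "solves F I1 y" "solves F I2 z" "y t0 = x t0" "z t0 = x t0"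
    "t0 \<in> I1" "t0 \<in> I2" "t \<in> I1" "t \<in> I2" for I1 I2 y z t
  proof -
    let ?C = "closed_segment t0 t"
    define R where "R = K0 \<bar>t - t0\<bar>"
    have seg: "?C \<subseteq> I1" "?C \<subseteq> I2"
      using that is_interval_convex unfolding solves_def open_interval_def
      by (metis closed_segment_subset)+
    obtain L where L: "\<And>z z'. z \<in> cball 0 R \<Longrightarrow> z' \<in> cball 0 R \<Longrightarrow> norm (F z - F z') \<le> L * norm (z - z')"
      using lip by blast
    have le: "\<bar>s - t0\<bar> \<le> \<bar>t - t0\<bar>" if "s \<in> ?C" for s
      using that by (auto simp: closed_segment_eq_real_ivl split: if_splits)
    have "norm (y t - z t) \<le> norm (y t0 - z t0) * exp (L * \<bar>t - t0\<bar>)"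
    proof (rule gronwall[of ?C _ _ "\<lambda>s. y s - z s" "\<lambda>s. F (y s) - F (z s)"])
      fix s assume s: "s \<in> ?C"
      show "((\<lambda>s. y s - z s) has_vector_derivative F (y s) - F (z s)) (at s)"
        using s seg that by (auto intro!: has_vector_derivative_diff simp: solves_def)
      have "y s \<in> cball 0 R" "z s \<in> cball 0 R"
        using K0[OF that(1) that(5) that(3), of s] K0[OF that(2) that(6) that(4), of s] s seg le[OF s]
        by (auto simp: R_def)
      then show "norm (F (y s) - F (z s)) \<le> L * norm (y s - z s)" by (rule L)
    qed (auto simp: is_interval_convex_1)
    then show ?thesis using that by simp
  qed
  have "\<exists>y. y t0 = x t0 \<and> solves F (ball t0 (real (Suc n))) y" for n
  proof (rule solution_on_ball[where F = F, OF lip])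
    show "norm (x t0) \<le> K0 (real (Suc n))"
      using K0[OF x t0 refl t0, of "real (Suc n)"] by simp
  qed (use K0 in auto)
  then obtain f where f: "\<And>n. f n t0 = x t0" "\<And>n. solves F (ball t0 (real (Suc n))) (f n)"
    by metis
  have "f n t = f m t" if "n \<le> m" "\<bar>t - t0\<bar> < real (Suc n)" for n m t
    using that by (intro unique[OF f(2) f(2) f(1) f(1)]) (auto simp: dist_real_def)
  then obtain g where g: "\<And>n t. \<bar>t - t0\<bar> < real (Suc n) \<Longrightarrow> g t = f n t"
    using glue_increasing_balls[of t0 f] by blast
  have large: "\<exists>n. \<bar>t - t0\<bar> < real (Suc n)" for t
    using reals_Archimedean2[of "\<bar>t - t0\<bar>"] by (metis less_trans lessI of_nat_less_iff)
  have "solves F UNIV g"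
    unfolding solves_def
  proof (intro conjI ballI)
    show "open_interval UNIV" by (simp add: open_interval_def)
    fix t
    obtain n where n: "\<bar>t - t0\<bar> < real (Suc n)" using large by blast
    have "(f n has_vector_derivative F (f n t)) (at t)"
      using f(2)[of n] n by (auto simp: solves_def dist_real_def abs_minus_commute)
    moreover have "(f n has_vector_derivative F (f n t)) (at t) \<longleftrightarrow> (g has_vector_derivative F (f n t)) (at t)"
      by (rule has_vector_derivative_cong_open[of "ball t0 (real (Suc n))"])
         (use n g[of _ n] in \<open>auto simp: dist_real_def abs_minus_commute\<close>)
    ultimately show "(g has_vector_derivative F (g t)) (at t)" using g[OF n] by simp
  qed
  moreover have "g t = x t" if "t \<in> I" for t
  proof -
    obtain n where n: "\<bar>t - t0\<bar> < real (Suc n)" using large by blast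
    show ?thesis
      unfolding g[OF n] using n that
      by (intro unique[OF f(2) x f(1) refl _ t0]) (auto simp: dist_real_def)
  qed
  ultimately show "\<exists>y. solves F UNIV y \<and> (\<forall>t\<in>I. y t = x t)" by blast
qed

unbundle cross3_syntax

section \<open>Fields \<open>Mv \<times> Nv\<close> with symmetric \<open>M\<close>, \<open>N\<close>\<close>

lemma constant_on_interval:
  fixes f :: "real \<Rightarrow> real"
  assumes "is_interval I" "s \<in> I" "t \<in> I" "\<And>s. s \<in> I \<Longrightarrow> (f has_vector_derivative 0) (at s)"
  shows "f s = f t"
proof -
  have conv: "convex I" using assms(1) by (simp add: is_interval_convex_1)
  have der: "(f has_vector_derivative 0) (at x within I)" if "x \<in> I" for x
    using assms(4)[OF that] by (rule has_vector_derivative_at_within)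
  show ?thesis
    using has_vector_derivative_zero_constant[OF conv der] assms(2,3) by metis
qed

text \<open>If the form \<open>m2 b\<^sup>2 + 2 m b c + m3 c\<^sup>2\<close>, which is conserved, is definite, it bounds \<open>b\<close> and \<open>c\<close>.
  If it is degenerate, then even \<open>m2 b + m c\<close> and \<open>m b + m3 c\<close> are constant, and the system is
  linear.\<close>

lemma planar_system_bound:
  fixes m2 m m3 b0 c0 r :: real
  assumes "m\<^sup>2 \<le> m2 * m3"
  shows "\<exists>B. \<forall>I b c t0 t.
    is_interval I \<and> t0 \<in> I \<and> t \<in> I \<and> \<bar>t - t0\<bar> \<le> r \<and> b t0 = b0 \<and> c t0 = c0 \<and>
    (\<forall>s\<in>I. (b has_real_derivative (m * b s + m3 * c s) * c s) (at s)) \<and>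
    (\<forall>s\<in>I. (c has_real_derivative - (m2 * b s + m * c s) * c s) (at s))
    \<longrightarrow> \<bar>b t\<bar> \<le> B \<and> \<bar>c t\<bar> \<le> B"
proof (cases "m\<^sup>2 = m2 * m3")
  case True
  define L where "L = \<bar>m * b0 + m3 * c0\<bar> + \<bar>m2 * b0 + m * c0\<bar>"
  show ?thesis
  proof (intro exI[of _ "norm (b0, c0) * exp (L * r)"] allI impI, elim conjE)
    fix I b c and t0 t :: real
    assume I: "is_interval I" "t0 \<in> I" "t \<in> I" and r: "\<bar>t - t0\<bar> \<le> r"
      and init: "b t0 = b0" "c t0 = c0"
      and b: "\<forall>s\<in>I. (b has_real_derivative (m * b s + m3 * c s) * c s) (at s)"
      and c: "\<forall>s\<in>I. (c has_real_derivative - (m2 * b s + m * c s) * c s) (at s)"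
    have P: "m2 * b s + m * c s = m2 * b0 + m * c0" and R: "m * b s + m3 * c s = m * b0 + m3 * c0"
      if s: "s \<in> I" for s
    proof -
      have "((\<lambda>s. m2 * b s + m * c s) has_vector_derivative 0) (at s)"
        and "((\<lambda>s. m * b s + m3 * c s) has_vector_derivative 0) (at s)" if "s \<in> I" for s
      proof -
        have "m2 * ((m * b s + m3 * c s) * c s) + m * (- (m2 * b s + m * c s) * c s)
            = (m2 * m3 - m\<^sup>2) * (c s)\<^sup>2"
          by (simp add: algebra_simps power2_eq_square)
        then have 1: "m2 * ((m * b s + m3 * c s) * c s) + m * (- (m2 * b s + m * c s) * c s) = 0"
          using True by simp
        have "m * ((m * b s + m3 * c s) * c s) + m3 * (- (m2 * b s + m * c s) * c s)
            = (m\<^sup>2 - m2 * m3) * (b s * c s)"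
          by (simp add: algebra_simps power2_eq_square)
        then have 2: "m * ((m * b s + m3 * c s) * c s) + m3 * (- (m2 * b s + m * c s) * c s) = 0"
          using True by simp
        show "((\<lambda>s. m2 * b s + m * c s) has_vector_derivative 0) (at s)"
          unfolding has_real_derivative_iff_has_vector_derivative[symmetric]
          using DERIV_add[OF DERIV_cmult[OF b[rule_format, OF that], of m2]
              DERIV_cmult[OF c[rule_format, OF that], of m]] unfolding 1 by simp
        show "((\<lambda>s. m * b s + m3 * c s) has_vector_derivative 0) (at s)"
          unfolding has_real_derivative_iff_has_vector_derivative[symmetric]
          using DERIV_add[OF DERIV_cmult[OF b[rule_format, OF that], of m]
              DERIV_cmult[OF c[rule_format, OF that], of m3]] unfolding 2 by simp
      qed
      from constant_on_interval[OF I(1) s I(2) this(1)] constant_on_interval[OF I(1) s I(2) this(2)]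
      show "m2 * b s + m * c s = m2 * b0 + m * c0" "m * b s + m3 * c s = m * b0 + m3 * c0"
        using init by auto
    qed
    have "norm (b t, c t) \<le> norm (b t0, c t0) * exp (L * \<bar>t - t0\<bar>)"
    proof (rule gronwall[OF I])
      fix s assume s: "s \<in> I"
      show "((\<lambda>s. (b s, c s)) has_vector_derivative
          ((m * b0 + m3 * c0) * c s, - (m2 * b0 + m * c0) * c s)) (at s)"
        using b[rule_format, OF s] c[rule_format, OF s]
        unfolding has_real_derivative_iff_has_vector_derivative P[OF s] R[OF s]
        by (rule has_vector_derivative_Pair)
      have "norm ((m * b0 + m3 * c0) * c s, - (m2 * b0 + m * c0) * c s)
          \<le> norm ((m * b0 + m3 * c0) * c s) + norm (- (m2 * b0 + m * c0) * c s)"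
        by (rule norm_Pair_le)
      also have "\<dots> = L * \<bar>c s\<bar>"
        unfolding L_def real_norm_def abs_mult[of "m * b0 + m3 * c0"] abs_mult[of "- (m2 * b0 + m * c0)"]
          abs_minus_cancel by (rule distrib_right[symmetric])
      also have "\<dots> \<le> L * norm (b s, c s)"
        using norm_snd_le[where x = "b s" and y = "c s"] by (intro mult_left_mono) (auto simp: L_def)
      finally show "norm ((m * b0 + m3 * c0) * c s, - (m2 * b0 + m * c0) * c s) \<le> L * norm (b s, c s)" .
    qed
    also have "\<dots> \<le> norm (b0, c0) * exp (L * r)"
      using init r by (auto intro!: mult_left_mono simp: L_def)
    finally show "\<bar>b t\<bar> \<le> norm (b0, c0) * exp (L * r) \<and> \<bar>c t\<bar> \<le> norm (b0, c0) * exp (L * r)"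
      using norm_snd_le[where x = "b t" and y = "c t"] norm_fst_le[where x = "b t" and y = "c t"] by auto
  qed
next
  case False
  define \<delta> where "\<delta> = m2 * m3 - m\<^sup>2"
  have \<delta>: "\<delta> > 0" using False assms by (simp add: \<delta>_def)
  define E where "E = m2 * b0\<^sup>2 + 2 * m * b0 * c0 + m3 * c0\<^sup>2"
  define B where "B = sqrt \<bar>m2 * E / \<delta>\<bar> + sqrt \<bar>m3 * E / \<delta>\<bar>"
  show ?thesis
  proof (intro exI[of _ B] allI impI, elim conjE)
    fix I b c and t0 t :: real
    assume I: "is_interval I" "t0 \<in> I" "t \<in> I"
      and init: "b t0 = b0" "c t0 = c0"
      and b: "\<forall>s\<in>I. (b has_real_derivative (m * b s + m3 * c s) * c s) (at s)"
      and c: "\<forall>s\<in>I. (c has_real_derivative - (m2 * b s + m * c s) * c s) (at s)"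
    let ?E = "\<lambda>s. m2 * (b s)\<^sup>2 + 2 * m * b s * c s + m3 * (c s)\<^sup>2"
    have "?E t = ?E t0"
    proof (rule constant_on_interval[OF I(1,3,2)])
      fix s assume s: "s \<in> I"
      note bs = b[rule_format, OF s] and cs = c[rule_format, OF s]
      show "(?E has_vector_derivative 0) (at s)"
        unfolding has_real_derivative_iff_has_vector_derivative[symmetric]
        by (rule derivative_eq_intros bs cs refl)+ (simp add: algebra_simps power2_eq_square)
    qed
    then have E: "?E t = E" by (simp add: E_def init)
    have "m2 * E = (m2 * b t + m * c t)\<^sup>2 + \<delta> * (c t)\<^sup>2"
      unfolding E[symmetric] \<delta>_def by (simp add: algebra_simps power2_eq_square)
    then have "(c t)\<^sup>2 \<le> m2 * E / \<delta>"
      using \<delta> by (simp add: field_simps)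
    moreover have "m3 * E = (m * b t + m3 * c t)\<^sup>2 + \<delta> * (b t)\<^sup>2"
      unfolding E[symmetric] \<delta>_def by (simp add: algebra_simps power2_eq_square)
    then have "(b t)\<^sup>2 \<le> m3 * E / \<delta>"
      using \<delta> by (simp add: field_simps)
    ultimately have "\<bar>c t\<bar> \<le> sqrt \<bar>m2 * E / \<delta>\<bar>" "\<bar>b t\<bar> \<le> sqrt \<bar>m3 * E / \<delta>\<bar>"
      by (auto intro!: real_le_rsqrt order_trans[OF _ abs_ge_self] simp del: abs_divide)
    then show "\<bar>b t\<bar> \<le> B \<and> \<bar>c t\<bar> \<le> B"
      unfolding B_def by (smt (verit) real_sqrt_abs2 real_sqrt_ge_zero abs_ge_zero)
  qed
qed

text \<open>Once \<open>b\<close> and \<open>c\<close> are bounded, the equation for \<open>a\<close> is linear and inhomogeneous with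
  bounded coefficients. The estimate \<open>gronwall\<close> applies to the pair \<open>(a, 1)\<close>, for which it
  is homogeneous.\<close>

lemma triangular_system_bound:
  fixes m2 m m3 e a0 b0 c0 r :: real
  assumes "m\<^sup>2 \<le> m2 * m3"
  shows "\<exists>B. \<forall>I a b c t0 t.
    is_interval I \<and> t0 \<in> I \<and> t \<in> I \<and> \<bar>t - t0\<bar> \<le> r \<and> a t0 = a0 \<and> b t0 = b0 \<and> c t0 = c0 \<and>
    (\<forall>s\<in>I. (a has_real_derivative (m2 * b s + m * c s) * a s - e * b s * (m * b s + m3 * c s)) (at s)) \<and>
    (\<forall>s\<in>I. (b has_real_derivative (m * b s + m3 * c s) * c s) (at s)) \<and>
    (\<forall>s\<in>I. (c has_real_derivative - (m2 * b s + m * c s) * c s) (at s))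
    \<longrightarrow> \<bar>a t\<bar> \<le> B \<and> \<bar>b t\<bar> \<le> B \<and> \<bar>c t\<bar> \<le> B"
proof -
  obtain B where B: "\<And>I b c t0 t. \<lbrakk>is_interval I; t0 \<in> I; t \<in> I; \<bar>t - t0\<bar> \<le> r; b t0 = b0; c t0 = c0;
      \<forall>s\<in>I. (b has_real_derivative (m * b s + m3 * c s) * c s) (at s);
      \<forall>s\<in>I. (c has_real_derivative - (m2 * b s + m * c s) * c s) (at s)\<rbrakk>
      \<Longrightarrow> \<bar>b t\<bar> \<le> B \<and> \<bar>c t\<bar> \<le> B"
    using planar_system_bound[OF assms, of r b0 c0] by metis
  define Q where "Q = (\<bar>m2\<bar> + \<bar>m\<bar> + \<bar>m3\<bar>) * \<bar>B\<bar>"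
  define L where "L = Q + \<bar>e\<bar> * \<bar>B\<bar> * Q"
  define C where "C = norm (a0, 1::real) * exp (L * r)"
  show ?thesis
  proof (intro exI[of _ "max B C"] allI impI, elim conjE)
    fix I a b c and t0 t :: real
    assume I: "is_interval I" "t0 \<in> I" "t \<in> I" and r: "\<bar>t - t0\<bar> \<le> r"
      and init: "a t0 = a0" "b t0 = b0" "c t0 = c0"
      and a: "\<forall>s\<in>I. (a has_real_derivative (m2 * b s + m * c s) * a s - e * b s * (m * b s + m3 * c s)) (at s)"
      and b: "\<forall>s\<in>I. (b has_real_derivative (m * b s + m3 * c s) * c s) (at s)"
      and c: "\<forall>s\<in>I. (c has_real_derivative - (m2 * b s + m * c s) * c s) (at s)"
    let ?J = "closed_segment t0 t"
    have J: "?J \<subseteq> I" using I by (simp add: closed_segment_subset is_interval_convex)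
    have le: "\<bar>b s\<bar> \<le> B" "\<bar>c s\<bar> \<le> B" if "s \<in> ?J" for s
    proof -
      have "\<bar>s - t0\<bar> \<le> r"
        using that r by (auto simp: closed_segment_eq_real_ivl split: if_splits)
      then show "\<bar>b s\<bar> \<le> B" "\<bar>c s\<bar> \<le> B"
        using B[OF I(1,2) _ _ init(2,3) b c, of s] that J by auto
    qed
    have "norm (a t, 1::real) \<le> norm (a t0, 1::real) * exp (L * \<bar>t - t0\<bar>)"
    proof (rule gronwall[of ?J])
      fix s assume s: "s \<in> ?J"
      let ?a' = "(m2 * b s + m * c s) * a s - e * b s * (m * b s + m3 * c s)"
      show "((\<lambda>s. (a s, 1::real)) has_vector_derivative (?a', 0)) (at s)"
        using a[rule_format, of s] s J unfolding has_real_derivative_iff_has_vector_derivative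
        by (intro has_vector_derivative_Pair has_vector_derivative_const) auto
      have bs: "\<bar>b s\<bar> \<le> \<bar>B\<bar>" and cs: "\<bar>c s\<bar> \<le> \<bar>B\<bar>" using le[OF s] by auto
      have lin: "\<bar>x * b s + y * c s\<bar> \<le> (\<bar>x\<bar> + \<bar>y\<bar>) * \<bar>B\<bar>" for x y
      proof -
        have "\<bar>x * b s + y * c s\<bar> \<le> \<bar>x\<bar> * \<bar>b s\<bar> + \<bar>y\<bar> * \<bar>c s\<bar>"
          using abs_triangle_ineq[of "x * b s" "y * c s"] by (simp add: abs_mult)
        also have "\<dots> \<le> \<bar>x\<bar> * \<bar>B\<bar> + \<bar>y\<bar> * \<bar>B\<bar>"
          by (intro add_mono mult_left_mono bs cs) auto
        finally show ?thesis by (simp add: algebra_simps)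
      qed
      have P: "\<bar>m2 * b s + m * c s\<bar> \<le> Q" and R: "\<bar>m * b s + m3 * c s\<bar> \<le> Q"
        unfolding Q_def
        by (rule order_trans[OF lin mult_right_mono]; simp)+
      have Q0: "Q \<ge> 0" by (simp add: Q_def)
      have "\<bar>?a'\<bar> \<le> \<bar>(m2 * b s + m * c s) * a s\<bar> + \<bar>e * b s * (m * b s + m3 * c s)\<bar>"
        by (rule abs_triangle_ineq4)
      also have "\<dots> = \<bar>m2 * b s + m * c s\<bar> * \<bar>a s\<bar> + \<bar>e\<bar> * \<bar>b s\<bar> * \<bar>m * b s + m3 * c s\<bar>"
        by (simp add: abs_mult)
      also have "\<dots> \<le> Q * \<bar>a s\<bar> + \<bar>e\<bar> * \<bar>B\<bar> * Q"
        by (intro add_mono mult_mono P R bs order_refl) (use Q0 in auto)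
      also have "\<dots> \<le> Q * norm (a s, 1::real) + (\<bar>e\<bar> * \<bar>B\<bar> * Q) * norm (a s, 1::real)"
      proof (rule add_mono)
        show "Q * \<bar>a s\<bar> \<le> Q * norm (a s, 1::real)"
          using norm_fst_le[where x = "a s" and y = "1::real"] Q0 by (intro mult_left_mono) auto
        show "\<bar>e\<bar> * \<bar>B\<bar> * Q \<le> (\<bar>e\<bar> * \<bar>B\<bar> * Q) * norm (a s, 1::real)"
          using mult_left_mono[of 1 "norm (a s, 1::real)" "\<bar>e\<bar> * \<bar>B\<bar> * Q"]
            norm_snd_le[where x = "a s" and y = "1::real"] Q0 by simp
      qed
      finally show "norm (?a', 0::real) \<le> L * norm (a s, 1::real)"
        by (simp add: norm_Pair L_def algebra_simps)
    qed (use J in \<open>auto simp: is_interval_convex_1\<close>)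
    also have "\<dots> \<le> C"
      using init r by (auto intro!: mult_left_mono simp: C_def L_def Q_def)
    finally have "\<bar>a t\<bar> \<le> C"
      using norm_fst_le[where x = "a t" and y = "1::real"] by auto
    then show "\<bar>a t\<bar> \<le> max B C \<and> \<bar>b t\<bar> \<le> max B C \<and> \<bar>c t\<bar> \<le> max B C"
      using le[of t] by auto
  qed
qed

lemma expansion_in_dual_basis:
  fixes u f w v :: "real^3"
  shows "(u \<bullet> (f \<times> w)) *\<^sub>R v = (v \<bullet> (f \<times> w)) *\<^sub>R u + (v \<bullet> (w \<times> u)) *\<^sub>R f + (v \<bullet> (u \<times> f)) *\<^sub>R w"
  by (simp add: vec_eq_iff forall_3 cross3_simps)

text \<open>In dimension three a unimodular Lie algebra with a metric amounts to such a pair: \<open>M\<close> gives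
  the bracket, \<open>N\<close> is the inverse of the metric, and \<open>F\<close> is the Euler vector field. Since \<open>F v\<close> is
  orthogonal to \<open>M v\<close> and to \<open>N v\<close>, both quadratic forms are constant along solutions.\<close>

locale symmetric_pair =
  fixes M N :: "real^3^3"
  assumes M_sym: "x \<bullet> (M *v y) = y \<bullet> (M *v x)"
    and N_sym: "x \<bullet> (N *v y) = y \<bullet> (N *v x)"
    and N_inj: "N *v x = 0 \<Longrightarrow> x = 0"
begin

definition F :: "real^3 \<Rightarrow> real^3" where
  "F v = (M *v v) \<times> (N *v v)"

lemma F_lipschitz_on_balls:
  "\<exists>L. \<forall>z\<in>cball 0 R. \<forall>z'\<in>cball 0 R. norm (F z - F z') \<le> L * norm (z - z')"
proof -
  have F: "F = (\<lambda>v. (M *v v) \<times> (N *v v))"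
    by (simp add: F_def fun_eq_iff)
  have bc: "bounded_bilinear (\<times>)"
    using bilinear_cross by (simp add: bilinear_conv_bounded_bilinear)
  have bM: "bounded_linear ((*v) A)" for A :: "real^3^3" by (rule matrix_vector_mul_bounded_linear)
  obtain CM where CM: "\<And>v. norm (M *v v) \<le> norm v * CM" "CM \<ge> 0"
    using bounded_linear.nonneg_bounded[OF bM[of M]] by blast
  obtain CN where CN: "\<And>v. norm (N *v v) \<le> norm v * CN" "CN \<ge> 0"
    using bounded_linear.nonneg_bounded[OF bM[of N]] by blast
  have cr: "norm (x \<times> y) \<le> norm x * norm y" for x y :: "real^3"
    using norm_cross_dot[of x y] by (smt (verit) mult_nonneg_nonneg norm_ge_zero power2_le_imp_le zero_le_power2)
  show ?thesis
  proof (intro exI[of _ "2 * CM * CN * R"] ballI)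
    fix z z' :: "real^3" assume z: "z \<in> cball 0 R" "z' \<in> cball 0 R"
    have "F z - F z' = (M *v (z - z')) \<times> (N *v z) + (M *v z') \<times> (N *v (z - z'))"
      unfolding F_def by (simp add: matrix_vector_mult_diff_distrib Cross3.left_diff_distrib Cross3.right_diff_distrib)
    then have "norm (F z - F z') \<le> norm (M *v (z - z')) * norm (N *v z) + norm (M *v z') * norm (N *v (z - z'))"
      using cr norm_triangle_le[of "(M *v (z - z')) \<times> (N *v z)"] by (metis add_mono)
    also have "\<dots> \<le> (norm (z - z') * CM) * (R * CN) + (R * CM) * (norm (z - z') * CN)"
    proof (intro add_mono mult_mono CM CN)
      show "norm (N *v z) \<le> R * CN" using CN(1)[of z] z CN(2) by (metis mem_cball_0 mult_right_mono order_trans)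
      show "norm (M *v z') \<le> R * CM" using CM(1)[of z'] z CM(2) by (metis mem_cball_0 mult_right_mono order_trans)
      have "R \<ge> 0" using z(1) norm_ge_zero[of z] unfolding mem_cball_0 by linarith
      then show "0 \<le> R * CM" using CM(2) by simp
    qed (use CM CN in auto)
    finally show "norm (F z - F z') \<le> 2 * CM * CN * R * norm (z - z')" by (simp add: algebra_simps)
  qed
qed

lemma conserved:
  assumes "\<And>x y. x \<bullet> (A *v y) = y \<bullet> (A *v x)" "\<And>v. (A *v v) \<bullet> F v = 0"
    and "solves F I x" "s \<in> I" "t \<in> I"
  shows "x s \<bullet> (A *v x s) = x t \<bullet> (A *v x t)"
proof (rule constant_on_interval[of I s t "\<lambda>s. x s \<bullet> (A *v x s)"])
  fix s assume "s \<in> I"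
  then have x: "(x has_vector_derivative F (x s)) (at s)"
    using assms by (auto simp: solves_def)
  have "((\<lambda>s. x s \<bullet> (A *v x s)) has_vector_derivative (x s \<bullet> (A *v F (x s)) + F (x s) \<bullet> (A *v x s))) (at s)"
    by (rule bounded_bilinear.has_vector_derivative[OF bounded_bilinear_inner x])
       (rule bounded_linear.has_vector_derivative[OF matrix_vector_mul_bounded_linear x])
  then show "((\<lambda>s. x s \<bullet> (A *v x s)) has_vector_derivative 0) (at s)"
    using assms(1)[of "x s" "F (x s)"] assms(2)[of "x s"] by (simp add: inner_commute)
qed (use assms in \<open>auto simp: solves_def open_interval_def\<close>)

lemma F_conserves: "(M *v v) \<bullet> F v = 0" "(N *v v) \<bullet> F v = 0"
  by (simp_all add: F_def dot_cross_self)

text \<open>Without a common isotropic vector, \<open>\<bar>vMv\<bar> + \<bar>vNv\<bar>\<close> dominates a multiple of \<open>\<bar>v\<bar>\<^sup>2\<close> by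
  compactness of the sphere, so that the level sets of the two conserved forms are compact.\<close>

lemma bounded_if_anisotropic:
  assumes "\<And>u. u \<bullet> (M *v u) = 0 \<Longrightarrow> u \<bullet> (N *v u) = 0 \<Longrightarrow> u = 0"
  shows "\<exists>K. \<forall>I x t0 t. solves F I x \<and> t0 \<in> I \<and> x t0 = x0 \<and> t \<in> I \<longrightarrow> norm (x t) \<le> K"
proof -
  define g where "g v = \<bar>v \<bullet> (M *v v)\<bar> + \<bar>v \<bullet> (N *v v)\<bar>" for v
  have "continuous_on (sphere 0 1) g"
    unfolding g_def by (intro continuous_intros)
  moreover have "sphere (0::real^3) 1 \<noteq> {}" by simp
  ultimately obtain u where u: "u \<in> sphere 0 1" "\<And>v. v \<in> sphere 0 1 \<Longrightarrow> g u \<le> g v"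
    using continuous_attains_inf[of "sphere (0::real^3) 1" g] compact_sphere by blast
  have "g u \<noteq> 0"
  proof
    assume "g u = 0"
    then have "u = 0" by (intro assms) (auto simp: g_def)
    then show False using u(1) by simp
  qed
  then have pos: "g u > 0" by (smt (verit) g_def abs_ge_zero)
  have le: "(norm v)\<^sup>2 * g u \<le> g v" for v
  proof (cases "v = 0")
    case False
    have "g u \<le> g ((1 / norm v) *\<^sub>R v)"
      using False by (intro u(2)) simp
    also have "\<dots> = g v / (norm v)\<^sup>2"
      by (simp add: g_def matrix_vector_mult_scaleR abs_mult abs_divide add_divide_distrib power2_eq_square)
    finally show ?thesis using False by (simp add: field_simps)
  qed (simp add: g_def)
  show ?thesis
  proof (intro exI[of _ "sqrt (g x0 / g u)"] allI impI, elim conjE)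
    fix I x and t0 t :: real
    assume x: "solves F I x" "t0 \<in> I" "x t0 = x0" "t \<in> I"
    have "g (x t) = g x0"
      using conserved[OF M_sym F_conserves(1) x(1,4,2)] conserved[OF N_sym F_conserves(2) x(1,4,2)] x(3)
      by (simp add: g_def)
    then have "(norm (x t))\<^sup>2 \<le> g x0 / g u"
      using le[of "x t"] pos by (simp add: field_simps)
    then show "norm (x t) \<le> sqrt (g x0 / g u)" by (rule real_le_rsqrt)
  qed
qed

text \<open>At a common isotropic vector both \<open>Mv\<close> and \<open>Nv\<close> are orthogonal to \<open>v\<close>, so that their cross
  product is a multiple of \<open>v\<close>.\<close>

lemma F_zero_at_isotropic:
  assumes "\<nexists>v. idempotent_of F v" "u \<bullet> (M *v u) = 0" "u \<bullet> (N *v u) = 0"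
  shows "F u = 0"
proof (rule ccontr)
  assume ne: "F u \<noteq> 0"
  then have "u \<noteq> 0" by (auto simp: F_def)
  have "u \<times> F u = 0"
    using assms(2,3) by (simp add: F_def Lagrange inner_commute)
  then have "(u \<bullet> F u) *\<^sub>R u = (u \<bullet> u) *\<^sub>R F u"
    using Lagrange[of u u "F u"] by simp
  then have "(u \<bullet> F u) *\<^sub>R u + (- (u \<bullet> u)) *\<^sub>R F u = 0" by simp
  then have "idempotent_of F u"
    using ne \<open>u \<noteq> 0\<close> unfolding idempotent_of_def
    by (intro conjI exI[of _ "u \<bullet> F u"] exI[of _ "- (u \<bullet> u)"]) auto
  then show False using assms(1) by blast
qed

end

text \<open>The vectors \<open>u\<close>, \<open>f = Nu \<times> Nw\<close>, \<open>w\<close> form a basis of determinant one with dual basis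
  \<open>Nw\<close>, \<open>w \<times> u\<close>, \<open>Nu\<close>; in it the form of \<open>N\<close> is \<open>2ac + eb\<^sup>2\<close> and that of \<open>M\<close>
  only depends on \<open>b\<close> and \<open>c\<close>.\<close>

locale isotropic_kernel = symmetric_pair +
  fixes u w f
  assumes Mu: "M *v u = 0" and uNu: "u \<bullet> (N *v u) = 0"
    and uNw: "u \<bullet> (N *v w) = 1" and wNw: "w \<bullet> (N *v w) = 0"
  defines "f \<equiv> (N *v u) \<times> (N *v w)"
begin

lemma dual_basis: "f \<times> w = N *v w" "u \<times> f = N *v u"
proof -
  have "w \<times> f = - (N *v w)"
    unfolding f_def Lagrange using N_sym[of w u] uNw wNw by simp
  then show "f \<times> w = N *v w" by (metis cross_skew minus_minus)
  show "u \<times> f = N *v u"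
    unfolding f_def Lagrange using uNw uNu by simp
qed

lemma f_orthogonal: "f \<bullet> (N *v u) = 0" "f \<bullet> (N *v w) = 0"
  by (simp_all add: f_def dot_cross_self)

lemma expansion: "v = (v \<bullet> (N *v w)) *\<^sub>R u + (v \<bullet> (w \<times> u)) *\<^sub>R f + (v \<bullet> (N *v u)) *\<^sub>R w"
  using expansion_in_dual_basis[of u f w v] by (simp add: dual_basis uNw)

definition "m2 = f \<bullet> (M *v f)"
definition "m = f \<bullet> (M *v w)"
definition "m3 = w \<bullet> (M *v w)"
definition "e = f \<bullet> (N *v f)"

lemma M_pairing:
  "u \<bullet> (M *v v) = 0"
  "f \<bullet> (M *v v) = m2 * (v \<bullet> (w \<times> u)) + m * (v \<bullet> (N *v u))"
  "w \<bullet> (M *v v) = m * (v \<bullet> (w \<times> u)) + m3 * (v \<bullet> (N *v u))"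
proof -
  show "u \<bullet> (M *v v) = 0" by (simp add: M_sym[of u] Mu)
  have "M *v v = (v \<bullet> (w \<times> u)) *\<^sub>R (M *v f) + (v \<bullet> (N *v u)) *\<^sub>R (M *v w)"
    by (subst expansion[of v]) (simp add: matrix_vector_right_distrib matrix_vector_mult_scaleR Mu)
  then show "f \<bullet> (M *v v) = m2 * (v \<bullet> (w \<times> u)) + m * (v \<bullet> (N *v u))"
    "w \<bullet> (M *v v) = m * (v \<bullet> (w \<times> u)) + m3 * (v \<bullet> (N *v u))"
    using M_sym[of w f] by (simp_all add: m2_def m_def m3_def inner_add_right)
qed

lemma N_pairing: "f \<bullet> (N *v v) = e * (v \<bullet> (w \<times> u))"
proof -
  have "N *v v = (v \<bullet> (N *v w)) *\<^sub>R (N *v u) + (v \<bullet> (w \<times> u)) *\<^sub>R (N *v f) + (v \<bullet> (N *v u)) *\<^sub>R (N *v w)"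
    by (subst expansion[of v]) (simp add: matrix_vector_right_distrib matrix_vector_mult_scaleR)
  then show ?thesis
    by (simp add: e_def inner_add_right f_orthogonal)
qed

lemma F_components:
  fixes v
  defines "a \<equiv> v \<bullet> (N *v w)" and "b \<equiv> v \<bullet> (w \<times> u)" and "c \<equiv> v \<bullet> (N *v u)"
  shows "F v \<bullet> (N *v w) = (m2 * b + m * c) * a - e * b * (m * b + m3 * c)"
    and "F v \<bullet> (w \<times> u) = (m * b + m3 * c) * c"
    and "F v \<bullet> (N *v u) = - (m2 * b + m * c) * c"
proof -
  note pair = M_pairing[of v] N_pairing[of v] N_sym[of u v] N_sym[of w v]
  have "F v \<bullet> (N *v w) = (f \<times> w) \<bullet> ((M *v v) \<times> (N *v v))"
    by (simp add: dual_basis F_def inner_commute)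
  then show "F v \<bullet> (N *v w) = (m2 * b + m * c) * a - e * b * (m * b + m3 * c)"
    unfolding dot_cross by (simp add: pair a_def b_def c_def)
  have "F v \<bullet> (w \<times> u) = (w \<times> u) \<bullet> ((M *v v) \<times> (N *v v))"
    by (simp add: F_def inner_commute)
  then show "F v \<bullet> (w \<times> u) = (m * b + m3 * c) * c"
    unfolding dot_cross by (simp add: pair a_def b_def c_def)
  have "F v \<bullet> (N *v u) = (u \<times> f) \<bullet> ((M *v v) \<times> (N *v v))"
    by (simp add: dual_basis F_def inner_commute)
  then show "F v \<bullet> (N *v u) = - (m2 * b + m * c) * c"
    unfolding dot_cross by (simp add: pair a_def b_def c_def algebra_simps)
qed

text \<open>If the discriminant were positive, the form of \<open>M\<close> would vanish along a line of the
  \<open>(b, c)\<close>-plane other than \<open>c = 0\<close>, and the common isotropic vector over it would be a transversal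
  intersection of the two cones, that is, an idempotent.\<close>

lemma discriminant_nonpos:
  assumes "\<nexists>v. idempotent_of F v"
  shows "m\<^sup>2 \<le> m2 * m3"
proof (rule ccontr)
  assume D: "\<not> ?thesis"
  have "\<exists>b. m2 * b\<^sup>2 + 2 * m * b + m3 = 0"
  proof (cases "m2 = 0")
    case True
    then have "m \<noteq> 0" using D by auto
    then show ?thesis using True by (intro exI[of _ "- m3 / (2 * m)"]) simp
  next
    case False
    have "(sqrt (m\<^sup>2 - m2 * m3))\<^sup>2 = m\<^sup>2 - m2 * m3" using D by simp
    then have "m2 * (m2 * ((- m + sqrt (m\<^sup>2 - m2 * m3)) / m2)\<^sup>2 + 2 * m * ((- m + sqrt (m\<^sup>2 - m2 * m3)) / m2) + m3) = 0"
      using False by (simp add: field_simps power2_eq_square)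
    then show ?thesis using False by (metis mult_eq_0_iff)
  qed
  then obtain b where b: "m2 * b\<^sup>2 + 2 * m * b + m3 = 0" by blast
  \<comment> \<open>The coordinate along \<open>u\<close> is the one that makes \<open>2ac + eb\<^sup>2\<close> vanish for \<open>c = 1\<close>.\<close>
  define v where "v = (- (e * b\<^sup>2) / 2) *\<^sub>R u + b *\<^sub>R f + w"
  have Nuf: "u \<bullet> (N *v f) = 0" "w \<bullet> (N *v f) = 0"
    using f_orthogonal N_sym[of u f] N_sym[of w f] by auto
  have 1: "f \<bullet> (w \<times> u) = 1"
  proof -
    have "f \<bullet> (w \<times> u) = u \<bullet> (f \<times> w)" by (simp add: cross3_simps)
    then show ?thesis using dual_basis uNw by simp
  qed
  have comp: "v \<bullet> (N *v w) = - (e * b\<^sup>2) / 2" "v \<bullet> (w \<times> u) = b" "v \<bullet> (N *v u) = 1"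
    using N_sym[of w u] by (simp_all add: v_def inner_add_left inner_diff_left uNu uNw wNw f_orthogonal dot_cross_self 1)
  have lin: "v \<bullet> z = - (e * b\<^sup>2) / 2 * (u \<bullet> z) + b * (f \<bullet> z) + w \<bullet> z" for z
    by (simp add: v_def inner_add_left inner_diff_left)
  have "v \<bullet> (M *v v) = 0"
  proof -
    have "v \<bullet> (M *v v) = b * (m2 * b + m * 1) + (m * b + m3 * 1)"
      using lin[of "M *v v"] M_pairing[of v] comp by simp
    then show ?thesis using b by (simp add: power2_eq_square algebra_simps)
  qed
  moreover have "v \<bullet> (N *v v) = 0"
  proof -
    have "v \<bullet> (N *v v) = - (e * b\<^sup>2) / 2 * (u \<bullet> (N *v v)) + b * (f \<bullet> (N *v v)) + w \<bullet> (N *v v)"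
      by (rule lin)
    then show ?thesis
      using N_pairing[of v] N_sym[of u v] N_sym[of w v] comp by (simp add: power2_eq_square)
  qed
  ultimately have "F v = 0" by (rule F_zero_at_isotropic[OF assms])
  then have "m * b + m3 = 0" "m2 * b + m = 0"
    using F_components[of v] comp by auto
  then have "m3 = - (m * b)" "m = - (m2 * b)" by auto
  then have "m\<^sup>2 = m2 * m3" by (simp add: power2_eq_square)
  then show False using D by simp
qed

lemma bounded_if_no_idempotent:
  assumes "\<nexists>v. idempotent_of F v"
  shows "\<exists>K. \<forall>I x t0 t. solves F I x \<and> t0 \<in> I \<and> x t0 = x0 \<and> t \<in> I \<and> \<bar>t - t0\<bar> \<le> r \<longrightarrow> norm (x t) \<le> K"
proof -
  obtain B where B: "\<And>I a b c t0 t. \<lbrakk>is_interval I; t0 \<in> I; t \<in> I; \<bar>t - t0\<bar> \<le> r;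
    a t0 = x0 \<bullet> (N *v w); b t0 = x0 \<bullet> (w \<times> u); c t0 = x0 \<bullet> (N *v u);
    \<forall>s\<in>I. (a has_real_derivative (m2 * b s + m * c s) * a s - e * b s * (m * b s + m3 * c s)) (at s);
    \<forall>s\<in>I. (b has_real_derivative (m * b s + m3 * c s) * c s) (at s);
    \<forall>s\<in>I. (c has_real_derivative - (m2 * b s + m * c s) * c s) (at s)\<rbrakk>
    \<Longrightarrow> \<bar>a t\<bar> \<le> B \<and> \<bar>b t\<bar> \<le> B \<and> \<bar>c t\<bar> \<le> B"
    using triangular_system_bound[OF discriminant_nonpos[OF assms], of r "x0 \<bullet> (N *v w)" "x0 \<bullet> (w \<times> u)" "x0 \<bullet> (N *v u)" e]
    by metis
  show ?thesis
  proof (intro exI[of _ "B * norm u + B * norm f + B * norm w"] allI impI, elim conjE)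
    fix I x and t0 t :: real
    assume x: "solves F I x" "t0 \<in> I" "x t0 = x0" "t \<in> I" "\<bar>t - t0\<bar> \<le> r"
    have der: "((\<lambda>s. x s \<bullet> z) has_real_derivative F (x s) \<bullet> z) (at s)" if "s \<in> I" for s z
      unfolding has_real_derivative_iff_has_vector_derivative
      using x(1) that
      by (intro bounded_linear.has_vector_derivative[OF bounded_linear_inner_left]) (auto simp: solves_def)
    have "\<bar>x t \<bullet> (N *v w)\<bar> \<le> B \<and> \<bar>x t \<bullet> (w \<times> u)\<bar> \<le> B \<and> \<bar>x t \<bullet> (N *v u)\<bar> \<le> B"
    proof (rule B[of I t0 t "\<lambda>s. x s \<bullet> (N *v w)" "\<lambda>s. x s \<bullet> (w \<times> u)" "\<lambda>s. x s \<bullet> (N *v u)"])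
      show "is_interval I" using x(1) by (simp add: solves_def open_interval_def)
      show "\<forall>s\<in>I. ((\<lambda>s. x s \<bullet> (N *v w)) has_real_derivative
          (m2 * (x s \<bullet> (w \<times> u)) + m * (x s \<bullet> (N *v u))) * (x s \<bullet> (N *v w)) -
          e * (x s \<bullet> (w \<times> u)) * (m * (x s \<bullet> (w \<times> u)) + m3 * (x s \<bullet> (N *v u)))) (at s)"
        using der[of _ "N *v w"] unfolding F_components by blast
      show "\<forall>s\<in>I. ((\<lambda>s. x s \<bullet> (w \<times> u)) has_real_derivative
          (m * (x s \<bullet> (w \<times> u)) + m3 * (x s \<bullet> (N *v u))) * (x s \<bullet> (N *v u))) (at s)"
        using der[of _ "w \<times> u"] unfolding F_components by blast
      show "\<forall>s\<in>I. ((\<lambda>s. x s \<bullet> (N *v u)) has_real_derivative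
          - (m2 * (x s \<bullet> (w \<times> u)) + m * (x s \<bullet> (N *v u))) * (x s \<bullet> (N *v u))) (at s)"
        using der[of _ "N *v u"] unfolding F_components by blast
    qed (use x in auto)
    then have B: "\<bar>x t \<bullet> (N *v w)\<bar> \<le> B" "\<bar>x t \<bullet> (w \<times> u)\<bar> \<le> B" "\<bar>x t \<bullet> (N *v u)\<bar> \<le> B" by auto
    have "norm (x t) \<le> norm ((x t \<bullet> (N *v w)) *\<^sub>R u + (x t \<bullet> (w \<times> u)) *\<^sub>R f) + norm ((x t \<bullet> (N *v u)) *\<^sub>R w)"
      by (subst expansion[of "x t"]) (rule norm_triangle_ineq)
    also have "\<dots> \<le> norm ((x t \<bullet> (N *v w)) *\<^sub>R u) + norm ((x t \<bullet> (w \<times> u)) *\<^sub>R f) + norm ((x t \<bullet> (N *v u)) *\<^sub>R w)"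
      by (intro add_right_mono norm_triangle_ineq)
    also have "\<dots> \<le> B * norm u + B * norm f + B * norm w"
      unfolding norm_scaleR by (intro add_mono mult_right_mono B norm_ge_zero)
    finally show "norm (x t) \<le> B * norm u + B * norm f + B * norm w" .
  qed
qed

end

context symmetric_pair
begin

text \<open>At a common isotropic vector \<open>u\<close> the covectors \<open>Mu\<close> and \<open>Nu\<close> are dependent, since \<open>u\<close> is not
  an idempotent. Subtracting a multiple of \<open>N\<close> from \<open>M\<close> does not change the cross product \<open>Mv \<times> Nv\<close>
  and achieves \<open>Mu = 0\<close>.\<close>

lemma bounded_if_isotropic:
  assumes no: "\<nexists>v. idempotent_of F v" and u: "u \<noteq> 0" "u \<bullet> (M *v u) = 0" "u \<bullet> (N *v u) = 0"
  shows "\<exists>K. \<forall>I x t0 t. solves F I x \<and> t0 \<in> I \<and> x t0 = x0 \<and> t \<in> I \<and> \<bar>t - t0\<bar> \<le> r \<longrightarrow> norm (x t) \<le> K"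
proof -
  have Nu: "N *v u \<noteq> 0" using N_inj u(1) by blast
  have "F u = 0" by (rule F_zero_at_isotropic[OF no u(2,3)])
  then have "(N *v u) \<times> ((M *v u) \<times> (N *v u)) = 0" by (simp add: F_def)
  then have eq: "((N *v u) \<bullet> (N *v u)) *\<^sub>R (M *v u) = ((N *v u) \<bullet> (M *v u)) *\<^sub>R (N *v u)"
    unfolding Lagrange by simp
  define \<mu> where "\<mu> = ((N *v u) \<bullet> (M *v u)) / ((N *v u) \<bullet> (N *v u))"
  have Mu: "M *v u = \<mu> *\<^sub>R (N *v u)"
    using arg_cong[OF eq, of "\<lambda>x. (1 / ((N *v u) \<bullet> (N *v u))) *\<^sub>R x"] Nu by (simp add: \<mu>_def)
  define M' where "M' = M - \<mu> *\<^sub>R N"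
  have M': "M' *v v = M *v v - \<mu> *\<^sub>R (N *v v)" for v
    by (simp add: M'_def matrix_vector_mult_diff_rdistrib scaleR_matrix_vector_assoc)
  have M'_sym: "x \<bullet> (M' *v y) = y \<bullet> (M' *v x)" for x y
    using M_sym[of x y] N_sym[of x y] by (simp add: M' inner_diff_right)
  \<comment> \<open>Moving \<open>w0\<close> along \<open>u\<close> makes it isotropic and keeps its pairing with \<open>u\<close>.\<close>
  define w0 where "w0 = (1 / ((N *v u) \<bullet> (N *v u))) *\<^sub>R (N *v u)"
  have w0: "w0 \<bullet> (N *v u) = 1" using Nu by (simp add: w0_def)
  define w where "w = w0 - ((w0 \<bullet> (N *v w0)) / 2) *\<^sub>R u"
  have uNw: "u \<bullet> (N *v w) = 1"
    using w0 N_sym[of u w0] u(3)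
    by (simp add: w_def matrix_vector_mult_diff_distrib matrix_vector_mult_scaleR inner_diff_right)
  have wNw: "w \<bullet> (N *v w) = 0"
    using w0 N_sym[of u w0] u(3)
    by (simp add: w_def matrix_vector_mult_diff_distrib matrix_vector_mult_scaleR inner_diff_right inner_diff_left)
  interpret k: isotropic_kernel M' N u w "(N *v u) \<times> (N *v w)"
    by unfold_locales (use M'_sym N_sym N_inj Mu u uNw wNw in \<open>auto simp: M'\<close>)
  have "k.F = F"
    by (simp add: fun_eq_iff k.F_def F_def M' Cross3.left_diff_distrib cross_mult_left)
  then show ?thesis using k.bounded_if_no_idempotent[of x0 r] no by simp
qed

theorem complete_if_no_idempotent:
  assumes "\<nexists>v. idempotent_of F v"
  shows "complete_field F"
proof (rule complete_field_of_a_priori_bounds[OF F_lipschitz_on_balls])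
  fix x0 r
  show "\<exists>K. \<forall>I x t0 t. solves F I x \<and> t0 \<in> I \<and> x t0 = x0 \<and> t \<in> I \<and> \<bar>t - t0\<bar> \<le> r \<longrightarrow> norm (x t) \<le> K"
  proof (cases "\<exists>u. u \<noteq> 0 \<and> u \<bullet> (M *v u) = 0 \<and> u \<bullet> (N *v u) = 0")
    case True
    then show ?thesis using bounded_if_isotropic[OF assms] by blast
  next
    case False
    then obtain K where "\<forall>I x t0 t. solves F I x \<and> t0 \<in> I \<and> x t0 = x0 \<and> t \<in> I \<longrightarrow> norm (x t) \<le> K"
      using bounded_if_anisotropic by metis
    then show ?thesis by blast
  qed
qed

end

unbundle no cross3_syntax

section \<open>Lie groups in charts\<close>

lemma continuous_on_cball_bounded:
  fixes g :: "'a::euclidean_space \<Rightarrow> 'b::real_normed_vector"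
  assumes "continuous_on (cball e r) g"
  shows "\<exists>M. \<forall>z\<in>cball e r. norm (g z) \<le> M"
proof -
  have "bounded (g ` cball e r)"
    using assms by (intro compact_imp_bounded compact_continuous_image compact_cball)
  then obtain M where M: "\<forall>y\<in>g ` cball e r. norm y \<le> M" unfolding bounded_iff ..
  then have "norm (g z) \<le> M" if "z \<in> cball e r" for z
    using imageI[OF that, of g] by (rule bspec)
  then show ?thesis by (intro exI ballI)
qed

lemma smooth_on_lipschitz_cball:
  fixes f :: "'a::euclidean_space \<Rightarrow> 'b::real_normed_vector"
  assumes "open S" "smooth_on S f" "cball e r \<subseteq> S"
  shows "\<exists>L\<ge>0. \<forall>z\<in>cball e r. \<forall>w\<in>cball e r. norm (f z - f w) \<le> L * norm (z - w)"
proof -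
  let ?D = "\<lambda>z. frechet_derivative f (at z)"
  have "\<exists>M. \<forall>z\<in>cball e r. norm (?D z b) \<le> M" for b
  proof -
    have "continuous_on (cball e r) (\<lambda>z. ?D z b)"
      by (rule continuous_on_subset[OF smooth_on_imp_continuous_on[OF smooth_on_frechet_derivative[OF assms(1,2)]] assms(3)])
    then show ?thesis by (rule continuous_on_cball_bounded)
  qed
  then obtain M where M: "\<And>b z. z \<in> cball e r \<Longrightarrow> norm (?D z b) \<le> M b"
    by metis
  define L where "L = (\<Sum>b\<in>Basis. \<bar>M b\<bar>)"
  have on: "onorm (?D z) \<le> L" if z: "z \<in> cball e r" for z
  proof (rule onorm_le)
    fix v
    have lin: "linear (?D z)"
      by (rule has_derivative_linear[OF smooth_on_has_derivative[OF assms(2) subsetD[OF assms(3) z]]])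
    have "norm (?D z v) \<le> (\<Sum>b\<in>Basis. norm ((v \<bullet> b) *\<^sub>R ?D z b))"
      by (subst linear_basis_expansion[OF lin]) (rule norm_sum)
    also have "\<dots> \<le> (\<Sum>b\<in>Basis. \<bar>M b\<bar> * norm v)"
    proof (rule sum_mono)
      fix b :: 'a assume b: "b \<in> Basis"
      have "norm (?D z b) \<le> \<bar>M b\<bar>" using M[OF z, of b] by linarith
      then show "norm ((v \<bullet> b) *\<^sub>R ?D z b) \<le> \<bar>M b\<bar> * norm v"
        unfolding norm_scaleR using Basis_le_norm[OF b, of v]
        by (metis mult.commute mult_mono abs_ge_zero norm_ge_zero)
    qed
    also have "\<dots> = L * norm v" by (simp add: L_def sum_distrib_right)
    finally show "norm (?D z v) \<le> L * norm v" .
  qed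
  show ?thesis
  proof (intro exI[of _ L] conjI ballI)
    show "L \<ge> 0" by (simp add: L_def sum_nonneg)
    fix z w assume zw: "z \<in> cball e r" "w \<in> cball e r"
    show "norm (f z - f w) \<le> L * norm (z - w)"
    proof (rule differentiable_bound[OF convex_cball _ on])
      show "(f has_derivative ?D x) (at x within cball e r)" if "x \<in> cball e r" for x
        using smooth_on_has_derivative[OF assms(2), of x] that assms(3) has_derivative_at_withinI by blast
    qed (use zw in auto)
  qed
qed

locale lie_group_chart = group G
  for G :: "'g monoid" (structure) +
  fixes T :: "'g topology" and A :: "('g, 'e::euclidean_space) chart set" and c :: "('g, 'e) chart"
  assumes lie: "lie_group G T A" and c_in: "c \<in> A" and one_in: "\<one> \<in> fst c"
begin

lemma manifold: "smooth_manifold T A" and topspace_T: "topspace T = carrier G"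
  and mult_smooth_map: "smooth_map (prod_topology T T) (prod_atlas A A) T A (\<lambda>(g, h). g \<otimes> h)"
  using lie by (auto simp: lie_group_def)

abbreviation img :: "('g, 'e) chart \<Rightarrow> 'e set" where "img c' \<equiv> snd c' ` fst c'"

lemma chart_props:
  assumes "c' \<in> A"
  shows "openin T (fst c')" "open (img c')"
    "homeomorphic_map (subtopology T (fst c')) (top_of_set (img c')) (snd c')"
  using manifold assms unfolding smooth_manifold_def by (cases c'; auto)+

lemma chart_subset: "c' \<in> A \<Longrightarrow> fst c' \<subseteq> carrier G"
  using chart_props(1) openin_subset topspace_T by blast

lemma chart_topspace: "c' \<in> A \<Longrightarrow> topspace (subtopology T (fst c')) = fst c'"
  using chart_subset[of c'] topspace_T by (simp add: Int_absorb1)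

lemma chart_carrier: "c' \<in> A \<Longrightarrow> p \<in> fst c' \<Longrightarrow> p \<in> carrier G"
  using chart_subset by blast

lemma chart_inj: "c' \<in> A \<Longrightarrow> inj_on (snd c') (fst c')"
  using chart_props(3)[of c'] chart_topspace[of c'] by (metis homeomorphic_imp_injective_map)

lemma chart_inv_left [simp]: "c' \<in> A \<Longrightarrow> p \<in> fst c' \<Longrightarrow> chart_inv c' (snd c' p) = p"
  by (simp add: chart_inv_def chart_inj)

lemma chart_inv_right [simp]: "x \<in> img c' \<Longrightarrow> snd c' (chart_inv c' x) = x"
  by (simp add: chart_inv_def f_inv_into_f)

lemma chart_inv_in [simp]: "x \<in> img c' \<Longrightarrow> chart_inv c' x \<in> fst c'"
  by (simp add: chart_inv_def inv_into_into)

lemma chart_at: "p \<in> carrier G \<Longrightarrow> \<exists>c'\<in>A. p \<in> fst c'"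
  using manifold topspace_T unfolding smooth_manifold_def by blast

lemma chart_inv_continuous:
  assumes "c' \<in> A"
  shows "continuous_map (top_of_set (img c')) T (chart_inv c')"
proof -
  obtain g where g: "homeomorphic_maps (subtopology T (fst c')) (top_of_set (img c')) (snd c') g"
    using chart_props(3)[OF assms] homeomorphic_map_maps by blast
  have "continuous_map (top_of_set (img c')) (subtopology T (fst c')) g"
    using g by (simp add: homeomorphic_maps_def)
  then have g_cont: "continuous_map (top_of_set (img c')) T g"
    by (rule continuous_map_into_fulltopology)
  have "g x = chart_inv c' x" if "x \<in> img c'" for x
  proof -
    from that obtain p where p: "p \<in> fst c'" "x = snd c' p" by (rule imageE)
    have "g (snd c' p) = p"
      using g p(1) chart_topspace[OF assms] unfolding homeomorphic_maps_def by blast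
    then show ?thesis using p assms by simp
  qed
  then show ?thesis
    using continuous_map_eq[OF g_cont] by simp
qed

text \<open>Multiplication in the charts \<open>c1\<close>, \<open>c2\<close> of the factors and \<open>c3\<close> of the product.\<close>

definition mult_dom :: "('g, 'e) chart \<Rightarrow> ('g, 'e) chart \<Rightarrow> ('g, 'e) chart \<Rightarrow> ('e \<times> 'e) set" where
  "mult_dom c1 c2 c3 = {p. fst p \<in> img c1 \<and> snd p \<in> img c2 \<and> chart_inv c1 (fst p) \<otimes> chart_inv c2 (snd p) \<in> fst c3}"

definition mult_fun :: "('g, 'e) chart \<Rightarrow> ('g, 'e) chart \<Rightarrow> ('g, 'e) chart \<Rightarrow> 'e \<times> 'e \<Rightarrow> 'e" where
  "mult_fun c1 c2 c3 p = snd c3 (chart_inv c1 (fst p) \<otimes> chart_inv c2 (snd p))"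

lemma open_mult_dom:
  assumes "c1 \<in> A" "c2 \<in> A" "c3 \<in> A"
  shows "open (mult_dom c1 c2 c3)"
proof -
  let ?V = "img c1 \<times> img c2"
  have mult: "continuous_map (prod_topology T T) T (\<lambda>p. fst p \<otimes> snd p)"
    using mult_smooth_map unfolding smooth_map_def case_prod_beta by blast
  have "continuous_map (top_of_set ?V) (top_of_set (img c1)) fst"
    "continuous_map (top_of_set ?V) (top_of_set (img c2)) snd"
    by (auto intro: continuous_intros)
  then have "continuous_map (top_of_set ?V) T (chart_inv c1 \<circ> fst)"
    "continuous_map (top_of_set ?V) T (chart_inv c2 \<circ> snd)"
    using continuous_map_compose chart_inv_continuous[OF assms(1)] chart_inv_continuous[OF assms(2)]
    by metis+
  then have "continuous_map (top_of_set ?V) (prod_topology T T)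
      (\<lambda>p. ((chart_inv c1 \<circ> fst) p, (chart_inv c2 \<circ> snd) p))"
    unfolding continuous_map_paired by (simp add: o_def)
  from continuous_map_compose[OF this mult]
  have "continuous_map (top_of_set ?V) T (\<lambda>p. chart_inv c1 (fst p) \<otimes> chart_inv c2 (snd p))"
    by (simp add: o_def)
  from openin_continuous_map_preimage[OF this chart_props(1)[OF assms(3)]]
  have "openin (top_of_set ?V) {p \<in> ?V. chart_inv c1 (fst p) \<otimes> chart_inv c2 (snd p) \<in> fst c3}"
    by simp
  moreover have "open ?V" using assms chart_props(2) open_Times by blast
  ultimately have "open {p \<in> ?V. chart_inv c1 (fst p) \<otimes> chart_inv c2 (snd p) \<in> fst c3}"
    using openin_open_eq by blast
  moreover have "{p \<in> ?V. chart_inv c1 (fst p) \<otimes> chart_inv c2 (snd p) \<in> fst c3} = mult_dom c1 c2 c3"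
    by (auto simp: mult_dom_def)
  ultimately show ?thesis by simp
qed

lemma smooth_mult_fun:
  assumes "c1 \<in> A" "c2 \<in> A" "c3 \<in> A"
  shows "smooth_on (mult_dom c1 c2 c3) (mult_fun c1 c2 c3)"
proof -
  let ?c = "(fst c1 \<times> fst c2, map_prod (snd c1) (snd c2))"
  have "?c \<in> prod_atlas A A"
    unfolding prod_atlas_def using assms
    by (intro CollectI exI[of _ "fst c1"] exI[of _ "snd c1"] exI[of _ "fst c2"] exI[of _ "snd c2"]) simp
  then have smooth: "smooth_on (snd ?c ` {p \<in> fst ?c. (case p of (g, h) \<Rightarrow> g \<otimes> h) \<in> fst c3})
      (snd c3 \<circ> (\<lambda>(g, h). g \<otimes> h) \<circ> chart_inv ?c)"
    using mult_smooth_map assms unfolding smooth_map_def by blast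
  have inj: "inj_on (snd ?c) (fst ?c)"
    using chart_inj assms by (simp add: map_prod_inj_on)
  have inv: "chart_inv ?c (x, y) = (chart_inv c1 x, chart_inv c2 y)" if "x \<in> img c1" "y \<in> img c2" for x y
    unfolding chart_inv_def[of ?c]
    by (rule inv_into_f_eq[OF inj]) (use that in auto)
  have dom: "snd ?c ` {p \<in> fst ?c. (case p of (g, h) \<Rightarrow> g \<otimes> h) \<in> fst c3} = mult_dom c1 c2 c3" (is "?L = _")
  proof (intro equalityI subsetI)
    fix p assume "p \<in> ?L"
    then show "p \<in> mult_dom c1 c2 c3" using assms by (auto simp: mult_dom_def)
  next
    fix p assume p: "p \<in> mult_dom c1 c2 c3"
    then show "p \<in> ?L"
      by (intro image_eqI[of _ _ "(chart_inv c1 (fst p), chart_inv c2 (snd p))"])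
         (auto simp: mult_dom_def)
  qed
  show ?thesis
  proof (rule smooth_on_cong_open[OF open_mult_dom[OF assms] _ smooth[unfolded dom]])
    fix p assume "p \<in> mult_dom c1 c2 c3"
    then show "(snd c3 \<circ> (\<lambda>(g, h). g \<otimes> h) \<circ> chart_inv ?c) p = mult_fun c1 c2 c3 p"
      using inv[of "fst p" "snd p"] by (simp add: mult_dom_def mult_fun_def)
  qed
qed

definition left_dom :: "'g \<Rightarrow> ('g, 'e) chart \<Rightarrow> ('g, 'e) chart \<Rightarrow> 'e set" where
  "left_dom g c1 c2 = {x \<in> img c1. g \<otimes> chart_inv c1 x \<in> fst c2}"

definition left_mult :: "'g \<Rightarrow> ('g, 'e) chart \<Rightarrow> ('g, 'e) chart \<Rightarrow> 'e \<Rightarrow> 'e" where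
  "left_mult g c1 c2 x = snd c2 (g \<otimes> chart_inv c1 x)"

lemma left_dom_props:
  assumes "g \<in> carrier G" "c1 \<in> A" "c2 \<in> A"
  shows open_left_dom: "open (left_dom g c1 c2)" and smooth_left_mult: "smooth_on (left_dom g c1 c2) (left_mult g c1 c2)"
proof -
  obtain c0 where c0: "c0 \<in> A" "g \<in> fst c0" using chart_at assms by blast
  let ?x = "snd c0 g"
  have dom: "left_dom g c1 c2 = (\<lambda>y. (?x, y)) -` mult_dom c0 c1 c2"
    using c0 by (auto simp: left_dom_def mult_dom_def)
  show "open (left_dom g c1 c2)"
    unfolding dom by (rule open_vimage[OF open_mult_dom[OF c0(1) assms(2,3)]]) (auto intro: continuous_intros)
  have "smooth_on (left_dom g c1 c2) (\<lambda>y. mult_fun c0 c1 c2 (?x, y))"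
    by (rule smooth_on_compose[OF _ smooth_mult_fun[OF c0(1) assms(2,3)]])
       (auto simp: dom intro: smooth_on_Pair smooth_on_const smooth_on_id)
  moreover have "(\<lambda>y. mult_fun c0 c1 c2 (?x, y)) = left_mult g c1 c2"
    using c0 by (simp add: fun_eq_iff mult_fun_def left_mult_def)
  ultimately show "smooth_on (left_dom g c1 c2) (left_mult g c1 c2)" by simp
qed

lemma in_left_dom: "c1 \<in> A \<Longrightarrow> p \<in> fst c1 \<Longrightarrow> g \<otimes> p \<in> fst c2 \<Longrightarrow> snd c1 p \<in> left_dom g c1 c2"
  by (auto simp: left_dom_def)

abbreviation dL :: "('g, 'e) chart \<Rightarrow> ('g, 'e) chart \<Rightarrow> 'g \<Rightarrow> 'g \<Rightarrow> 'e \<Rightarrow> 'e" where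
  "dL c1 c2 g p \<equiv> differential c1 c2 (\<lambda>h. g \<otimes> h) p"

lemma dL_eq: "dL c1 c2 g p = frechet_derivative (left_mult g c1 c2) (at (snd c1 p))"
proof -
  have "snd c2 \<circ> (\<otimes>) g \<circ> chart_inv c1 = left_mult g c1 c2"
    by (simp add: fun_eq_iff left_mult_def)
  then show ?thesis by (simp add: differential_def)
qed

lemma left_mult_has_derivative:
  assumes "g \<in> carrier G" "c1 \<in> A" "c2 \<in> A" "p \<in> fst c1" "g \<otimes> p \<in> fst c2"
  shows "(left_mult g c1 c2 has_derivative dL c1 c2 g p) (at (snd c1 p))"
  unfolding dL_eq using assms by (intro smooth_on_has_derivative[OF smooth_left_mult] in_left_dom)

lemma dL_linear:
  assumes "g \<in> carrier G" "c1 \<in> A" "c2 \<in> A" "p \<in> fst c1" "g \<otimes> p \<in> fst c2"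
  shows "linear (dL c1 c2 g p)"
  using left_mult_has_derivative[OF assms] by (rule has_derivative_linear)

lemma left_mult_compose:
  assumes "g \<in> carrier G" "h \<in> carrier G" "c1 \<in> A" "c2 \<in> A" "x \<in> left_dom h c1 c2"
  shows "left_mult g c2 c3 (left_mult h c1 c2 x) = left_mult (g \<otimes> h) c1 c3 x"
proof -
  have "chart_inv c1 x \<in> carrier G"
    using assms(5) by (intro chart_carrier[OF assms(3)]) (simp add: left_dom_def)
  then show ?thesis
    using assms by (simp add: left_mult_def left_dom_def m_assoc)
qed

lemma dL_compose:
  assumes "g \<in> carrier G" "h \<in> carrier G" "c1 \<in> A" "c2 \<in> A" "c3 \<in> A"
    and "p \<in> fst c1" "h \<otimes> p \<in> fst c2" "g \<otimes> (h \<otimes> p) \<in> fst c3"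
  shows "dL c2 c3 g (h \<otimes> p) (dL c1 c2 h p v) = dL c1 c3 (g \<otimes> h) p v"
proof -
  have p: "p \<in> carrier G" using assms chart_subset by blast
  have "(left_mult g c2 c3 has_derivative dL c2 c3 g (h \<otimes> p)) (at (left_mult h c1 c2 (snd c1 p)))"
    using left_mult_has_derivative[of g c2 c3 "h \<otimes> p"] assms by (simp add: left_mult_def)
  from has_derivative_compose[OF left_mult_has_derivative this] assms
  have 1: "((\<lambda>x. left_mult g c2 c3 (left_mult h c1 c2 x)) has_derivative (\<lambda>v. dL c2 c3 g (h \<otimes> p) (dL c1 c2 h p v)))
      (at (snd c1 p))" by simp
  have "(left_mult (g \<otimes> h) c1 c3 has_derivative (\<lambda>v. dL c2 c3 g (h \<otimes> p) (dL c1 c2 h p v))) (at (snd c1 p))"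
    by (rule has_derivative_transform_within_open[OF 1 open_left_dom[of h c1 c2] in_left_dom])
       (use assms in \<open>auto simp: left_mult_compose\<close>)
  moreover have "(left_mult (g \<otimes> h) c1 c3 has_derivative dL c1 c3 (g \<otimes> h) p) (at (snd c1 p))"
    using assms p by (intro left_mult_has_derivative) (auto simp: m_assoc)
  ultimately show ?thesis
    using has_derivative_unique by (metis (no_types))
qed

lemma dL_one:
  assumes "c1 \<in> A" "p \<in> fst c1"
  shows "dL c1 c1 \<one> p v = v"
proof -
  have p: "p \<in> carrier G" using assms chart_subset by blast
  have "(left_mult \<one> c1 c1 has_derivative (\<lambda>v. v)) (at (snd c1 p))"
  proof (rule has_derivative_transform_within_open[OF has_derivative_ident chart_props(2)[OF assms(1)]])
    fix x assume x: "x \<in> img c1"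
    then have "chart_inv c1 x \<in> carrier G" using chart_subset[OF assms(1)] by auto
    then show "x = left_mult \<one> c1 c1 x" using x by (simp add: left_mult_def)
  qed (use assms in auto)
  moreover have "(left_mult \<one> c1 c1 has_derivative dL c1 c1 \<one> p) (at (snd c1 p))"
    using assms p by (intro left_mult_has_derivative) auto
  ultimately show ?thesis
    using has_derivative_unique by (metis (no_types))
qed

text \<open>The value at \<open>p\<close> of the left invariant field with value \<open>X\<close> at the identity.\<close>

definition E :: "('g, 'e) chart \<Rightarrow> 'g \<Rightarrow> 'e \<Rightarrow> 'e" where
  "E c' p X = dL c c' p \<one> X"

text \<open>Left invariance is the chain rule for \<open>L\<^sub>g \<circ> L\<^sub>p = L\<^sub>g\<^sub>p\<close>.\<close>

lemma E_natural:
  assumes "g \<in> carrier G" "c1 \<in> A" "c2 \<in> A" "p \<in> fst c1" "g \<otimes> p \<in> fst c2"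
  shows "dL c1 c2 g p (E c1 p X) = E c2 (g \<otimes> p) X"
proof -
  have p: "p \<in> carrier G" using assms chart_subset by blast
  show ?thesis
    using dL_compose[of g p c c1 c2 \<one> X] assms p c_in one_in by (simp add: E_def)
qed

lemma E_linear: "c' \<in> A \<Longrightarrow> p \<in> fst c' \<Longrightarrow> linear (E c' p)"
  using dL_linear[of p c c' \<one>] c_in one_in chart_subset[of c'] unfolding E_def[abs_def]
  by (auto simp: subset_iff)

lemma E_one: "E c \<one> X = X"
  using dL_one c_in one_in by (simp add: E_def)

lemma E_surj:
  assumes "c' \<in> A" "p \<in> fst c'"
  shows "\<exists>X. E c' p X = v"
proof -
  have p: "p \<in> carrier G" using assms chart_subset by blast
  have "dL c c' p (inv p \<otimes> p) (dL c' c (inv p) p v) = dL c' c' (p \<otimes> inv p) p v"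
    using assms p c_in one_in by (intro dL_compose) (auto simp: m_assoc[symmetric])
  then show ?thesis
    using assms p dL_one by (auto simp: E_def)
qed

text \<open>The left invariant field as a vector field on the image of the chart \<open>c'\<close>.\<close>

definition Ef :: "('g, 'e) chart \<Rightarrow> 'e \<Rightarrow> 'e \<Rightarrow> 'e" where
  "Ef c' X x = E c' (chart_inv c' x) X"

lemma left_inv_field_eq: "left_inv_field G c X = Ef c X"
  by (simp add: fun_eq_iff left_inv_field_def Ef_def E_def)

lemma smooth_Ef:
  assumes "c' \<in> A"
  shows "smooth_on (img c') (Ef c' X)"
proof -
  have "smooth_on (img c') (\<lambda>x. frechet_derivative (\<lambda>y. mult_fun c' c c' (x, y)) (at (snd c \<one>)) X)"
  proof (rule smooth_on_partial_derivative[OF open_mult_dom smooth_mult_fun])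
    show "(x, snd c \<one>) \<in> mult_dom c' c c'" if "x \<in> img c'" for x
    proof -
      have "chart_inv c' x \<in> carrier G" using that chart_subset[OF assms] by auto
      then show ?thesis using that c_in one_in by (simp add: mult_dom_def)
    qed
  qed (use assms c_in chart_props(2) in auto)
  then show ?thesis
    by (simp add: Ef_def[abs_def] E_def dL_eq mult_fun_def left_mult_def[abs_def])
qed

lemma Ef_linear: "c' \<in> A \<Longrightarrow> x \<in> img c' \<Longrightarrow> linear (\<lambda>X. Ef c' X x)"
  using E_linear[of c' "chart_inv c' x"] unfolding Ef_def by simp

lemma Ef_expansion: "c' \<in> A \<Longrightarrow> x \<in> img c' \<Longrightarrow> Ef c' X x = (\<Sum>b\<in>Basis. (X \<bullet> b) *\<^sub>R Ef c' b x)"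
  using linear_basis_expansion[OF Ef_linear] .

text \<open>The bounds are uniform in \<open>X\<close> of a given norm because the field depends linearly on \<open>X\<close>; hence
  they also serve for the time-dependent fields \<open>E (x t)\<close>.\<close>

lemma Ef_bounds:
  assumes "c' \<in> A" "cball e r \<subseteq> img c'"
  shows "\<exists>L\<ge>0. \<forall>X. (\<forall>z\<in>cball e r. norm (Ef c' X z) \<le> L * norm X) \<and>
    (\<forall>z\<in>cball e r. \<forall>w\<in>cball e r. norm (Ef c' X z - Ef c' X w) \<le> L * norm X * norm (z - w))"
proof -
  have "\<exists>L. \<forall>z\<in>cball e r. \<forall>w\<in>cball e r. norm (Ef c' b z - Ef c' b w) \<le> L * norm (z - w)" for b
    using smooth_on_lipschitz_cball[OF chart_props(2)[OF assms(1)] smooth_Ef[OF assms(1)] assms(2)] by blast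
  then obtain L where L: "\<And>b z w. z \<in> cball e r \<Longrightarrow> w \<in> cball e r \<Longrightarrow> norm (Ef c' b z - Ef c' b w) \<le> L b * norm (z - w)"
    by metis
  have "\<exists>M. \<forall>z\<in>cball e r. norm (Ef c' b z) \<le> M" for b
  proof -
    have "continuous_on (cball e r) (Ef c' b)"
      by (rule continuous_on_subset[OF smooth_on_imp_continuous_on[OF smooth_Ef[OF assms(1)]] assms(2)])
    then show ?thesis by (rule continuous_on_cball_bounded)
  qed
  then obtain M where M: "\<And>b z. z \<in> cball e r \<Longrightarrow> norm (Ef c' b z) \<le> M b" by metis
  define K where "K = (\<Sum>b\<in>Basis. \<bar>L b\<bar> + \<bar>M b\<bar>)"
  have K: "K \<ge> 0" by (simp add: K_def sum_nonneg)
  have *: "norm (\<Sum>b\<in>Basis. (X \<bullet> b) *\<^sub>R w b) \<le> K * norm X * s"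
    if "\<And>b. b \<in> Basis \<Longrightarrow> norm (w b) \<le> (\<bar>L b\<bar> + \<bar>M b\<bar>) * s" "s \<ge> 0" for X :: 'e and w :: "'e \<Rightarrow> 'e" and s
  proof -
    have "norm (\<Sum>b\<in>Basis. (X \<bullet> b) *\<^sub>R w b) \<le> (\<Sum>b\<in>Basis. norm ((X \<bullet> b) *\<^sub>R w b))"
      by (rule norm_sum)
    also have "\<dots> \<le> (\<Sum>b\<in>Basis. norm X * ((\<bar>L b\<bar> + \<bar>M b\<bar>) * s))"
      unfolding norm_scaleR by (intro sum_mono mult_mono that(1) Basis_le_norm) auto
    also have "\<dots> = K * norm X * s"
      by (simp add: K_def sum_distrib_left sum_distrib_right mult_ac)
    finally show ?thesis .
  qed
  show ?thesis
  proof (intro exI[of _ K] conjI allI ballI K)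
    fix X z assume z: "z \<in> cball e r"
    then have zi: "z \<in> img c'" using assms by blast
    have "norm (Ef c' b z) \<le> (\<bar>L b\<bar> + \<bar>M b\<bar>) * 1" for b
    proof -
      have "M b \<le> \<bar>M b\<bar>" "\<bar>M b\<bar> \<le> (\<bar>L b\<bar> + \<bar>M b\<bar>) * 1" by simp_all
      with M[OF z, of b] show ?thesis by (meson order_trans)
    qed
    from *[OF this, of X] show "norm (Ef c' X z) \<le> K * norm X"
      unfolding Ef_expansion[OF assms(1) zi, of X] by simp
    fix w assume w: "w \<in> cball e r"
    then have wi: "w \<in> img c'" using assms by blast
    have "Ef c' X z - Ef c' X w = (\<Sum>b\<in>Basis. (X \<bullet> b) *\<^sub>R (Ef c' b z - Ef c' b w))"
      unfolding Ef_expansion[OF assms(1) zi, of X] Ef_expansion[OF assms(1) wi, of X]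
      by (simp add: sum_subtractf scaleR_diff_right)
    moreover have "norm (Ef c' b z - Ef c' b w) \<le> (\<bar>L b\<bar> + \<bar>M b\<bar>) * norm (z - w)" for b
    proof -
      have "L b * norm (z - w) \<le> (\<bar>L b\<bar> + \<bar>M b\<bar>) * norm (z - w)"
        by (intro mult_right_mono) auto
      then show ?thesis using L[OF z w, of b] by linarith
    qed
    ultimately show "norm (Ef c' X z - Ef c' X w) \<le> K * norm X * norm (z - w)"
      using *[of "\<lambda>b. Ef c' b z - Ef c' b w" "norm (z - w)" X] by simp
  qed
qed

end

section \<open>Curves with prescribed logarithmic derivative\<close>

lemma has_vector_derivative_cong_nhds:
  assumes "\<forall>\<^sub>F s in nhds t. f s = g s"
  shows "(f has_vector_derivative v) (at t) \<longleftrightarrow> (g has_vector_derivative v) (at t)"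
proof -
  obtain S where "open S" "t \<in> S" "\<And>s. s \<in> S \<Longrightarrow> f s = g s"
    using assms unfolding eventually_nhds by blast
  then show ?thesis by (rule has_vector_derivative_cong_open)
qed

lemma has_vector_derivative_compose_derivative:
  assumes "(f has_vector_derivative v) (at t)" "(h has_derivative h') (at (f t))"
  shows "((\<lambda>s. h (f s)) has_vector_derivative h' v) (at t)"
  using vector_derivative_diff_chain_within[OF assms(1) has_derivative_at_withinI[OF assms(2)]]
  by (simp add: o_def)

lemma isCont_eventually_in_open:
  assumes "isCont f t" "open U" "f t \<in> U"
  shows "\<forall>\<^sub>F s in nhds t. f s \<in> U"
proof -
  have "(f \<longlongrightarrow> f t) (nhds t)"
    using assms(1) unfolding continuous_at tendsto_at_iff_tendsto_nhds .
  then show ?thesis using assms(2,3) by (rule topological_tendstoD)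
qed

context lie_group_chart
begin

definition cont_at :: "(real \<Rightarrow> 'g) \<Rightarrow> real \<Rightarrow> bool" where
  "cont_at \<gamma> t \<longleftrightarrow> \<gamma> t \<in> carrier G \<and> (\<forall>U. openin T U \<longrightarrow> \<gamma> t \<in> U \<longrightarrow> (\<forall>\<^sub>F s in nhds t. \<gamma> s \<in> U))"

text \<open>The logarithmic derivative of a curve \<open>\<gamma>\<close> at \<open>t\<close> is the velocity \<open>\<gamma>' t\<close> translated back to
  the identity. Continuity has to be required separately, because in a chart the derivative only
  has a meaning when the curve stays in the domain of the chart for a while.\<close>

definition log_deriv_at :: "(real \<Rightarrow> 'g) \<Rightarrow> real \<Rightarrow> 'e \<Rightarrow> bool" where
  "log_deriv_at \<gamma> t X \<longleftrightarrow> cont_at \<gamma> t \<and>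
     (\<forall>c'\<in>A. \<gamma> t \<in> fst c' \<longrightarrow> ((snd c' \<circ> \<gamma>) has_vector_derivative E c' (\<gamma> t) X) (at t))"

lemma cont_atD:
  "cont_at \<gamma> t \<Longrightarrow> c' \<in> A \<Longrightarrow> \<gamma> t \<in> fst c' \<Longrightarrow> \<forall>\<^sub>F s in nhds t. \<gamma> s \<in> fst c'"
  using chart_props(1) unfolding cont_at_def by blast

lemma continuous_map_iff_cont_at:
  assumes "open I"
  shows "continuous_map (top_of_set I) T \<gamma> \<longleftrightarrow> (\<forall>t\<in>I. cont_at \<gamma> t)"
proof
  assume \<gamma>: "continuous_map (top_of_set I) T \<gamma>"
  show "\<forall>t\<in>I. cont_at \<gamma> t"
    unfolding cont_at_def
  proof (intro ballI conjI allI impI)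
    fix t assume t: "t \<in> I"
    then show "\<gamma> t \<in> carrier G"
      using continuous_map_image_subset_topspace[OF \<gamma>] topspace_T by auto
    fix U assume "openin T U" "\<gamma> t \<in> U"
    then have "openin (top_of_set I) {s \<in> I. \<gamma> s \<in> U}"
      using openin_continuous_map_preimage[OF \<gamma>] by simp
    then have "open {s \<in> I. \<gamma> s \<in> U}"
      using assms openin_open_eq by blast
    then have "\<forall>\<^sub>F s in nhds t. s \<in> {s \<in> I. \<gamma> s \<in> U}"
      using t \<open>\<gamma> t \<in> U\<close> by (intro eventually_nhds_in_open) auto
    then show "\<forall>\<^sub>F s in nhds t. \<gamma> s \<in> U"
      by eventually_elim simp
  qed
next
  assume \<gamma>: "\<forall>t\<in>I. cont_at \<gamma> t"
  show "continuous_map (top_of_set I) T \<gamma>"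
    unfolding continuous_map_def
  proof (intro conjI allI impI)
    show "\<gamma> \<in> topspace (top_of_set I) \<rightarrow> topspace T"
      using \<gamma> by (auto simp: cont_at_def topspace_T)
    fix U assume U: "openin T U"
    have "open {s \<in> I. \<gamma> s \<in> U}"
    proof (rule openI)
      fix t assume t: "t \<in> {s \<in> I. \<gamma> s \<in> U}"
      then have "\<forall>\<^sub>F s in nhds t. \<gamma> s \<in> U" using \<gamma> U by (auto simp: cont_at_def)
      moreover have "\<forall>\<^sub>F s in nhds t. s \<in> I" using t assms by (intro eventually_nhds_in_open) auto
      ultimately have "\<forall>\<^sub>F s in nhds t. s \<in> {s \<in> I. \<gamma> s \<in> U}" by eventually_elim simp
      then show "\<exists>e>0. ball t e \<subseteq> {s \<in> I. \<gamma> s \<in> U}"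
        unfolding eventually_nhds_metric by (auto simp: dist_commute subset_iff)
    qed
    then show "openin (top_of_set I) {x \<in> topspace (top_of_set I). \<gamma> x \<in> U}"
      by (simp add: open_subset)
  qed
qed

lemma translation_continuous:
  assumes "g \<in> carrier G"
  shows "continuous_map T T ((\<otimes>) g)"
proof -
  have mult: "continuous_map (prod_topology T T) T (\<lambda>p. fst p \<otimes> snd p)"
    using mult_smooth_map unfolding smooth_map_def case_prod_beta by blast
  have "continuous_map T (prod_topology T T) (\<lambda>x. (g, x))"
    unfolding continuous_map_paired using assms topspace_T by simp
  from continuous_map_compose[OF this mult] show ?thesis by (simp add: o_def)
qed

lemma cont_at_translate:
  assumes "g \<in> carrier G" "cont_at \<gamma> t"
  shows "cont_at (\<lambda>s. g \<otimes> \<gamma> s) t"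
  unfolding cont_at_def
proof (intro conjI allI impI)
  show "g \<otimes> \<gamma> t \<in> carrier G" using assms by (simp add: cont_at_def)
  fix U assume "openin T U" "g \<otimes> \<gamma> t \<in> U"
  then have "openin T {p \<in> topspace T. g \<otimes> p \<in> U}"
    using openin_continuous_map_preimage[OF translation_continuous[OF assms(1)]] by blast
  moreover have "\<gamma> t \<in> {p \<in> topspace T. g \<otimes> p \<in> U}"
    using assms \<open>g \<otimes> \<gamma> t \<in> U\<close> by (simp add: cont_at_def topspace_T)
  ultimately have "\<forall>\<^sub>F s in nhds t. \<gamma> s \<in> {p \<in> topspace T. g \<otimes> p \<in> U}"
    using assms(2) unfolding cont_at_def by blast
  then show "\<forall>\<^sub>F s in nhds t. g \<otimes> \<gamma> s \<in> U"
    by eventually_elim simp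
qed

lemma translate_velocity:
  assumes "g \<in> carrier G" "c1 \<in> A" "c2 \<in> A" "\<gamma> t \<in> fst c1" "g \<otimes> \<gamma> t \<in> fst c2" "cont_at \<gamma> t"
    and "((snd c1 \<circ> \<gamma>) has_vector_derivative v) (at t)"
  shows "((snd c2 \<circ> (\<lambda>s. g \<otimes> \<gamma> s)) has_vector_derivative dL c1 c2 g (\<gamma> t) v) (at t)"
proof -
  have "((\<lambda>s. left_mult g c1 c2 ((snd c1 \<circ> \<gamma>) s)) has_vector_derivative dL c1 c2 g (\<gamma> t) v) (at t)"
    by (rule has_vector_derivative_compose_derivative[OF assms(7)])
       (use left_mult_has_derivative[OF assms(1-5)] in simp)
  moreover have "\<forall>\<^sub>F s in nhds t. left_mult g c1 c2 ((snd c1 \<circ> \<gamma>) s) = (snd c2 \<circ> (\<lambda>s. g \<otimes> \<gamma> s)) s"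
    using cont_atD[OF assms(6,2,4)]
    by eventually_elim (simp add: left_mult_def assms(2))
  ultimately show ?thesis
    by (rule has_vector_derivative_cong_nhds[THEN iffD1, rotated])
qed

lemma log_deriv_at_translate:
  assumes "g \<in> carrier G" "cont_at \<gamma> t" "c1 \<in> A" "\<gamma> t \<in> fst c1"
    and "((snd c1 \<circ> \<gamma>) has_vector_derivative E c1 (\<gamma> t) X) (at t)"
  shows "log_deriv_at (\<lambda>s. g \<otimes> \<gamma> s) t X"
  unfolding log_deriv_at_def
proof (intro conjI ballI impI cont_at_translate assms(1,2))
  fix c2 assume c2: "c2 \<in> A" "g \<otimes> \<gamma> t \<in> fst c2"
  show "((snd c2 \<circ> (\<lambda>s. g \<otimes> \<gamma> s)) has_vector_derivative E c2 (g \<otimes> \<gamma> t) X) (at t)"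
    using translate_velocity[OF assms(1,3) c2(1) assms(4) c2(2) assms(2,5)]
    unfolding E_natural[OF assms(1,3) c2(1) assms(4) c2(2)] .
qed

lemma log_deriv_at_cong:
  assumes "\<forall>\<^sub>F s in nhds t. \<gamma> s = \<delta> s" "log_deriv_at \<gamma> t X"
  shows "log_deriv_at \<delta> t X"
proof -
  have eq: "\<gamma> t = \<delta> t" using assms(1) by (rule eventually_nhds_x_imp_x)
  show ?thesis
    unfolding log_deriv_at_def cont_at_def eq[symmetric]
  proof (intro conjI ballI allI impI)
    show "\<gamma> t \<in> carrier G" using assms(2) by (simp add: log_deriv_at_def cont_at_def)
    fix U assume "openin T U" "\<gamma> t \<in> U"
    then have "\<forall>\<^sub>F s in nhds t. \<gamma> s \<in> U" using assms(2) by (simp add: log_deriv_at_def cont_at_def)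
    with assms(1) show "\<forall>\<^sub>F s in nhds t. \<delta> s \<in> U" by eventually_elim simp
  next
    fix c' assume "c' \<in> A" "\<gamma> t \<in> fst c'"
    then have "((snd c' \<circ> \<gamma>) has_vector_derivative E c' (\<gamma> t) X) (at t)"
      using assms(2) by (simp add: log_deriv_at_def)
    moreover have "\<forall>\<^sub>F s in nhds t. (snd c' \<circ> \<gamma>) s = (snd c' \<circ> \<delta>) s"
      using assms(1) by eventually_elim simp
    ultimately show "((snd c' \<circ> \<delta>) has_vector_derivative E c' (\<gamma> t) X) (at t)"
      using has_vector_derivative_cong_nhds by blast
  qed
qed

text \<open>The chart may be chosen because translation by the identity is a change of charts.\<close>

lemma log_deriv_atI:
  assumes cont: "\<forall>\<^sub>F s in nhds t. cont_at \<gamma> s" and "c1 \<in> A" "\<gamma> t \<in> fst c1"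
    and "((snd c1 \<circ> \<gamma>) has_vector_derivative E c1 (\<gamma> t) X) (at t)"
  shows "log_deriv_at \<gamma> t X"
proof (rule log_deriv_at_cong)
  show "log_deriv_at (\<lambda>s. \<one> \<otimes> \<gamma> s) t X"
    by (rule log_deriv_at_translate[OF one_closed eventually_nhds_x_imp_x[OF cont] assms(2-4)])
  show "\<forall>\<^sub>F s in nhds t. \<one> \<otimes> \<gamma> s = \<gamma> s"
    using cont by eventually_elim (simp add: cont_at_def)
qed

lemma log_deriv_at_left_translate:
  assumes "g \<in> carrier G" "log_deriv_at \<gamma> t X"
  shows "log_deriv_at (\<lambda>s. g \<otimes> \<gamma> s) t X"
proof -
  have c: "cont_at \<gamma> t" using assms(2) by (simp add: log_deriv_at_def)
  then obtain c1 where "c1 \<in> A" "\<gamma> t \<in> fst c1" using chart_at[of "\<gamma> t"] unfolding cont_at_def by blast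
  then show ?thesis
    using assms(2) by (intro log_deriv_at_translate[OF assms(1) c]) (auto simp: log_deriv_at_def)
qed

lemma log_deriv_at_compose:
  assumes "log_deriv_at \<gamma> (s t) X" "(s has_real_derivative s') (at t)"
  shows "log_deriv_at (\<gamma> \<circ> s) t (s' *\<^sub>R X)"
  unfolding log_deriv_at_def cont_at_def
proof (intro conjI ballI allI impI)
  show "(\<gamma> \<circ> s) t \<in> carrier G" using assms(1) by (simp add: log_deriv_at_def cont_at_def)
  fix U assume "openin T U" "(\<gamma> \<circ> s) t \<in> U"
  then have "\<forall>\<^sub>F r in nhds (s t). \<gamma> r \<in> U" using assms(1) by (simp add: log_deriv_at_def cont_at_def)
  moreover have "filterlim s (nhds (s t)) (nhds t)"
    using DERIV_isCont[OF assms(2)] by (simp add: continuous_at tendsto_nhds_iff)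
  ultimately show "\<forall>\<^sub>F r in nhds t. (\<gamma> \<circ> s) r \<in> U"
    unfolding o_def filterlim_iff by blast
next
  fix c' assume c': "c' \<in> A" "(\<gamma> \<circ> s) t \<in> fst c'"
  then have "((snd c' \<circ> \<gamma>) has_vector_derivative E c' (\<gamma> (s t)) X) (at (s t))"
    using assms(1) by (simp add: log_deriv_at_def)
  from vector_diff_chain_at[OF assms(2)[unfolded has_real_derivative_iff_has_vector_derivative] this]
  show "((snd c' \<circ> (\<gamma> \<circ> s)) has_vector_derivative E c' ((\<gamma> \<circ> s) t) (s' *\<^sub>R X)) (at t)"
    using c' linear_scale[OF E_linear[of c' "\<gamma> (s t)"], of s' X] by (simp add: o_def)
qed

lemma agree_locally:
  assumes \<gamma>: "\<forall>\<^sub>F s in nhds t. log_deriv_at \<gamma> s (x s)" and \<delta>: "\<forall>\<^sub>F s in nhds t. log_deriv_at \<delta> s (x s)"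
    and x: "isCont x t" and eq: "\<gamma> t = \<delta> t"
  shows "\<forall>\<^sub>F s in nhds t. \<gamma> s = \<delta> s"
proof -
  have ct: "cont_at \<gamma> t" "cont_at \<delta> t"
    using eventually_nhds_x_imp_x[OF \<gamma>] eventually_nhds_x_imp_x[OF \<delta>] by (auto simp: log_deriv_at_def)
  then obtain c1 where c1: "c1 \<in> A" "\<gamma> t \<in> fst c1" "\<delta> t \<in> fst c1"
    using chart_at[of "\<gamma> t"] eq by (auto simp: cont_at_def)
  let ?z = "snd c1 \<circ> \<gamma>" and ?w = "snd c1 \<circ> \<delta>"
  obtain r where r: "r > 0" "cball (?z t) r \<subseteq> img c1"
    using chart_props(2)[OF c1(1)] c1(2) open_contains_cball[of "img c1"] by auto
  obtain L where L: "L \<ge> 0" "\<And>X z w. z \<in> cball (?z t) r \<Longrightarrow> w \<in> cball (?z t) r \<Longrightarrow>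
      norm (Ef c1 X z - Ef c1 X w) \<le> L * norm X * norm (z - w)"
    using Ef_bounds[OF c1(1) r(2)] by blast
  have z_cont: "isCont ?z t" and w_cont: "isCont ?w t"
    using eventually_nhds_x_imp_x[OF \<gamma>] eventually_nhds_x_imp_x[OF \<delta>] c1
    by (auto simp: log_deriv_at_def intro: has_vector_derivative_continuous)
  have "?w t = ?z t" using eq by simp
  then have ev_z: "\<forall>\<^sub>F s in nhds t. ?z s \<in> ball (?z t) r" and ev_w: "\<forall>\<^sub>F s in nhds t. ?w s \<in> ball (?z t) r"
    using isCont_eventually_in_open[OF z_cont open_ball] isCont_eventually_in_open[OF w_cont open_ball] r(1)
    by simp_all
  have "\<forall>\<^sub>F s in nhds t. x s \<in> ball (x t) 1"
    by (rule isCont_eventually_in_open[OF x open_ball]) simp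
  with \<gamma> \<delta> cont_atD[OF ct(1) c1(1,2)] cont_atD[OF ct(2) c1(1,3)] ev_z ev_w
  have "\<forall>\<^sub>F s in nhds t. log_deriv_at \<gamma> s (x s) \<and> log_deriv_at \<delta> s (x s) \<and> \<gamma> s \<in> fst c1 \<and> \<delta> s \<in> fst c1 \<and>
      ?z s \<in> ball (?z t) r \<and> ?w s \<in> ball (?z t) r \<and> x s \<in> ball (x t) 1"
    by eventually_elim blast
  then obtain d where d: "d > 0" "\<And>s. dist s t < d \<Longrightarrow> log_deriv_at \<gamma> s (x s) \<and> log_deriv_at \<delta> s (x s) \<and>
      \<gamma> s \<in> fst c1 \<and> \<delta> s \<in> fst c1 \<and> ?z s \<in> ball (?z t) r \<and> ?w s \<in> ball (?z t) r \<and> x s \<in> ball (x t) 1"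
    unfolding eventually_nhds_metric by blast
  define K where "K = L * (norm (x t) + 1)"
  have "\<gamma> s = \<delta> s" if s: "dist s t < d" for s
  proof -
    have "norm (?z s - ?w s) \<le> norm (?z t - ?w t) * exp (K * \<bar>s - t\<bar>)"
    proof (rule gronwall[of "ball t d"])
      fix s assume "s \<in> ball t d"
      then have s: "dist s t < d" by (simp add: dist_commute)
      note ds = d(2)[OF s]
      have "(?z has_vector_derivative Ef c1 (x s) (?z s)) (at s)"
        "(?w has_vector_derivative Ef c1 (x s) (?w s)) (at s)"
        using ds c1 by (simp_all add: log_deriv_at_def Ef_def)
      then show "((\<lambda>s. ?z s - ?w s) has_vector_derivative Ef c1 (x s) (?z s) - Ef c1 (x s) (?w s)) (at s)"
        by (rule has_vector_derivative_diff)
      have "norm (x s) \<le> norm (x t) + 1"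
        using ds norm_triangle_sub[of "x s" "x t"] by (simp add: dist_norm norm_minus_commute)
      then have "L * norm (x s) * norm (?z s - ?w s) \<le> K * norm (?z s - ?w s)"
        unfolding K_def using L(1) by (intro mult_right_mono mult_left_mono) auto
      moreover have "norm (Ef c1 (x s) (?z s) - Ef c1 (x s) (?w s)) \<le> L * norm (x s) * norm (?z s - ?w s)"
        using ds by (intro L(2)) auto
      ultimately show "norm (Ef c1 (x s) (?z s) - Ef c1 (x s) (?w s)) \<le> K * norm (?z s - ?w s)"
        by linarith
    qed (use d(1) s in \<open>auto simp: is_interval_ball_real dist_commute\<close>)
    then have "?z s = ?w s" using eq by simp
    then show ?thesis
      using d(2)[OF s] c1(1) chart_inv_left by (metis o_apply)
  qed
  then show ?thesis
    using d(1) unfolding eventually_nhds_metric by blast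
qed

text \<open>The set of times where two curves with the same logarithmic derivative agree is closed
  because the group is Hausdorff, and open by uniqueness for ordinary differential equations in a
  chart.\<close>

lemma log_deriv_unique:
  assumes I: "open_interval I" and t0: "t0 \<in> I" "\<gamma> t0 = \<delta> t0"
    and \<gamma>: "\<And>t. t \<in> I \<Longrightarrow> log_deriv_at \<gamma> t (x t)" and \<delta>: "\<And>t. t \<in> I \<Longrightarrow> log_deriv_at \<delta> t (x t)"
    and x: "continuous_on I x" and t: "t \<in> I"
  shows "\<gamma> t = \<delta> t"
proof -
  have oI: "open I" using I by (simp add: open_interval_def)
  let ?S = "{t \<in> I. \<gamma> t = \<delta> t}"
  have "open ?S"
  proof (rule openI)
    fix t assume t: "t \<in> ?S"
    have ev: "\<forall>\<^sub>F s in nhds t. s \<in> I" using t oI by (intro eventually_nhds_in_open) auto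
    have "\<forall>\<^sub>F s in nhds t. \<gamma> s = \<delta> s"
    proof (rule agree_locally)
      show "\<forall>\<^sub>F s in nhds t. log_deriv_at \<gamma> s (x s)" using ev by eventually_elim (rule \<gamma>)
      show "\<forall>\<^sub>F s in nhds t. log_deriv_at \<delta> s (x s)" using ev by eventually_elim (rule \<delta>)
      show "isCont x t" using x oI t by (simp add: continuous_on_eq_continuous_at)
    qed (use t in simp)
    with ev have "\<forall>\<^sub>F s in nhds t. s \<in> ?S" by eventually_elim simp
    then show "\<exists>e>0. ball t e \<subseteq> ?S"
      unfolding eventually_nhds_metric by (auto simp: dist_commute subset_iff)
  qed
  then have "openin (top_of_set I) ?S" by (intro open_subset) auto
  moreover have "closedin (top_of_set I) ?S"
  proof -
    have "continuous_map (top_of_set I) T \<gamma>" "continuous_map (top_of_set I) T \<delta>"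
      unfolding continuous_map_iff_cont_at[OF oI] using \<gamma> \<delta> by (auto simp: log_deriv_at_def)
    moreover have "Hausdorff_space T" using manifold by (simp add: smooth_manifold_def)
    ultimately show ?thesis
      using closedin_continuous_maps_eq[of T "top_of_set I" \<gamma> \<delta>] by simp
  qed
  moreover have "connected I" using I by (simp add: open_interval_def is_interval_connected_1)
  ultimately have "?S = {} \<or> ?S = I" unfolding connected_clopen by blast
  then show ?thesis using t0 t by blast
qed

text \<open>In the chart at the identity, the field is composed with the projection to a ball, which makes it
  globally Lipschitz. As \<open>y\<close> is bounded, the solution needs a fixed time to leave the ball, whatever
  the initial time \<open>t0\<close>.\<close>

lemma log_deriv_local_existence:
  assumes y: "continuous_on UNIV y" and bdd: "\<And>t. norm (y t) \<le> K"
  shows "\<exists>\<epsilon>>0. \<forall>t0. \<exists>\<gamma>. \<gamma> t0 = \<one> \<and> (\<forall>t\<in>ball t0 \<epsilon>. log_deriv_at \<gamma> t (y t))"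
proof -
  let ?e = "snd c \<one>"
  have K: "K \<ge> 0" using bdd[of 0] norm_ge_zero order_trans by blast
  have e: "?e \<in> img c" using one_in by simp
  obtain r where r: "r > 0" "cball ?e r \<subseteq> img c"
    using chart_props(2)[OF c_in] e open_contains_cball[of "img c"] by blast
  obtain L where L: "L \<ge> 0" "\<And>X z. z \<in> cball ?e r \<Longrightarrow> norm (Ef c X z) \<le> L * norm X"
    "\<And>X z w. z \<in> cball ?e r \<Longrightarrow> w \<in> cball ?e r \<Longrightarrow> norm (Ef c X z - Ef c X w) \<le> L * norm X * norm (z - w)"
    using Ef_bounds[OF c_in r(2)] by blast
  define P where "P = closest_point (cball ?e r)"
  have P: "P z \<in> cball ?e r" for z
    unfolding P_def using r(1) by (intro closest_point_in_set) auto
  have P_id: "P z = z" if "z \<in> cball ?e r" for z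
    unfolding P_def using that by (rule closest_point_self)
  have P_lip: "norm (P z - P z') \<le> norm (z - z')" for z z'
    using closest_point_lipschitz[of "cball ?e r" z z'] r(1)
    by (simp add: P_def dist_norm)
  have contP: "continuous_on UNIV P"
    unfolding P_def using r(1) by (intro continuous_on_closest_point) auto
  define F where "F t z = Ef c (y t) (P z)" for t z
  have F_bdd: "norm (F t z) \<le> L * K" for t z
    using L(2)[OF P, of "y t" z] mult_left_mono[OF bdd[of t] L(1)] unfolding F_def by linarith
  have F_lip: "norm (F t z - F t z') \<le> (L * K) * norm (z - z')" for t z z'
  proof -
    have "norm (F t z - F t z') \<le> L * norm (y t) * norm (P z - P z')"
      unfolding F_def by (rule L(3)[OF P P])
    also have "\<dots> \<le> L * K * norm (z - z')"
      using L(1) K by (intro mult_mono mult_left_mono bdd P_lip) auto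
    finally show ?thesis .
  qed
  have F_cont: "continuous_on UNIV (\<lambda>p. F (fst p) (snd p))"
  proof -
    have Ef_cont: "continuous_on UNIV (\<lambda>p::real \<times> 'e. Ef c b (P (snd p)))" for b
    proof (rule continuous_on_compose2[of "cball ?e r" "Ef c b"])
      show "continuous_on (cball ?e r) (Ef c b)"
        by (rule continuous_on_subset[OF smooth_on_imp_continuous_on[OF smooth_Ef[OF c_in]] r(2)])
      show "continuous_on UNIV (\<lambda>p::real \<times> 'e. P (snd p))"
        by (rule continuous_on_compose2[OF contP]) (auto intro: continuous_intros)
    qed (use P in auto)
    have y_cont: "continuous_on UNIV (\<lambda>p::real \<times> 'e. y (fst p))"
      by (rule continuous_on_compose2[OF y]) (auto intro: continuous_intros)
    have "F (fst p) (snd p) = (\<Sum>b\<in>Basis. (y (fst p) \<bullet> b) *\<^sub>R Ef c b (P (snd p)))" for p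
      unfolding F_def using P r(2) by (intro Ef_expansion[OF c_in]) blast
    then show ?thesis
      using Ef_cont y_cont by (simp add: continuous_intros)
  qed
  define \<epsilon> where "\<epsilon> = r / (L * K + 1)"
  have LK: "L * K \<ge> 0" using L(1) K by simp
  have \<epsilon>: "\<epsilon> > 0" using r(1) LK by (simp add: \<epsilon>_def)
  show ?thesis
  proof (intro exI[of _ \<epsilon>] conjI \<epsilon> allI)
    fix t0
    obtain z where z0: "z t0 = ?e" and z: "\<And>t. (z has_vector_derivative F t (z t)) (at t)"
      using global_solution_bounded_lipschitz[OF F_cont F_bdd F_lip, of t0 ?e] by blast
    have z_in: "z t \<in> ball ?e r" if "t \<in> ball t0 \<epsilon>" for t
    proof -
      have "norm (z t - z t0) \<le> (L * K) * norm (t - t0)"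
      proof (rule differentiable_bound[of UNIV])
        show "(z has_derivative (\<lambda>h. h *\<^sub>R F s (z s))) (at s within UNIV)" for s
          using z[of s] by (simp add: has_vector_derivative_def)
        show "onorm (\<lambda>h. h *\<^sub>R F s (z s)) \<le> L * K" for s
          using F_bdd[of s "z s"] by (intro onorm_le) (simp add: mult.commute mult_left_mono)
      qed auto
      also have "\<dots> \<le> (L * K + 1) * \<bar>t - t0\<bar>" by (simp add: mult_right_mono)
      also have "\<dots> < (L * K + 1) * \<epsilon>"
        using that LK by (intro mult_strict_left_mono) (auto simp: dist_real_def abs_minus_commute)
      also have "\<dots> = r" using LK by (simp add: \<epsilon>_def)
      finally show ?thesis using z0 by (simp add: dist_norm norm_minus_commute)
    qed
    have z_img: "z t \<in> img c" if "t \<in> ball t0 \<epsilon>" for t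
      using z_in[OF that] r(2) ball_subset_cball by blast
    let ?\<gamma> = "chart_inv c \<circ> z"
    have z_cont: "continuous_on UNIV z"
      using z by (meson continuous_at_imp_continuous_on has_vector_derivative_continuous)
    have "continuous_map (top_of_set (ball t0 \<epsilon>)) (top_of_set (img c)) z"
      using continuous_on_subset[OF z_cont] z_img by auto
    then have "continuous_map (top_of_set (ball t0 \<epsilon>)) T ?\<gamma>"
      by (rule continuous_map_compose[OF _ chart_inv_continuous[OF c_in]])
    then have cont: "cont_at ?\<gamma> t" if "t \<in> ball t0 \<epsilon>" for t
      using that continuous_map_iff_cont_at[of "ball t0 \<epsilon>"] by blast
    have "log_deriv_at ?\<gamma> t (y t)" if t: "t \<in> ball t0 \<epsilon>" for t
    proof (rule log_deriv_atI[OF _ c_in])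
      have ev: "\<forall>\<^sub>F s in nhds t. s \<in> ball t0 \<epsilon>" using t by (intro eventually_nhds_in_open) auto
      then show "\<forall>\<^sub>F s in nhds t. cont_at ?\<gamma> s" by eventually_elim (rule cont)
      show "?\<gamma> t \<in> fst c" using z_img[OF t] by simp
      have "F t (z t) = E c (?\<gamma> t) (y t)"
        using z_in[OF t] ball_subset_cball by (auto simp: F_def Ef_def P_id)
      then have "(z has_vector_derivative E c (?\<gamma> t) (y t)) (at t)" using z[of t] by simp
      moreover have "\<forall>\<^sub>F s in nhds t. z s = (snd c \<circ> ?\<gamma>) s"
        using ev by eventually_elim (simp add: z_img)
      ultimately show "((snd c \<circ> ?\<gamma>) has_vector_derivative E c (?\<gamma> t) (y t)) (at t)"
        using has_vector_derivative_cong_nhds by blast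
    qed
    moreover have "?\<gamma> t0 = \<one>" using z0 c_in one_in by simp
    ultimately show "\<exists>\<gamma>. \<gamma> t0 = \<one> \<and> (\<forall>t\<in>ball t0 \<epsilon>. log_deriv_at \<gamma> t (y t))" by blast
  qed
qed

lemma log_deriv_glue:
  assumes I: "open_interval I" "open_interval J" and t1: "t1 \<in> I" "t1 \<in> J" "\<gamma> t1 = \<delta> t1"
    and \<gamma>: "\<And>t. t \<in> I \<Longrightarrow> log_deriv_at \<gamma> t (y t)" and \<delta>: "\<And>t. t \<in> J \<Longrightarrow> log_deriv_at \<delta> t (y t)"
    and y: "continuous_on UNIV y" and t: "t \<in> I \<union> J"
  shows "log_deriv_at (\<lambda>t. if t \<in> I then \<gamma> t else \<delta> t) t (y t)"
proof (cases "t \<in> I")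
  case True
  then have "\<forall>\<^sub>F s in nhds t. s \<in> I" using I by (intro eventually_nhds_in_open) (auto simp: open_interval_def)
  then have "\<forall>\<^sub>F s in nhds t. \<gamma> s = (if s \<in> I then \<gamma> s else \<delta> s)" by eventually_elim simp
  then show ?thesis by (rule log_deriv_at_cong[OF _ \<gamma>[OF True]])
next
  case False
  then have tJ: "t \<in> J" using t by simp
  then have ev: "\<forall>\<^sub>F s in nhds t. s \<in> J" using I by (intro eventually_nhds_in_open) (auto simp: open_interval_def)
  have eq: "\<gamma> s = \<delta> s" if "s \<in> I \<inter> J" for s
    by (rule log_deriv_unique[OF open_interval_Int[OF I, of t1] _ t1(3) \<gamma> \<delta> continuous_on_subset[OF y] that])
       (use t1 in auto)
  have "\<forall>\<^sub>F s in nhds t. \<delta> s = (if s \<in> I then \<gamma> s else \<delta> s)"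
    using ev by (rule eventually_mono) (simp add: eq)
  then show ?thesis by (rule log_deriv_at_cong[OF _ \<delta>[OF tJ]])
qed

text \<open>Left translation carries the local solution at the identity to every point of the group, so
  that a solution can be prolonged at both ends by a fixed amount.\<close>

lemma log_deriv_extend:
  assumes y: "continuous_on UNIV y" and \<epsilon>: "\<epsilon> > 0"
    and loc: "\<And>t0. \<exists>\<gamma>. \<gamma> t0 = \<one> \<and> (\<forall>t\<in>ball t0 \<epsilon>. log_deriv_at \<gamma> t (y t))"
    and I: "open_interval I" "t1 \<in> I" and \<gamma>: "\<And>t. t \<in> I \<Longrightarrow> log_deriv_at \<gamma> t (y t)"
  shows "\<exists>\<gamma>'. (\<forall>t\<in>I. \<gamma>' t = \<gamma> t) \<and> (\<forall>t\<in>I \<union> ball t1 \<epsilon>. log_deriv_at \<gamma>' t (y t))"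
proof -
  obtain \<psi> where \<psi>: "\<psi> t1 = \<one>" "\<And>t. t \<in> ball t1 \<epsilon> \<Longrightarrow> log_deriv_at \<psi> t (y t)"
    using loc by blast
  have g: "\<gamma> t1 \<in> carrier G" using \<gamma>[OF I(2)] by (simp add: log_deriv_at_def cont_at_def)
  let ?\<delta> = "\<lambda>t. \<gamma> t1 \<otimes> \<psi> t"
  have "log_deriv_at ?\<delta> t (y t)" if "t \<in> ball t1 \<epsilon>" for t
    by (rule log_deriv_at_left_translate[OF g \<psi>(2)[OF that]])
  moreover have "\<gamma> t1 = ?\<delta> t1" using g \<psi>(1) by simp
  ultimately have "log_deriv_at (\<lambda>t. if t \<in> I then \<gamma> t else ?\<delta> t) t (y t)" if "t \<in> I \<union> ball t1 \<epsilon>" for t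
    using log_deriv_glue[OF I(1) open_interval_ball[OF \<epsilon>] I(2) _ _ \<gamma> _ y that] \<epsilon> by simp
  then show ?thesis
    by (intro exI[of _ "\<lambda>t. if t \<in> I then \<gamma> t else ?\<delta> t"]) simp
qed

lemma log_deriv_bounded_existence:
  assumes y: "continuous_on UNIV y" and bdd: "\<And>t. norm (y t) \<le> K" and g: "g \<in> carrier G"
  shows "\<exists>\<gamma>. \<gamma> t0 = g \<and> (\<forall>t\<in>ball t0 R. log_deriv_at \<gamma> t (y t))"
proof -
  obtain \<epsilon> where \<epsilon>: "\<epsilon> > 0" and loc: "\<And>t0. \<exists>\<gamma>. \<gamma> t0 = \<one> \<and> (\<forall>t\<in>ball t0 \<epsilon>. log_deriv_at \<gamma> t (y t))"
    using log_deriv_local_existence[OF y bdd] by blast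
  have step: "\<exists>\<gamma>. \<gamma> t0 = g \<and> (\<forall>t\<in>ball t0 (real (Suc n) * (\<epsilon> / 2)). log_deriv_at \<gamma> t (y t))" for n
  proof (induction n)
    case 0
    obtain \<psi> where \<psi>: "\<psi> t0 = \<one>" "\<And>t. t \<in> ball t0 \<epsilon> \<Longrightarrow> log_deriv_at \<psi> t (y t)"
      using loc by blast
    have "log_deriv_at (\<lambda>t. g \<otimes> \<psi> t) t (y t)" if "t \<in> ball t0 (\<epsilon> / 2)" for t
      using that \<epsilon> by (intro log_deriv_at_left_translate[OF g \<psi>(2)]) auto
    then show ?case using \<psi>(1) g by (intro exI[of _ "\<lambda>t. g \<otimes> \<psi> t"]) simp
  next
    case (Suc n)
    let ?r = "real (Suc n) * (\<epsilon> / 2)"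
    have "?r \<ge> 1 * (\<epsilon> / 2)" by (rule mult_right_mono) (use \<epsilon> in auto)
    then have r: "?r > 0" "?r \<ge> \<epsilon> / 2" using \<epsilon> by linarith+
    from Suc obtain \<gamma> where \<gamma>: "\<gamma> t0 = g" "\<And>t. t \<in> ball t0 ?r \<Longrightarrow> log_deriv_at \<gamma> t (y t)" by blast
    \<comment> \<open>From these points, at distance \<open>\<epsilon> / 2\<close> from the ends of the ball, the local solutions reach
      \<open>\<epsilon> / 2\<close> beyond the ends.\<close>
    let ?a = "t0 + (?r - \<epsilon> / 2)" and ?b = "t0 - (?r - \<epsilon> / 2)"
    have a: "?a \<in> ball t0 ?r" and b: "?b \<in> ball t0 ?r" using r \<epsilon> by (auto simp: dist_real_def)
    obtain \<gamma>1 where \<gamma>1: "\<And>t. t \<in> ball t0 ?r \<Longrightarrow> \<gamma>1 t = \<gamma> t"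
      "\<And>t. t \<in> ball t0 ?r \<union> ball ?a \<epsilon> \<Longrightarrow> log_deriv_at \<gamma>1 t (y t)"
      using log_deriv_extend[OF y \<epsilon> loc open_interval_ball[OF r(1)] a \<gamma>(2)] by blast
    have J: "open_interval (ball t0 ?r \<union> ball ?a \<epsilon>)"
    proof -
      have "?a \<in> ball ?a \<epsilon>" using \<epsilon> by simp
      then show ?thesis
        using a unfolding open_interval_def
        by (auto simp: is_interval_connected_1 intro!: connected_Un)
    qed
    obtain \<gamma>2 where \<gamma>2: "\<And>t. t \<in> ball t0 ?r \<union> ball ?a \<epsilon> \<Longrightarrow> \<gamma>2 t = \<gamma>1 t"
      "\<And>t. t \<in> ball t0 ?r \<union> ball ?a \<epsilon> \<union> ball ?b \<epsilon> \<Longrightarrow> log_deriv_at \<gamma>2 t (y t)"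
      using log_deriv_extend[OF y \<epsilon> loc J _ \<gamma>1(2), of ?b] b by blast
    have "\<gamma>2 t0 = g" using \<gamma>2(1)[of t0] \<gamma>1(1)[of t0] \<gamma>(1) r(1) by simp
    moreover have "ball t0 (real (Suc (Suc n)) * (\<epsilon> / 2)) \<subseteq> ball t0 ?r \<union> ball ?a \<epsilon> \<union> ball ?b \<epsilon>"
    proof
      fix t assume t: "t \<in> ball t0 (real (Suc (Suc n)) * (\<epsilon> / 2))"
      have "real (Suc (Suc n)) = real (Suc n) + 1" by simp
      then have "real (Suc (Suc n)) * (\<epsilon> / 2) = ?r + \<epsilon> / 2"
        by (simp only: distrib_right mult_1_left)
      with t have "\<bar>t - t0\<bar> < ?r + \<epsilon> / 2"
        by (simp add: dist_real_def abs_minus_commute del: of_nat_Suc)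
      then show "t \<in> ball t0 ?r \<union> ball ?a \<epsilon> \<union> ball ?b \<epsilon>"
      proof (cases "\<bar>t - t0\<bar> < ?r")
        case True
        then show ?thesis by (simp add: dist_real_def abs_minus_commute)
      next
        case False
        with \<open>\<bar>t - t0\<bar> < ?r + \<epsilon> / 2\<close> have "\<bar>?a - t\<bar> < \<epsilon> \<or> \<bar>?b - t\<bar> < \<epsilon>"
          using \<epsilon> r(1) by linarith
        then show ?thesis unfolding Un_iff mem_ball dist_real_def by blast
      qed
    qed
    ultimately show ?case using \<gamma>2(2) by blast
  qed
  obtain n where "R / (\<epsilon> / 2) < real n" using reals_Archimedean2 by blast
  then have "R < real (Suc n) * (\<epsilon> / 2)" using \<epsilon> by (simp add: field_simps)
  then have "ball t0 R \<subseteq> ball t0 (real (Suc n) * (\<epsilon> / 2))" by (intro subset_ball) simp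
  then show ?thesis using step[of n] by blast
qed

text \<open>On each ball around \<open>t0\<close> the function \<open>y\<close> may be replaced by a bounded one, which is constant
  on each side of the ball.\<close>

theorem log_deriv_existence:
  assumes y: "continuous_on UNIV y" and g: "g \<in> carrier G"
  shows "\<exists>\<gamma>. \<gamma> t0 = g \<and> (\<forall>t. log_deriv_at \<gamma> t (y t))"
proof -
  have "\<exists>\<gamma>. \<gamma> t0 = g \<and> (\<forall>t\<in>ball t0 (real (Suc n)). log_deriv_at \<gamma> t (y t))" for n
  proof -
    let ?R = "real (Suc n)"
    define yn where "yn t = y (max (t0 - ?R) (min (t0 + ?R) t))" for t
    have "continuous_on UNIV yn"
      unfolding yn_def by (intro continuous_on_compose2[OF y] continuous_intros) auto
    moreover have "\<exists>K. \<forall>t. norm (yn t) \<le> K"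
    proof -
      obtain K where "\<forall>s\<in>cball t0 ?R. norm (y s) \<le> K"
        using continuous_on_cball_bounded[OF continuous_on_subset[OF y]] by blast
      then show ?thesis
        by (intro exI[of _ K]) (auto simp: yn_def dist_real_def)
    qed
    ultimately obtain \<gamma> where \<gamma>: "\<gamma> t0 = g" "\<forall>t\<in>ball t0 ?R. log_deriv_at \<gamma> t (yn t)"
      using log_deriv_bounded_existence[OF _ _ g] by blast
    have "yn t = y t" if "t \<in> ball t0 ?R" for t
    proof -
      have "max (t0 - ?R) (min (t0 + ?R) t) = t" using that by (simp add: dist_real_def)
      then show ?thesis by (simp add: yn_def)
    qed
    then show ?thesis using \<gamma> by (intro exI[of _ \<gamma>]) simp
  qed
  then obtain f where f: "\<And>n. f n t0 = g"
    "\<And>n t. t \<in> ball t0 (real (Suc n)) \<Longrightarrow> log_deriv_at (f n) t (y t)" by metis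
  have "f n t = f m t" if "n \<le> m" "\<bar>t - t0\<bar> < real (Suc n)" for n m t
  proof (rule log_deriv_unique[of "ball t0 (real (Suc n))" t0 "f n" "f m" y t])
    show "log_deriv_at (f n) s (y s)" "log_deriv_at (f m) s (y s)" if "s \<in> ball t0 (real (Suc n))" for s
      using that \<open>n \<le> m\<close> by (auto intro!: f(2))
    show "t \<in> ball t0 (real (Suc n))" using that by (simp add: dist_real_def abs_minus_commute)
    show "continuous_on (ball t0 (real (Suc n))) y" using y by (rule continuous_on_subset) simp
  qed (simp_all add: f(1) open_interval_ball)
  then obtain \<gamma> where \<gamma>: "\<And>n t. \<bar>t - t0\<bar> < real (Suc n) \<Longrightarrow> \<gamma> t = f n t"
    using glue_increasing_balls[of t0 f] by blast
  have "log_deriv_at \<gamma> t (y t)" for t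
  proof -
    obtain n where "\<bar>t - t0\<bar> < real n" using reals_Archimedean2 by blast
    then have n: "t \<in> ball t0 (real (Suc n))" by (simp add: dist_real_def)
    then have "\<forall>\<^sub>F s in nhds t. s \<in> ball t0 (real (Suc n))" by (intro eventually_nhds_in_open) auto
    then have "\<forall>\<^sub>F s in nhds t. f n s = \<gamma> s"
      by eventually_elim (simp add: \<gamma> dist_real_def abs_minus_commute)
    then show ?thesis by (rule log_deriv_at_cong[OF _ f(2)[OF n]])
  qed
  moreover have "\<gamma> t0 = g" using \<gamma>[of t0 0] f(1) by simp
  ultimately show ?thesis by blast
qed

text \<open>By the equation \<open>z' = E (x)\<close> in a chart, each degree of smoothness of the curve gives the
  next one.\<close>

lemma smooth_curve_log_deriv:
  assumes I: "open_interval I" and \<gamma>: "\<And>t. t \<in> I \<Longrightarrow> log_deriv_at \<gamma> t (x t)" and x: "smooth_on I x"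
  shows "smooth_curve T A I \<gamma>"
  unfolding smooth_curve_def smooth_map_def
proof (intro conjI ballI)
  have oI: "open I" using I by (simp add: open_interval_def)
  show cont: "continuous_map (top_of_set I) T \<gamma>"
    unfolding continuous_map_iff_cont_at[OF oI] using \<gamma> by (simp add: log_deriv_at_def)
  fix i c' assume i: "i \<in> {(I, id :: real \<Rightarrow> real)}" and c': "c' \<in> A"
  let ?S = "{t \<in> I. \<gamma> t \<in> fst c'}" and ?z = "snd c' \<circ> \<gamma>"
  have "openin (top_of_set I) ?S"
    using openin_continuous_map_preimage[OF cont chart_props(1)[OF c']] by simp
  then have oS: "open ?S" using oI openin_open_eq by blast
  have "Ck_on k ?z ?S" for k
  proof (induction k)
    case 0
    have "isCont ?z t" if "t \<in> ?S" for t
      using \<gamma>[of t] that c' by (auto simp: log_deriv_at_def intro: has_vector_derivative_continuous)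
    then show ?case unfolding Ck_on.simps by (intro continuous_at_imp_continuous_on ballI)
  next
    case (Suc k)
    show ?case
    proof (rule Ck_on_Suc_real)
      fix t assume t: "t \<in> ?S"
      have "(?z has_vector_derivative Ef c' (x t) (?z t)) (at t)"
        using \<gamma>[of t] t c' by (simp add: log_deriv_at_def Ef_def)
      then show "(?z has_vector_derivative (\<Sum>b\<in>Basis. (x t \<bullet> b) *\<^sub>R Ef c' b (?z t))) (at t)"
        using t by (subst Ef_expansion[OF c', symmetric]) auto
    next
      have "Ck_on k x ?S" using x Ck_on_subset[of k x I ?S] by (auto simp: smooth_on_def)
      moreover have "Ck_on k (\<lambda>t. Ef c' b (?z t)) ?S" for b
      proof (rule Ck_on_compose[OF _ Suc])
        show "Ck_on k (Ef c' b) (img c')" using smooth_Ef[OF c'] by (simp add: smooth_on_def)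
      qed auto
      ultimately show "Ck_on k (\<lambda>t. \<Sum>b\<in>Basis. (x t \<bullet> b) *\<^sub>R Ef c' b (?z t)) ?S"
        by (intro Ck_on_sum Ck_on_bilinear[OF bounded_bilinear_scaleR]
            Ck_on_bounded_linear_compose[OF bounded_linear_inner_left])
    qed
  qed
  then have "smooth_on ?S ?z" by (simp add: smooth_on_def)
  moreover have "?z t = (snd c' \<circ> \<gamma> \<circ> chart_inv i) t" if "t \<in> ?S" for t
  proof -
    have "chart_inv i t = t" using i that by (simp add: chart_inv_def inv_into_f_eq)
    then show ?thesis by simp
  qed
  ultimately have "smooth_on ?S (snd c' \<circ> \<gamma> \<circ> chart_inv i)"
    using smooth_on_cong_open[OF oS, of ?z "snd c' \<circ> \<gamma> \<circ> chart_inv i"] by blast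
  then show "smooth_on (snd i ` {p \<in> fst i. \<gamma> p \<in> fst c'}) (snd c' \<circ> \<gamma> \<circ> chart_inv i)"
    using i by simp
qed

lemma smooth_curveD:
  assumes "open I" "smooth_curve T A I \<gamma>"
  shows "t \<in> I \<Longrightarrow> cont_at \<gamma> t"
    and "c' \<in> A \<Longrightarrow> open {t \<in> I. \<gamma> t \<in> fst c'}"
    and "c' \<in> A \<Longrightarrow> smooth_on {t \<in> I. \<gamma> t \<in> fst c'} (snd c' \<circ> \<gamma>)"
proof -
  have cont: "continuous_map (top_of_set I) T \<gamma>"
    using assms(2) by (simp add: smooth_curve_def smooth_map_def)
  then show "t \<in> I \<Longrightarrow> cont_at \<gamma> t" using continuous_map_iff_cont_at[OF assms(1)] by blast
  assume c': "c' \<in> A"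
  let ?S = "{t \<in> I. \<gamma> t \<in> fst c'}"
  have "openin (top_of_set I) ?S"
    using openin_continuous_map_preimage[OF cont chart_props(1)[OF c']] by simp
  then show S: "open ?S" using assms(1) openin_open_eq by blast
  have smooth: "smooth_on ?S (snd c' \<circ> \<gamma> \<circ> chart_inv (I, id :: real \<Rightarrow> real))"
    using assms(2) c' by (simp add: smooth_curve_def smooth_map_def)
  have "chart_inv (I, id :: real \<Rightarrow> real) t = t" if "t \<in> I" for t
    using that by (simp add: chart_inv_def inv_into_f_eq)
  then show "smooth_on ?S (snd c' \<circ> \<gamma>)"
    by (intro smooth_on_cong_open[OF S _ smooth]) simp
qed

end

section \<open>Geodesics of a left invariant metric\<close>

text \<open>The product rule for \<open>D\<tau> (h y) (W y)\<close>. Smoothness speaks of derivatives in constant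
  directions, so the direction \<open>W y\<close> is expanded in the standard basis.\<close>

lemma has_derivative_moving_direction:
  fixes \<tau> :: "'a::euclidean_space \<Rightarrow> 'b::real_normed_vector" and W :: "'c::real_normed_vector \<Rightarrow> 'a"
  assumes S: "open S" "e \<in> S" and \<tau>: "smooth_on S \<tau>" and W: "(W has_derivative W') (at e0)"
    and h: "(h has_derivative h') (at e0)" "h e0 = e"
  shows "((\<lambda>y. frechet_derivative \<tau> (at (h y)) (W y)) has_derivative
    (\<lambda>u. frechet_derivative \<tau> (at e) (W' u) +
      frechet_derivative (\<lambda>y. frechet_derivative \<tau> (at y) (W e0)) (at e) (h' u))) (at e0)"
proof -
  let ?D = "\<lambda>y. frechet_derivative \<tau> (at y)"
  let ?D2 = "\<lambda>b. frechet_derivative (\<lambda>y. ?D y b) (at e)"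
  have lin: "linear (?D y)" if "y \<in> S" for y
    by (rule has_derivative_linear[OF smooth_on_has_derivative[OF \<tau> that]])
  have D2: "((\<lambda>y. ?D y b) has_derivative ?D2 b) (at e)" for b
    by (rule smooth_on_has_derivative[OF smooth_on_frechet_derivative[OF S(1) \<tau>] S(2)])
  have D2h: "((\<lambda>y. ?D (h y) b) has_derivative (\<lambda>u. ?D2 b (h' u))) (at e0)" for b
    using has_derivative_compose[OF h(1), of "\<lambda>y. ?D y b" "?D2 b"] D2[of b] h(2) by simp
  have sum: "((\<lambda>y. \<Sum>b\<in>Basis. (W y \<bullet> b) *\<^sub>R ?D (h y) b) has_derivative
      (\<lambda>u. \<Sum>b\<in>Basis. (W e0 \<bullet> b) *\<^sub>R ?D2 b (h' u) + (W' u \<bullet> b) *\<^sub>R ?D e b)) (at e0)"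
  proof (rule has_derivative_sum)
    fix b :: 'a
    have "((\<lambda>y. W y \<bullet> b) has_derivative (\<lambda>u. W' u \<bullet> b)) (at e0)"
      by (rule bounded_linear.has_derivative[OF bounded_linear_inner_left W])
    from bounded_bilinear.FDERIV[OF bounded_bilinear_scaleR this D2h[of b]]
    show "((\<lambda>y. (W y \<bullet> b) *\<^sub>R ?D (h y) b) has_derivative
      (\<lambda>u. (W e0 \<bullet> b) *\<^sub>R ?D2 b (h' u) + (W' u \<bullet> b) *\<^sub>R ?D e b)) (at e0)"
      by (simp add: h(2))
  qed
  have D2W: "?D2 w u = (\<Sum>b\<in>Basis. (w \<bullet> b) *\<^sub>R ?D2 b u)" for w u
  proof -
    have "((\<lambda>y. \<Sum>b\<in>Basis. (w \<bullet> b) *\<^sub>R ?D y b) has_derivative (\<lambda>u. \<Sum>b\<in>Basis. (w \<bullet> b) *\<^sub>R ?D2 b u)) (at e)"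
      by (intro has_derivative_sum bounded_linear.has_derivative[OF bounded_linear_scaleR_right] D2)
    then have "((\<lambda>y. ?D y w) has_derivative (\<lambda>u. \<Sum>b\<in>Basis. (w \<bullet> b) *\<^sub>R ?D2 b u)) (at e)"
      by (rule has_derivative_transform_within_open[OF _ S])
         (rule linear_basis_expansion[OF lin, symmetric])
    from has_derivative_unique[OF this D2[of w]] show ?thesis by (simp add: fun_eq_iff)
  qed
  have hS: "\<forall>\<^sub>F y in nhds e0. h y \<in> S"
  proof -
    have "(h \<longlongrightarrow> h e0) (nhds e0)"
      using has_derivative_continuous[OF h(1)] by (simp add: continuous_at tendsto_at_iff_tendsto_nhds)
    then show ?thesis using S h(2) by (auto intro: topological_tendstoD)
  qed
  then obtain U where U: "open U" "e0 \<in> U" "\<And>y. y \<in> U \<Longrightarrow> h y \<in> S"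
    unfolding eventually_nhds by blast
  have "((\<lambda>y. ?D (h y) (W y)) has_derivative
      (\<lambda>u. \<Sum>b\<in>Basis. (W e0 \<bullet> b) *\<^sub>R ?D2 b (h' u) + (W' u \<bullet> b) *\<^sub>R ?D e b)) (at e0)"
    by (rule has_derivative_transform_within_open[OF sum U(1,2)])
       (rule linear_basis_expansion[OF lin, symmetric], rule U(3))
  moreover have "(\<Sum>b\<in>Basis. (W e0 \<bullet> b) *\<^sub>R ?D2 b (h' u) + (W' u \<bullet> b) *\<^sub>R ?D e b)
      = ?D e (W' u) + ?D2 (W e0) (h' u)" for u
    unfolding sum.distrib D2W[of "W e0" "h' u"] linear_basis_expansion[OF lin[OF S(2)], of "W' u"]
    by (rule add.commute)
  ultimately show ?thesis by simp
qed

lemma bilinear_basis_expansion: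
  fixes h :: "'a::euclidean_space \<Rightarrow> 'a \<Rightarrow> real"
  assumes "bilinear h"
  shows "h v w = (\<Sum>i\<in>Basis. \<Sum>j\<in>Basis. (v \<bullet> i) * ((w \<bullet> j) * h i j))"
proof -
  have "linear (\<lambda>v. h v w)" and r: "linear (h i)" for i
    using assms by (simp_all add: bilinear_def)
  from linear_basis_expansion[OF this(1), of v]
  have "h v w = (\<Sum>i\<in>Basis. (v \<bullet> i) * h i w)" by simp
  also have "\<dots> = (\<Sum>i\<in>Basis. (v \<bullet> i) * (\<Sum>j\<in>Basis. (w \<bullet> j) * h i j))"
    using linear_basis_expansion[OF r, of _ w] by (intro sum.cong refl) simp
  finally show ?thesis by (simp only: sum_distrib_left)
qed

lemma has_derivative_bilinear_field:
  fixes Q :: "'e::euclidean_space \<Rightarrow> 'e \<Rightarrow> 'e \<Rightarrow> real" and Z V W :: "'a::real_normed_vector \<Rightarrow> 'e"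
  assumes S: "open S" "Z s0 \<in> S" and bil: "\<And>x. x \<in> S \<Longrightarrow> bilinear (Q x)"
    and Q: "\<And>v w. smooth_on S (\<lambda>x. Q x v w)"
    and Z: "(Z has_derivative Z') (at s0)" and V: "(V has_derivative V') (at s0)"
    and W: "(W has_derivative W') (at s0)"
  shows "((\<lambda>s. Q (Z s) (V s) (W s)) has_derivative (\<lambda>u.
    frechet_derivative (\<lambda>x. Q x (V s0) (W s0)) (at (Z s0)) (Z' u) +
    Q (Z s0) (V' u) (W s0) + Q (Z s0) (V s0) (W' u))) (at s0)"
proof -
  let ?D = "\<lambda>v w. frechet_derivative (\<lambda>x. Q x v w) (at (Z s0))"
  have D: "((\<lambda>x. Q x v w) has_derivative ?D v w) (at (Z s0))" for v w
    by (rule smooth_on_has_derivative[OF Q S(2)])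
  have D_expand: "?D v w u = (\<Sum>i\<in>Basis. \<Sum>j\<in>Basis. (v \<bullet> i) * ((w \<bullet> j) * ?D i j u))" for v w u
  proof -
    have "((\<lambda>x. \<Sum>i\<in>Basis. \<Sum>j\<in>Basis. (v \<bullet> i) * ((w \<bullet> j) * Q x i j)) has_derivative
        (\<lambda>u. \<Sum>i\<in>Basis. \<Sum>j\<in>Basis. (v \<bullet> i) * ((w \<bullet> j) * ?D i j u))) (at (Z s0))"
      by (intro has_derivative_sum has_derivative_mult_right D)
    then have "((\<lambda>x. Q x v w) has_derivative
        (\<lambda>u. \<Sum>i\<in>Basis. \<Sum>j\<in>Basis. (v \<bullet> i) * ((w \<bullet> j) * ?D i j u))) (at (Z s0))"
      by (rule has_derivative_transform_within_open[OF _ S])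
         (rule bilinear_basis_expansion[OF bil, symmetric])
    from has_derivative_unique[OF this D[of v w]] show ?thesis by (simp add: fun_eq_iff)
  qed
  have Vb: "((\<lambda>s. V s \<bullet> b) has_derivative (\<lambda>u. V' u \<bullet> b)) (at s0)"
    and Wb: "((\<lambda>s. W s \<bullet> b) has_derivative (\<lambda>u. W' u \<bullet> b)) (at s0)" for b
    using bounded_linear.has_derivative[OF bounded_linear_inner_left] V W by blast+
  have DZ: "((\<lambda>s. Q (Z s) i j) has_derivative (\<lambda>u. ?D i j (Z' u))) (at s0)" for i j
    by (rule has_derivative_compose[OF Z D])
  have sum: "((\<lambda>s. \<Sum>i\<in>Basis. \<Sum>j\<in>Basis. (V s \<bullet> i) * ((W s \<bullet> j) * Q (Z s) i j)) has_derivative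
      (\<lambda>u. \<Sum>i\<in>Basis. \<Sum>j\<in>Basis. (V s0 \<bullet> i) * ((W s0 \<bullet> j) * ?D i j (Z' u) + (W' u \<bullet> j) * Q (Z s0) i j) +
        (V' u \<bullet> i) * ((W s0 \<bullet> j) * Q (Z s0) i j))) (at s0)"
    by (intro has_derivative_sum has_derivative_mult Vb Wb DZ)
  obtain U where U: "open U" "s0 \<in> U" "\<And>s. s \<in> U \<Longrightarrow> Z s \<in> S"
  proof -
    have "(Z \<longlongrightarrow> Z s0) (nhds s0)"
      using has_derivative_continuous[OF Z] by (simp add: continuous_at tendsto_at_iff_tendsto_nhds)
    then have "\<forall>\<^sub>F s in nhds s0. Z s \<in> S" using S by (rule topological_tendstoD)
    then show ?thesis using that unfolding eventually_nhds by blast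
  qed
  have "((\<lambda>s. Q (Z s) (V s) (W s)) has_derivative
      (\<lambda>u. \<Sum>i\<in>Basis. \<Sum>j\<in>Basis. (V s0 \<bullet> i) * ((W s0 \<bullet> j) * ?D i j (Z' u) + (W' u \<bullet> j) * Q (Z s0) i j) +
        (V' u \<bullet> i) * ((W s0 \<bullet> j) * Q (Z s0) i j))) (at s0)"
    by (rule has_derivative_transform_within_open[OF sum U(1,2)])
       (rule bilinear_basis_expansion[OF bil[OF U(3)], symmetric])
  moreover have "(\<Sum>i\<in>Basis. \<Sum>j\<in>Basis. (V s0 \<bullet> i) * ((W s0 \<bullet> j) * ?D i j (Z' u) + (W' u \<bullet> j) * Q (Z s0) i j) +
        (V' u \<bullet> i) * ((W s0 \<bullet> j) * Q (Z s0) i j)) =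
      ?D (V s0) (W s0) (Z' u) + Q (Z s0) (V' u) (W s0) + Q (Z s0) (V s0) (W' u)" for u
    unfolding D_expand[of "V s0" "W s0"] bilinear_basis_expansion[OF bil[OF S(2)], of "V' u" "W s0"]
      bilinear_basis_expansion[OF bil[OF S(2)], of "V s0" "W' u"]
    by (simp add: sum.distrib distrib_left)
  ultimately show ?thesis by simp
qed

lemma nondegenerate_riesz:
  fixes B :: "'e::euclidean_space \<Rightarrow> 'e \<Rightarrow> real"
  assumes "bilinear B" "\<And>v. (\<And>w. B v w = 0) \<Longrightarrow> v = 0" "linear l"
  shows "\<exists>!z. \<forall>u. B z u = l u"
proof -
  have lin: "linear (\<lambda>v. B v w)" "linear (B v)" for v w
    using assms(1) by (simp_all add: bilinear_def)
  define P where "P z = (\<Sum>b\<in>Basis. B z b *\<^sub>R b)" for z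
  have P: "P z \<bullet> b = B z b" if "b \<in> Basis" for z b
    using that by (simp add: P_def inner_sum_left inner_Basis if_distrib cong: if_cong)
  have eqI: "\<forall>u. f u = g u" if "linear f" "linear g" "\<And>b. b \<in> Basis \<Longrightarrow> f b = g b" for f g :: "'e \<Rightarrow> real"
    using linear_eq_stdbasis[OF that(1,2)] that(3) by blast
  have linP: "linear P"
  proof (rule linearI)
    show "P (x + y) = P x + P y" for x y
      by (rule euclidean_eqI) (simp add: P inner_add_left linear_add[OF lin(1)])
    show "P (r *\<^sub>R x) = r *\<^sub>R P x" for r x
      by (rule euclidean_eqI) (simp add: P linear_scale[OF lin(1)])
  qed
  have "z = 0" if "P z = 0" for z
  proof (rule assms(2))
    have "\<forall>u. B z u = (\<lambda>u. 0) u"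
      using P[of _ z] that by (intro eqI lin(2) linear_zero) auto
    then show "B z w = 0" for w by simp
  qed
  then have "inj P" using linP by (simp add: linear_injective_0)
  then have "surj P" by (rule linear_inj_imp_surj[OF linP])
  then obtain z where "P z = (\<Sum>b\<in>Basis. l b *\<^sub>R b)" by (metis surjD)
  then have "B z b = l b" if "b \<in> Basis" for b
    using P[OF that, of z] that by (simp add: inner_sum_left inner_Basis if_distrib cong: if_cong)
  then have z: "\<forall>u. B z u = l u" by (rule eqI[OF lin(2) assms(3)])
  show ?thesis
  proof (rule ex1I[of _ z])
    fix y assume "\<forall>u. B y u = l u"
    then have "y - z = 0" using z by (intro assms(2)) (simp add: linear_diff[OF lin(1)])
    then show "y = z" by simp
  qed (rule z)
qed

context lie_group_chart
begin

abbreviation dE :: "('g, 'e) chart \<Rightarrow> 'e \<Rightarrow> 'e \<Rightarrow> 'e \<Rightarrow> 'e" where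
  "dE c' X x \<equiv> frechet_derivative (Ef c' X) (at x)"

lemma dE_has_derivative:
  "c' \<in> A \<Longrightarrow> x \<in> img c' \<Longrightarrow> (Ef c' X has_derivative dE c' X x) (at x)"
  by (rule smooth_on_has_derivative[OF smooth_Ef])

lemma dE_expansion:
  assumes "c' \<in> A" "x \<in> img c'"
  shows "dE c' X x u = (\<Sum>b\<in>Basis. (X \<bullet> b) *\<^sub>R dE c' b x u)"
proof -
  have "((\<lambda>x. \<Sum>b\<in>Basis. (X \<bullet> b) *\<^sub>R Ef c' b x) has_derivative (\<lambda>u. \<Sum>b\<in>Basis. (X \<bullet> b) *\<^sub>R dE c' b x u)) (at x)"
    by (intro has_derivative_sum bounded_linear.has_derivative[OF bounded_linear_scaleR_right] dE_has_derivative assms)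
  then have "(Ef c' X has_derivative (\<lambda>u. \<Sum>b\<in>Basis. (X \<bullet> b) *\<^sub>R dE c' b x u)) (at x)"
    by (rule has_derivative_transform_within_open[OF _ chart_props(2)[OF assms(1)] assms(2)])
       (rule Ef_expansion[OF assms(1), symmetric])
  from has_derivative_unique[OF this dE_has_derivative[OF assms]] show ?thesis by (simp add: fun_eq_iff)
qed

lemma one_img: "snd c \<one> \<in> img c"
  using one_in by simp

lemma lie_bracket_eq:
  "lie_bracket G c X Y = dE c Y (snd c \<one>) X - dE c X (snd c \<one>) Y"
  using c_in one_in
  by (simp add: lie_bracket_def field_bracket_def left_inv_field_eq) (simp add: Ef_def E_one)

lemma lie_bracket_bilinear: "bilinear (lie_bracket G c)"
proof -
  have u: "linear (dE c X (snd c \<one>))" for X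
    by (rule has_derivative_linear[OF dE_has_derivative[OF c_in one_img]])
  have X: "linear (\<lambda>X. dE c X (snd c \<one>) u)" for u
  proof -
    have eq: "(\<lambda>X. dE c X (snd c \<one>) u) = (\<lambda>X. \<Sum>b\<in>Basis. (X \<bullet> b) *\<^sub>R dE c b (snd c \<one>) u)"
      by (rule ext) (rule dE_expansion[OF c_in one_img])
    show ?thesis
      by (subst eq, rule linearI) (simp_all add: inner_add_left scaleR_add_left sum.distrib scaleR_sum_right)
  qed
  show ?thesis
    unfolding bilinear_def lie_bracket_eq
    by (intro conjI allI linear_compose_sub u X)
qed

lemma lie_bracket_antisym: "lie_bracket G c X Y = - lie_bracket G c Y X"
  by (simp add: lie_bracket_eq)

text \<open>Left translation by \<open>p\<close> relates the left invariant fields to themselves. Differentiating this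
  relation, the second derivatives of the translation cancel in the bracket by symmetry.\<close>

lemma field_bracket_invariant:
  assumes c': "c' \<in> A" "p \<in> fst c'"
  shows "dE c' Y (snd c' p) (E c' p X) - dE c' X (snd c' p) (E c' p Y) = E c' p (lie_bracket G c X Y)"
proof -
  let ?\<tau> = "left_mult p c c'" and ?e = "snd c \<one>" and ?S = "left_dom p c c'"
  have p: "p \<in> carrier G" using chart_carrier[OF c'] .
  have e: "?e \<in> ?S" using c_in one_in p c' by (intro in_left_dom) auto
  have S: "open ?S" and \<tau>: "smooth_on ?S ?\<tau>" using left_dom_props[OF p c_in c'(1)] .
  \<comment> \<open>\<open>?S2 v u\<close> is the second derivative of the translation at the identity.\<close>
  let ?S2 = "\<lambda>v u. frechet_derivative (\<lambda>y. frechet_derivative ?\<tau> (at y) v) (at ?e) u"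
  have D\<tau>: "frechet_derivative ?\<tau> (at ?e) = E c' p"
    by (simp add: E_def[abs_def] dL_eq)
  have \<tau>e: "?\<tau> ?e = snd c' p" using c_in one_in p by (simp add: left_mult_def)
  have key: "dE c' Y (snd c' p) (E c' p X) = E c' p (dE c Y ?e X) + ?S2 Y X" for X Y
  proof -
    have 1: "((\<lambda>y. frechet_derivative ?\<tau> (at y) (Ef c Y y)) has_derivative
        (\<lambda>u. frechet_derivative ?\<tau> (at ?e) (dE c Y ?e u) + ?S2 (Ef c Y ?e) u)) (at ?e)"
      by (rule has_derivative_moving_direction[OF S e \<tau> dE_has_derivative[OF c_in one_img] has_derivative_ident refl])
    have "Ef c' Y (?\<tau> y) = frechet_derivative ?\<tau> (at y) (Ef c Y y)" if y: "y \<in> ?S" for y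
    proof -
      have y': "y \<in> img c" "p \<otimes> chart_inv c y \<in> fst c'" using y by (auto simp: left_dom_def)
      have "dL c c' p (chart_inv c y) (E c (chart_inv c y) Y) = E c' (p \<otimes> chart_inv c y) Y"
        using y' by (intro E_natural p c_in c') simp_all
      then show ?thesis using y' c' by (simp add: Ef_def dL_eq left_mult_def)
    qed
    then have "((\<lambda>y. Ef c' Y (?\<tau> y)) has_derivative
        (\<lambda>u. frechet_derivative ?\<tau> (at ?e) (dE c Y ?e u) + ?S2 (Ef c Y ?e) u)) (at ?e)"
      by (intro has_derivative_transform_within_open[OF 1 S e]) simp
    moreover have "((\<lambda>y. Ef c' Y (?\<tau> y)) has_derivative (\<lambda>u. dE c' Y (snd c' p) (E c' p u))) (at ?e)"
    proof -
      have d1: "(?\<tau> has_derivative E c' p) (at ?e)"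
        using smooth_on_has_derivative[OF \<tau> e] unfolding D\<tau> .
      have d2: "(Ef c' Y has_derivative dE c' Y (snd c' p)) (at (?\<tau> ?e))"
        unfolding \<tau>e using c' by (intro dE_has_derivative) auto
      show ?thesis by (rule has_derivative_compose[OF d1 d2])
    qed
    ultimately have eq: "(\<lambda>u. frechet_derivative ?\<tau> (at ?e) (dE c Y ?e u) + ?S2 (Ef c Y ?e) u) = (\<lambda>u. dE c' Y (snd c' p) (E c' p u))"
      by (rule has_derivative_unique)
    have "Ef c Y ?e = Y" using c_in one_in by (simp add: Ef_def E_one)
    then show ?thesis using fun_cong[OF eq, of X] unfolding D\<tau> by simp
  qed
  have sym: "?S2 Y X = ?S2 X Y" by (rule symmetric_second_derivative[OF S e \<tau>])
  show ?thesis
    unfolding key[of Y X] key[of X Y] sym lie_bracket_eq linear_diff[OF E_linear[OF c']] by simp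
qed

end

locale left_invariant_metric = lie_group_chart +
  fixes q :: "('a, 'b) metric"
  assumes metric: "pseudo_riemannian_metric A q" and left_inv: "left_invariant G A q"
begin

abbreviation B :: "'b \<Rightarrow> 'b \<Rightarrow> real" where "B \<equiv> q c \<one>"

lemma q_props:
  assumes "c' \<in> A" "p \<in> fst c'"
  shows "bilinear (q c' p)" "q c' p v w = q c' p w v" "(\<And>w. q c' p v w = 0) \<Longrightarrow> v = 0"
  using metric assms unfolding pseudo_riemannian_metric_def by blast+

lemma q_smooth: "c' \<in> A \<Longrightarrow> smooth_on (img c') (\<lambda>x. q c' (chart_inv c' x) v w)"
  using metric unfolding pseudo_riemannian_metric_def by blast

lemma q_left_invariant:
  assumes "c' \<in> A" "p \<in> fst c'"
  shows "q c' p (E c' p X) (E c' p Y) = B X Y"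
proof -
  have p: "p \<in> carrier G" using chart_carrier[OF assms] .
  then have "p \<otimes> \<one> \<in> fst c'" using assms by simp
  then have "q c' (p \<otimes> \<one>) (dL c c' p \<one> X) (dL c c' p \<one> Y) = B X Y"
    using left_inv p c_in assms(1) one_in unfolding left_invariant_def by blast
  then show ?thesis using p by (simp add: E_def)
qed

lemma metric_deriv_eq:
  "metric_deriv q c' p u v w = frechet_derivative (\<lambda>x. q c' (chart_inv c' x) v w) (at (snd c' p)) u"
  by (simp add: metric_deriv_def)

lemma metric_field_derivative:
  fixes Z V W :: "'x::real_normed_vector \<Rightarrow> 'b"
  assumes c': "c' \<in> A" "p \<in> fst c'" "Z s0 = snd c' p"
    and Z: "(Z has_derivative Z') (at s0)" and V: "(V has_derivative V') (at s0)"
    and W: "(W has_derivative W') (at s0)"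
  shows "((\<lambda>s. q c' (chart_inv c' (Z s)) (V s) (W s)) has_derivative (\<lambda>u.
    metric_deriv q c' p (Z' u) (V s0) (W s0) + q c' p (V' u) (W s0) + q c' p (V s0) (W' u))) (at s0)"
proof -
  have "Z s0 \<in> img c'" using c' by simp
  moreover have "bilinear (q c' (chart_inv c' x))" if "x \<in> img c'" for x
    using that by (intro q_props(1) c'(1)) simp
  ultimately have "((\<lambda>s. q c' (chart_inv c' (Z s)) (V s) (W s)) has_derivative (\<lambda>u.
      frechet_derivative (\<lambda>x. q c' (chart_inv c' x) (V s0) (W s0)) (at (Z s0)) (Z' u) +
      q c' (chart_inv c' (Z s0)) (V' u) (W s0) + q c' (chart_inv c' (Z s0)) (V s0) (W' u))) (at s0)"
    by (intro has_derivative_bilinear_field[where Q = "\<lambda>x. q c' (chart_inv c' x)" and S = "img c'"]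
        chart_props(2) q_smooth c'(1) Z V W)
  then show ?thesis using c' by (simp add: metric_deriv_eq)
qed

text \<open>The vector described in the definition of the Christoffel symbol exists and is unique since the
  metric is nondegenerate.\<close>

lemma christoffel_diagonal:
  assumes c': "c' \<in> A" "p \<in> fst c'"
  shows "2 * q c' p (christoffel q c' p v v) u = 2 * metric_deriv q c' p v v u - metric_deriv q c' p u v v"
proof -
  let ?m = "metric_deriv q c' p"
  let ?l = "\<lambda>u. (?m v v u + ?m v v u - ?m u v v) / 2"
  have z: "snd c' p \<in> img c'" using c' by simp
  have "linear (\<lambda>u. ?m u v v)"
    unfolding metric_deriv_eq
    by (rule has_derivative_linear[OF smooth_on_has_derivative[OF q_smooth[OF c'(1)] z]])
  moreover have "linear (\<lambda>u. ?m v v u)"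
  proof -
    have lin: "linear (q c' (chart_inv c' x) v)" if "x \<in> img c'" for x
      using q_props(1)[OF c'(1) chart_inv_in[OF that]] by (simp add: bilinear_def)
    have D: "((\<lambda>x. q c' (chart_inv c' x) v u) has_derivative (\<lambda>w. ?m w v u)) (at (snd c' p))" for u
      unfolding metric_deriv_eq by (rule smooth_on_has_derivative[OF q_smooth[OF c'(1)] z])
    note tr = has_derivative_transform_within_open[OF _ chart_props(2)[OF c'(1)] z]
    have add: "((\<lambda>x. q c' (chart_inv c' x) v (u + u')) has_derivative (\<lambda>w. ?m w v u + ?m w v u')) (at (snd c' p))" for u u'
      by (rule tr[OF has_derivative_add[OF D D]]) (simp add: linear_add[OF lin])
    have scale: "((\<lambda>x. q c' (chart_inv c' x) v (r *\<^sub>R u)) has_derivative (\<lambda>w. r * ?m w v u)) (at (snd c' p))" for u r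
      by (rule tr[OF has_derivative_mult_right[OF D]]) (simp add: linear_scale[OF lin])
    show ?thesis
    proof (rule linearI)
      show "?m v v (u + u') = ?m v v u + ?m v v u'" for u u'
        using fun_cong[OF has_derivative_unique[OF D add]] by simp
      show "?m v v (r *\<^sub>R u) = r *\<^sub>R ?m v v u" for r u
        using fun_cong[OF has_derivative_unique[OF D scale]] by simp
    qed
  qed
  ultimately have "linear ?l"
    by (simp add: linear_iff algebra_simps add_divide_distrib diff_divide_distrib)
  then have ex: "\<exists>!z. \<forall>u. q c' p z u = ?l u"
    using nondegenerate_riesz[of "q c' p" ?l] q_props[OF c'] by blast
  have "(\<forall>u. q c' p z u = ?l u) \<longleftrightarrow> (\<forall>u. 2 * q c' p z u = ?m v v u + ?m v v u - ?m u v v)" for z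
    by (simp add: field_simps)
  then have "christoffel q c' p v v = (THE z. \<forall>u. q c' p z u = ?l u)"
    by (simp add: christoffel_def)
  then have "q c' p (christoffel q c' p v v) u = ?l u"
    using theI'[OF ex] by simp
  then show ?thesis by simp
qed

text \<open>The velocity of the curve is \<open>v = E (x t)\<close>, and \<open>B (x s) W\<close> is the product of the velocity with the
  left invariant field of \<open>W\<close>. Its derivative is computed in the chart. The derivatives of the
  metric coefficients in the directions of the field are eliminated with those of the constant
  function \<open>q (E X) (E X)\<close>, and what remains of the derivatives of the fields is a bracket. So the
  Euler equation holds exactly where the covariant acceleration vanishes.\<close>

lemma euler_geodesic_identity:
  assumes c': "c' \<in> A" "\<gamma> t \<in> fst c'" and \<gamma>: "\<forall>\<^sub>F s in nhds t. log_deriv_at \<gamma> s (x s)"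
    and a: "((\<lambda>s. vector_derivative (snd c' \<circ> \<gamma>) (at s)) has_vector_derivative a) (at t)"
  defines "v \<equiv> vector_derivative (snd c' \<circ> \<gamma>) (at t)"
  shows "((\<lambda>s. B (x s) W) has_real_derivative
    (B (x t) (lie_bracket G c (x t) W) + q c' (\<gamma> t) (a + christoffel q c' (\<gamma> t) v v) (E c' (\<gamma> t) W))) (at t)"
proof -
  let ?z = "snd c' \<circ> \<gamma>" and ?p = "\<gamma> t" and ?X = "x t"
  let ?z1 = "\<lambda>s. vector_derivative ?z (at s)" and ?u = "E c' (\<gamma> t) W"
  let ?md = "metric_deriv q c' ?p"
  have ld: "log_deriv_at \<gamma> t ?X" using \<gamma> by (rule eventually_nhds_x_imp_x)
  then have ct: "cont_at \<gamma> t" by (simp add: log_deriv_at_def)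
  have z_der: "(?z has_vector_derivative E c' ?p ?X) (at t)" using ld c' by (simp add: log_deriv_at_def)
  have v: "v = E c' ?p ?X" unfolding v_def by (rule vector_derivative_at[OF z_der])
  have zi: "?z t \<in> img c'" using c' by simp
  have Ef_z: "Ef c' Y (?z t) = E c' ?p Y" for Y using c' by (simp add: Ef_def)
  have q: "bilinear (q c' ?p)" "\<And>v w. q c' ?p v w = q c' ?p w v" using q_props[OF c'] by auto
  have 1: "((\<lambda>s. q c' (chart_inv c' (?z s)) (?z1 s) (Ef c' W (?z s))) has_derivative
     (\<lambda>h. ?md (h *\<^sub>R v) (?z1 t) (Ef c' W (?z t)) + q c' ?p (h *\<^sub>R a) (Ef c' W (?z t)) +
        q c' ?p (?z1 t) (dE c' W (?z t) (h *\<^sub>R v)))) (at t)"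
  proof (rule metric_field_derivative[OF c'(1,2)])
    show z': "(?z has_derivative (\<lambda>h. h *\<^sub>R v)) (at t)"
      using z_der by (simp add: has_vector_derivative_def v)
    show "(?z1 has_derivative (\<lambda>h. h *\<^sub>R a)) (at t)" using a by (simp add: has_vector_derivative_def)
    show "((\<lambda>s. Ef c' W (?z s)) has_derivative (\<lambda>h. dE c' W (?z t) (h *\<^sub>R v))) (at t)"
      by (rule has_derivative_compose[OF z' dE_has_derivative[OF c'(1) zi]])
  qed simp
  have md_lin: "linear (\<lambda>u. ?md u v w)" for v w
    unfolding metric_deriv_eq using c'
    by (intro has_derivative_linear[OF smooth_on_has_derivative[OF q_smooth]]) auto
  have q_lin: "linear (\<lambda>v. q c' ?p v w)" "linear (q c' ?p w)" for w
    using q(1) by (simp_all add: bilinear_def)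
  have dE_lin: "linear (dE c' Y (?z t))" for Y
    by (rule has_derivative_linear[OF dE_has_derivative[OF c'(1) zi]])
  let ?D = "?md v v ?u + q c' ?p a ?u + q c' ?p v (dE c' W (?z t) v)"
  have eq: "?md (h *\<^sub>R v) (?z1 t) (Ef c' W (?z t)) + q c' ?p (h *\<^sub>R a) (Ef c' W (?z t)) +
        q c' ?p (?z1 t) (dE c' W (?z t) (h *\<^sub>R v)) = ?D * h" for h
    unfolding Ef_z v_def[symmetric] linear_scale[OF md_lin] linear_scale[OF q_lin(1)]
      linear_scale[OF dE_lin] linear_scale[OF q_lin(2)]
    by (simp add: algebra_simps)
  have 2: "((\<lambda>s. q c' (chart_inv c' (?z s)) (?z1 s) (Ef c' W (?z s))) has_real_derivative ?D) (at t)"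
    using 1 unfolding has_field_derivative_def eq .
  have "\<forall>\<^sub>F s in nhds t. q c' (chart_inv c' (?z s)) (?z1 s) (Ef c' W (?z s)) = B (x s) W"
    using \<gamma> cont_atD[OF ct c']
  proof eventually_elim
    case (elim s)
    then have "(?z has_vector_derivative E c' (\<gamma> s) (x s)) (at s)" using c' by (simp add: log_deriv_at_def)
    then have "?z1 s = E c' (\<gamma> s) (x s)" by (rule vector_derivative_at)
    then show ?case using elim c' q_left_invariant[OF c'(1), of "\<gamma> s" "x s" W] by (simp add: Ef_def)
  qed
  with 2 have 3: "((\<lambda>s. B (x s) W) has_real_derivative ?D) (at t)"
    unfolding has_real_derivative_iff_has_vector_derivative
    by (rule has_vector_derivative_cong_nhds[THEN iffD1, rotated])
  have "?md ?u v v + q c' ?p (dE c' ?X (?z t) ?u) v + q c' ?p v (dE c' ?X (?z t) ?u) = 0"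
  proof -
    have id: "?z t = snd c' ?p" by simp
    have dEX: "(Ef c' ?X has_derivative dE c' ?X (?z t)) (at (?z t))"
      by (rule dE_has_derivative[OF c'(1) zi])
    have 4: "((\<lambda>y. q c' (chart_inv c' y) (Ef c' ?X y) (Ef c' ?X y)) has_derivative
        (\<lambda>u. ?md u (Ef c' ?X (?z t)) (Ef c' ?X (?z t)) + q c' ?p (dE c' ?X (?z t) u) (Ef c' ?X (?z t))
          + q c' ?p (Ef c' ?X (?z t)) (dE c' ?X (?z t) u))) (at (?z t))"
      by (rule metric_field_derivative[OF c' id has_derivative_ident dEX dEX])
    have "((\<lambda>y. B ?X ?X) has_derivative
        (\<lambda>u. ?md u (Ef c' ?X (?z t)) (Ef c' ?X (?z t)) + q c' ?p (dE c' ?X (?z t) u) (Ef c' ?X (?z t))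
          + q c' ?p (Ef c' ?X (?z t)) (dE c' ?X (?z t) u))) (at (?z t))"
      by (rule has_derivative_transform_within_open[OF 4 chart_props(2)[OF c'(1)] zi])
         (simp add: Ef_def q_left_invariant c'(1))
    from has_derivative_unique[OF this has_derivative_const] show ?thesis
      unfolding Ef_z v by metis
  qed
  then have "q c' ?p (christoffel q c' ?p v v) ?u = ?md v v ?u + q c' ?p v (dE c' ?X (?z t) ?u)"
    using christoffel_diagonal[OF c', of v ?u] q(2)[of v] by simp
  then have "?D = q c' ?p (a + christoffel q c' ?p v v) ?u +
      q c' ?p v (dE c' W (?z t) v - dE c' ?X (?z t) ?u)"
    by (simp add: linear_add[OF q_lin(1)] linear_diff[OF q_lin(2)])
  also have "dE c' W (?z t) v - dE c' ?X (?z t) ?u = E c' ?p (lie_bracket G c ?X W)"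
    using field_bracket_invariant[OF c', of W ?X] by (simp add: v)
  also have "q c' ?p v (E c' ?p (lie_bracket G c ?X W)) = B ?X (lie_bracket G c ?X W)"
    unfolding v by (rule q_left_invariant[OF c'])
  finally show ?thesis using 3 by (simp add: add.commute)
qed

text \<open>The logarithmic derivative \<open>x\<close> of a geodesic is only known pointwise at first. It is
  differentiable because its products with left invariant fields are.\<close>

lemma geodesic_imp_euler:
  assumes geo: "geodesic T A q I \<gamma>"
  shows "\<exists>x. \<forall>t\<in>I. log_deriv_at \<gamma> t (x t) \<and>
    (\<forall>W. ((\<lambda>s. B (x s) W) has_real_derivative B (x t) (lie_bracket G c (x t) W)) (at t))"
proof -
  have I: "open I" and sc: "smooth_curve T A I \<gamma>"
    using geo by (auto simp: geodesic_def open_interval_def)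
  note sm = smooth_curveD[OF I sc]
  have "\<exists>X. log_deriv_at \<gamma> t X" if t: "t \<in> I" for t
  proof -
    obtain c1 where c1: "c1 \<in> A" "\<gamma> t \<in> fst c1"
      using chart_at[of "\<gamma> t"] sm(1)[OF t] unfolding cont_at_def by blast
    have der: "((snd c1 \<circ> \<gamma>) has_vector_derivative vector_derivative (snd c1 \<circ> \<gamma>) (at t)) (at t)"
      using smooth_on_vector_derivative(1)[OF sm(2,3)[OF c1(1)]] t c1(2) by blast
    obtain X where "E c1 (\<gamma> t) X = vector_derivative (snd c1 \<circ> \<gamma>) (at t)"
      using E_surj[OF c1] by blast
    moreover have "\<forall>\<^sub>F s in nhds t. cont_at \<gamma> s"
    proof -
      have "\<forall>\<^sub>F s in nhds t. s \<in> I" using I t by (rule eventually_nhds_in_open)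
      then show ?thesis by eventually_elim (rule sm(1))
    qed
    ultimately have "log_deriv_at \<gamma> t X"
      using log_deriv_atI[where t = t and \<gamma> = \<gamma>, OF _ c1] der by simp
    then show ?thesis ..
  qed
  then obtain x where x: "\<And>t. t \<in> I \<Longrightarrow> log_deriv_at \<gamma> t (x t)" by metis
  show ?thesis
  proof (intro exI[of _ x] ballI conjI allI x)
    fix t W assume t: "t \<in> I"
    obtain c1 where c1: "c1 \<in> A" "\<gamma> t \<in> fst c1"
      using chart_at[of "\<gamma> t"] sm(1)[OF t] unfolding cont_at_def by blast
    let ?z1 = "\<lambda>s. vector_derivative (snd c1 \<circ> \<gamma>) (at s)"
    let ?S = "{t \<in> I. \<gamma> t \<in> fst c1}"
    have "smooth_on ?S ?z1" by (rule smooth_on_vector_derivative(2)[OF sm(2,3)[OF c1(1)]])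
    then have a: "(?z1 has_vector_derivative vector_derivative ?z1 (at t)) (at t)"
      using smooth_on_vector_derivative(1)[OF sm(2)[OF c1(1)], of ?z1 t] t c1(2) by blast
    have "\<forall>\<^sub>F s in nhds t. s \<in> I" using I t by (rule eventually_nhds_in_open)
    then have ev: "\<forall>\<^sub>F s in nhds t. log_deriv_at \<gamma> s (x s)" by eventually_elim (rule x)
    have "vector_derivative ?z1 (at t) + christoffel q c1 (\<gamma> t) (?z1 t) (?z1 t) = 0"
      using geo c1 t unfolding geodesic_def Let_def by blast
    moreover have "q c1 (\<gamma> t) 0 (E c1 (\<gamma> t) W) = 0"
      using q_props(1)[OF c1] by (rule bilinear_lzero)
    ultimately show "((\<lambda>s. B (x s) W) has_real_derivative B (x t) (lie_bracket G c (x t) W)) (at t)"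
      using euler_geodesic_identity[OF c1 ev a, of W] by simp
  qed
qed

lemma euler_imp_geodesic:
  assumes I: "open_interval I" and \<gamma>: "\<And>t. t \<in> I \<Longrightarrow> log_deriv_at \<gamma> t (x t)" and x: "smooth_on I x"
    and euler: "\<And>t W. t \<in> I \<Longrightarrow> ((\<lambda>s. B (x s) W) has_real_derivative B (x t) (lie_bracket G c (x t) W)) (at t)"
  shows "geodesic T A q I \<gamma>"
  unfolding geodesic_def Let_def
proof (intro conjI I ballI impI)
  have oI: "open I" using I by (simp add: open_interval_def)
  show sc: "smooth_curve T A I \<gamma>" by (rule smooth_curve_log_deriv[OF I \<gamma> x])
  note sm = smooth_curveD[OF oI sc]
  fix c1 t assume c1: "c1 \<in> A" "\<gamma> t \<in> fst c1" and t: "t \<in> I"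
  let ?z1 = "\<lambda>s. vector_derivative (snd c1 \<circ> \<gamma>) (at s)"
  let ?S = "{t \<in> I. \<gamma> t \<in> fst c1}"
  have "smooth_on ?S ?z1" by (rule smooth_on_vector_derivative(2)[OF sm(2,3)[OF c1(1)]])
  then have a: "(?z1 has_vector_derivative vector_derivative ?z1 (at t)) (at t)"
    using smooth_on_vector_derivative(1)[OF sm(2)[OF c1(1)], of ?z1 t] t c1(2) by blast
  have "\<forall>\<^sub>F s in nhds t. s \<in> I" using oI t by (rule eventually_nhds_in_open)
  then have ev: "\<forall>\<^sub>F s in nhds t. log_deriv_at \<gamma> s (x s)" by eventually_elim (rule \<gamma>)
  let ?v = "vector_derivative ?z1 (at t) + christoffel q c1 (\<gamma> t) (?z1 t) (?z1 t)"
  have "q c1 (\<gamma> t) ?v (E c1 (\<gamma> t) W) = 0" for W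
    using DERIV_unique[OF euler_geodesic_identity[OF c1 ev a, of W] euler[OF t, of W]] by simp
  then have "q c1 (\<gamma> t) ?v w = 0" for w
    using E_surj[OF c1, of w] by metis
  then show "?v = 0" by (rule q_props(3)[OF c1])
qed

end

section \<open>One-parameter subgroups\<close>

context lie_group_chart
begin

lemma log_deriv_const_unique:
  assumes "\<And>t. log_deriv_at \<gamma> t X" "\<And>t. log_deriv_at \<delta> t X" "\<gamma> 0 = \<delta> 0"
  shows "\<gamma> = \<delta>"
proof
  fix t
  show "\<gamma> t = \<delta> t"
    by (rule log_deriv_unique[of UNIV 0 \<gamma> \<delta> "\<lambda>_. X"])
       (use assms in \<open>auto simp: open_interval_def\<close>)
qed

lemma log_deriv_at_shift:
  assumes "log_deriv_at \<gamma> (s + t) X"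
  shows "log_deriv_at (\<lambda>u. \<gamma> (s + u)) t X"
proof -
  have "((\<lambda>u. s + u) has_real_derivative 1) (at t)" by (auto intro!: derivative_eq_intros)
  from log_deriv_at_compose[OF assms this] show ?thesis by (simp add: o_def)
qed

lemma log_deriv_at_one_parameter_hom:
  assumes hom: "one_parameter_hom G T A \<gamma>" and X: "vector_derivative (snd c \<circ> \<gamma>) (at 0) = X"
  shows "\<gamma> 0 = \<one>" and "log_deriv_at \<gamma> t X"
proof -
  have sc: "smooth_curve T A UNIV \<gamma>" and add: "\<And>s t. \<gamma> (s + t) = \<gamma> s \<otimes> \<gamma> t"
    using hom by (auto simp: one_parameter_hom_def)
  note sm = smooth_curveD[OF open_UNIV sc]
  have cont: "cont_at \<gamma> t" for t by (rule sm(1)) simp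
  then have car: "\<gamma> t \<in> carrier G" for t by (simp add: cont_at_def)
  have "\<gamma> 0 \<otimes> \<gamma> 0 = \<gamma> 0" using add[of 0 0] by simp
  then show 0: "\<gamma> 0 = \<one>" using car[of 0] by (metis r_cancel_one)
  have in_c: "\<gamma> 0 \<in> fst c" using 0 one_in by simp
  have "((snd c \<circ> \<gamma>) has_vector_derivative X) (at 0)"
    using smooth_on_vector_derivative(1)[OF sm(2,3)[OF c_in], of 0] in_c X by simp
  then have "((snd c \<circ> \<gamma>) has_vector_derivative E c (\<gamma> 0) X) (at 0)"
    by (simp add: 0 E_one)
  then have "log_deriv_at \<gamma> 0 X"
    using log_deriv_atI[where \<gamma> = \<gamma> and t = 0, OF _ c_in in_c] cont by simp
  then have "log_deriv_at (\<lambda>s. \<gamma> (- t + s)) t X"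
    using log_deriv_at_shift[of \<gamma> "- t" t X] by simp
  then have "log_deriv_at (\<lambda>s. \<gamma> t \<otimes> \<gamma> (- t + s)) t X"
    by (rule log_deriv_at_left_translate[OF car])
  then show "log_deriv_at \<gamma> t X"
    unfolding add[symmetric] by simp
qed

lemma one_parameter_homI:
  assumes \<sigma>: "\<sigma> 0 = \<one>" "\<And>t. log_deriv_at \<sigma> t X"
  shows "one_parameter_hom G T A \<sigma>" and "vector_derivative (snd c \<circ> \<sigma>) (at 0) = X"
proof -
  have car: "\<sigma> t \<in> carrier G" for t using \<sigma>(2) by (simp add: log_deriv_at_def cont_at_def)
  have "smooth_curve T A UNIV \<sigma>"
    using smooth_curve_log_deriv[of UNIV \<sigma> "\<lambda>_. X"] \<sigma>(2) by (simp add: open_interval_def smooth_on_const)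
  moreover have "\<sigma> (s + t) = \<sigma> s \<otimes> \<sigma> t" for s t
  proof -
    have "(\<lambda>t. \<sigma> (s + t)) = (\<lambda>t. \<sigma> s \<otimes> \<sigma> t)"
      by (rule log_deriv_const_unique[OF log_deriv_at_shift[OF \<sigma>(2)] log_deriv_at_left_translate[OF car \<sigma>(2)]])
         (simp add: \<sigma>(1) car)
    then show ?thesis by (rule fun_cong)
  qed
  ultimately show "one_parameter_hom G T A \<sigma>" by (simp add: one_parameter_hom_def)
  have "((snd c \<circ> \<sigma>) has_vector_derivative E c (\<sigma> 0) X) (at 0)"
    using \<sigma>(2)[of 0] c_in one_in by (simp add: log_deriv_at_def \<sigma>(1))
  then show "vector_derivative (snd c \<circ> \<sigma>) (at 0) = X"
    by (simp add: \<sigma>(1) E_one vector_derivative_at)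
qed

text \<open>One-parameter subgroups are the curves through the identity with constant logarithmic
  derivative; these exist and are unique, so that the description defining \<open>lie_exp\<close> is proper.\<close>

lemma lie_exp_eq:
  assumes \<sigma>: "\<sigma> 0 = \<one>" "\<And>t. log_deriv_at \<sigma> t X"
  shows "lie_exp G T A c (s *\<^sub>R X) = \<sigma> s"
proof -
  have \<tau>: "(\<sigma> \<circ> (\<lambda>u. s * u)) 0 = \<one>" "log_deriv_at (\<sigma> \<circ> (\<lambda>u. s * u)) t (s *\<^sub>R X)" for t
    using \<sigma> by (auto intro!: log_deriv_at_compose derivative_eq_intros)
  have "(THE \<gamma>. one_parameter_hom G T A \<gamma> \<and> vector_derivative (snd c \<circ> \<gamma>) (at 0) = s *\<^sub>R X) = \<sigma> \<circ> (\<lambda>u. s * u)"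
  proof (rule the_equality)
    show "one_parameter_hom G T A (\<sigma> \<circ> (\<lambda>u. s * u)) \<and>
        vector_derivative (snd c \<circ> (\<sigma> \<circ> (\<lambda>u. s * u))) (at 0) = s *\<^sub>R X"
      using one_parameter_homI[OF \<tau>] by blast
    fix \<gamma> assume "one_parameter_hom G T A \<gamma> \<and> vector_derivative (snd c \<circ> \<gamma>) (at 0) = s *\<^sub>R X"
    then have "\<gamma> 0 = \<one>" "log_deriv_at \<gamma> t (s *\<^sub>R X)" for t
      using log_deriv_at_one_parameter_hom by blast+
    then show "\<gamma> = \<sigma> \<circ> (\<lambda>u. s * u)"
      using \<tau> by (intro log_deriv_const_unique[of \<gamma> "s *\<^sub>R X"]) simp_all
  qed
  then show ?thesis by (simp add: lie_exp_def)
qed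

lemma log_deriv_at_value_unique:
  assumes "log_deriv_at \<gamma> t X" "log_deriv_at \<gamma> t Y"
  shows "X = Y"
proof -
  obtain c1 where c1: "c1 \<in> A" "\<gamma> t \<in> fst c1"
    using chart_at[of "\<gamma> t"] assms(1) unfolding log_deriv_at_def cont_at_def by blast
  have "E c1 (\<gamma> t) X = E c1 (\<gamma> t) Y"
    using assms c1 vector_derivative_unique_at unfolding log_deriv_at_def by blast
  moreover have "surj (E c1 (\<gamma> t))" using E_surj[OF c1] by (metis surjI surj_def)
  then have "inj (E c1 (\<gamma> t))" by (rule linear_surj_imp_inj[OF E_linear[OF c1]])
  ultimately show ?thesis by (simp add: inj_eq)
qed

end

section \<open>The Euler equation in coordinates\<close>

lemma complete_field_conjugate_imp:
  assumes "bounded_linear \<Phi>" "bounded_linear \<Psi>" "\<And>x. \<Phi> (\<Psi> x) = x"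
    and conj: "\<And>v. E (\<Phi> v) = \<Phi> (F v)" "\<And>x. F (\<Psi> x) = \<Psi> (E x)" and "complete_field F"
  shows "complete_field E"
  unfolding complete_field_def
proof (intro allI impI)
  fix I x assume x: "solves E I x"
  have "solves F I (\<Psi> \<circ> x)"
    using x bounded_linear.has_vector_derivative[OF assms(2)] by (simp add: solves_def conj o_def)
  then obtain y where y: "solves F UNIV y" "\<forall>t\<in>I. y t = (\<Psi> \<circ> x) t"
    using assms(6) unfolding complete_field_def by blast
  have "solves E UNIV (\<Phi> \<circ> y)"
    using y(1) bounded_linear.has_vector_derivative[OF assms(1)] by (simp add: solves_def conj o_def)
  moreover have "\<forall>t\<in>I. (\<Phi> \<circ> y) t = x t" using y(2) assms(3) by simp
  ultimately show "\<exists>y. solves E UNIV y \<and> (\<forall>t\<in>I. y t = x t)" by blast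
qed

text \<open>The Euler field lives on the dual space, which is identified with the Euclidean model space by
  the standard inner product.\<close>

definition covector :: "'b::euclidean_space \<Rightarrow> ('b \<Rightarrow>\<^sub>L real)" where
  "covector v = Blinfun (\<lambda>y. v \<bullet> y)"

definition covector_coords :: "('b::euclidean_space \<Rightarrow>\<^sub>L real) \<Rightarrow> 'b" where
  "covector_coords \<xi> = (\<Sum>b\<in>Basis. blinfun_apply \<xi> b *\<^sub>R b)"

lemma covector_apply [simp]: "blinfun_apply (covector v) y = v \<bullet> y"
  unfolding covector_def by (simp add: bounded_linear_Blinfun_apply bounded_linear_inner_right)

lemma covector_coords [simp]: "covector_coords (covector v) = v"
  by (simp add: covector_coords_def euclidean_representation)

lemma coords_covector [simp]: "covector (covector_coords \<xi>) = \<xi>"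
proof (rule blinfun_eqI)
  fix y
  have "blinfun_apply \<xi> y = (\<Sum>b\<in>Basis. (y \<bullet> b) *\<^sub>R blinfun_apply \<xi> b)"
    by (rule linear_basis_expansion) (rule bounded_linear.linear[OF blinfun.bounded_linear_right])
  then show "blinfun_apply (covector (covector_coords \<xi>)) y = blinfun_apply \<xi> y"
    unfolding covector_apply covector_coords_def inner_sum_left inner_scaleR_left
    by (simp add: inner_commute mult.commute)
qed

lemma bounded_linear_covector: "bounded_linear (covector :: 'b::euclidean_space \<Rightarrow> _)"
proof (rule bounded_linear_intro[where K = 1])
  fix v w :: 'b and r :: real
  show "covector (v + w) = covector v + covector w"
    by (rule blinfun_eqI) (simp add: blinfun.add_left inner_add_left)
  show "covector (r *\<^sub>R v) = r *\<^sub>R covector v"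
    by (rule blinfun_eqI) (simp add: blinfun.scaleR_left)
  show "norm (covector v) \<le> norm v * 1"
    by (rule norm_blinfun_bound) (simp_all add: Cauchy_Schwarz_ineq2)
qed

lemma bounded_linear_covector_coords: "bounded_linear covector_coords"
  unfolding covector_coords_def[abs_def]
  by (intro bounded_linear_sum bounded_linear_scaleR_const blinfun.bounded_linear_left)

context left_invariant_metric
begin

text \<open>The metric at the identity as a linear operator, and its inverse.\<close>

definition P :: "'b \<Rightarrow> 'b" where
  "P x = (\<Sum>b\<in>Basis. B x b *\<^sub>R b)"

definition N :: "'b \<Rightarrow> 'b" where
  "N = inv_into UNIV P"

lemma B_props: "bilinear B" "B v w = B w v" "(\<And>w. B v w = 0) \<Longrightarrow> v = 0"
  using q_props[OF c_in one_in] by auto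

lemma P_inner: "P x \<bullet> y = B x y"
proof -
  have "linear (B x)" using B_props(1) by (simp add: bilinear_def)
  then have "B x y = (\<Sum>b\<in>Basis. (y \<bullet> b) *\<^sub>R B x b)" by (rule linear_basis_expansion)
  then show ?thesis
    unfolding P_def inner_sum_left inner_scaleR_left by (simp add: inner_commute mult.commute)
qed

lemma P_linear: "linear P"
proof (rule linearI)
  have lin: "linear (\<lambda>v. B v w)" for w using B_props(1) by (simp add: bilinear_def)
  show "P (x + y) = P x + P y" for x y
    by (rule euclidean_eqI) (simp add: P_inner inner_add_left linear_add[OF lin])
  show "P (r *\<^sub>R x) = r *\<^sub>R P x" for r x
    by (rule euclidean_eqI) (simp add: P_inner linear_scale[OF lin])
qed

lemma P_inj: "inj P"
proof -
  have "x = 0" if "P x = 0" for x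
    by (rule B_props(3)) (simp add: P_inner[symmetric] that)
  then show ?thesis using P_linear by (simp add: linear_injective_0)
qed

lemma NP [simp]: "N (P x) = x" and PN [simp]: "P (N v) = v"
proof -
  show "N (P x) = x" unfolding N_def by (rule inv_f_f[OF P_inj])
  have "surj P" by (rule linear_inj_imp_surj[OF P_linear P_inj])
  then show "P (N v) = v" unfolding N_def by (rule surj_f_inv_f)
qed

lemma N_linear: "linear N"
proof (rule linearI)
  show "N (v + w) = N v + N w" for v w
    by (rule injD[OF P_inj]) (simp add: linear_add[OF P_linear])
  show "N (r *\<^sub>R v) = r *\<^sub>R N v" for r v
    by (rule injD[OF P_inj]) (simp add: linear_scale[OF P_linear])
qed

text \<open>The Euler vector field, read in the dual of the standard basis.\<close>

definition F :: "'b \<Rightarrow> 'b" where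
  "F v = (\<Sum>b\<in>Basis. (v \<bullet> lie_bracket G c (N v) b) *\<^sub>R b)"

lemma bracket_linear: "linear (lie_bracket G c x)" "linear (\<lambda>x. lie_bracket G c x y)"
  using lie_bracket_bilinear by (simp_all add: bilinear_def)

lemma F_inner: "F v \<bullet> z = v \<bullet> lie_bracket G c (N v) z"
proof -
  have "lie_bracket G c (N v) z = (\<Sum>b\<in>Basis. (z \<bullet> b) *\<^sub>R lie_bracket G c (N v) b)"
    by (rule linear_basis_expansion[OF bracket_linear(1)])
  then show ?thesis by (simp add: F_def inner_sum_left inner_sum_right inner_commute mult.commute)
qed

lemma euler_field_covector: "euler_field G c q (covector v) = covector (F v)"
proof -
  have flat: "flat G c q x = covector (P x)" for x
    by (simp add: flat_def covector_def P_inner)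
  have "inj (flat G c q)"
    by (rule injI) (metis flat covector_coords NP)
  moreover have "flat G c q (N v) = covector v" by (simp add: flat)
  ultimately have inv: "inv_into UNIV (flat G c q) (covector v) = N v"
    by (rule inv_f_eq)
  have bl: "bounded_linear (\<lambda>z. - (v \<bullet> lie_bracket G c (N v) z))"
    using bracket_linear(1)[of "N v"]
    by (intro bounded_linear_minus bounded_linear_compose[OF bounded_linear_inner_right])
       (simp add: linear_conv_bounded_linear)
  show ?thesis
    by (rule blinfun_eqI)
       (simp add: euler_field_def inv coad_def blinfun.minus_left bounded_linear_Blinfun_apply[OF bl] F_inner)
qed

lemma euler_field_coords: "covector_coords (euler_field G c q \<xi>) = F (covector_coords \<xi>)"
  using euler_field_covector[of "covector_coords \<xi>"] by simp

lemma complete_euler_iff: "complete_field (euler_field G c q) \<longleftrightarrow> complete_field F"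
  using complete_field_conjugate_imp[where E = "euler_field G c q" and F = F, OF bounded_linear_covector bounded_linear_covector_coords coords_covector
      euler_field_covector euler_field_coords[symmetric]]
    complete_field_conjugate_imp[where E = F and F = "euler_field G c q", OF bounded_linear_covector_coords bounded_linear_covector covector_coords
      euler_field_coords[symmetric] euler_field_covector]
  by blast

lemma idempotent_euler_iff: "idempotent_of (euler_field G c q) (covector v) \<longleftrightarrow> idempotent_of F v"
proof -
  have lin: "linear (covector :: 'b \<Rightarrow> _)" by (rule bounded_linear.linear[OF bounded_linear_covector])
  have "covector v = 0 \<longleftrightarrow> v = 0" for v :: 'b
    by (metis covector_coords linear_0[OF lin])
  moreover have "a *\<^sub>R covector v + b *\<^sub>R covector (F v) = covector (a *\<^sub>R v + b *\<^sub>R F v)" for a b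
    by (simp add: linear_add[OF lin] linear_scale[OF lin])
  ultimately show ?thesis
    by (simp add: idempotent_of_def euler_field_covector)
qed

lemma euler_iff_solution:
  "(\<forall>W. ((\<lambda>s. B (x s) W) has_real_derivative B (x t) (lie_bracket G c (x t) W)) (at t)) \<longleftrightarrow>
   ((\<lambda>s. P (x s)) has_vector_derivative F (P (x t))) (at t)"
proof -
  have eq: "B (x t) (lie_bracket G c (x t) W) = F (P (x t)) \<bullet> W" for W
    by (simp add: F_inner P_inner)
  have "(\<forall>W. ((\<lambda>s. P (x s) \<bullet> W) has_real_derivative F (P (x t)) \<bullet> W) (at t)) \<longleftrightarrow>
      ((\<lambda>s. P (x s)) has_vector_derivative F (P (x t))) (at t)" (is "?l \<longleftrightarrow> ?r")
  proof
    assume ?l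
    then have "\<forall>b\<in>Basis. ((\<lambda>s. P (x s) \<bullet> b) has_derivative (\<lambda>h. (h *\<^sub>R F (P (x t))) \<bullet> b)) (at t)"
      by (simp add: has_real_derivative_iff_has_vector_derivative has_vector_derivative_def)
    then show ?r
      unfolding has_vector_derivative_def
      by (subst has_derivative_componentwise_within)
  next
    assume ?r
    then show ?l
      unfolding has_real_derivative_iff_has_vector_derivative
      using bounded_linear.has_vector_derivative[OF bounded_linear_inner_left] by blast
  qed
  then show ?thesis unfolding eq by (simp only: P_inner)
qed

lemma solution_smooth:
  assumes "solves F I y"
  shows "smooth_on I y"
proof -
  have y: "(y has_vector_derivative F (y t)) (at t)" if "t \<in> I" for t
    using assms that by (simp add: solves_def)
  have "Ck_on k y I" for k
  proof (induction k)
    case 0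
    show ?case
      unfolding Ck_on.simps using y by (intro continuous_at_imp_continuous_on ballI has_vector_derivative_continuous)
  next
    case (Suc k)
    have "Ck_on k (\<lambda>t. lie_bracket G c (N (y t)) b) I" for b
    proof (rule Ck_on_bounded_linear_compose[OF _ Suc, of "\<lambda>v. lie_bracket G c (N v) b"])
      have "linear (\<lambda>v. lie_bracket G c (N v) b)"
        using linear_compose[OF N_linear bracket_linear(2)] by (simp add: o_def)
      then show "bounded_linear (\<lambda>v. lie_bracket G c (N v) b)"
        by (simp add: linear_conv_bounded_linear)
    qed
    then have "Ck_on k (\<lambda>t. F (y t)) I"
      unfolding F_def
      by (intro Ck_on_sum Ck_on_bilinear[OF bounded_bilinear_scaleR] Ck_on_bilinear[OF bounded_bilinear_inner]
          Suc Ck_on_const)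
    then show ?case by (intro Ck_on_Suc_real[where f' = "\<lambda>t. F (y t)"] y)
  qed
  then show ?thesis by (simp add: smooth_on_def)
qed

text \<open>The logarithmic derivative of a geodesic is continued as a solution of the Euler equation. A curve
  with a prescribed logarithmic derivative exists for all time, whatever the completeness of the
  metric.\<close>

lemma geodesically_complete_if_euler_complete:
  assumes "complete_field F"
  shows "geodesically_complete T A q"
  unfolding geodesically_complete_def complete_geodesic_def
proof (intro allI impI)
  fix I \<gamma> assume geo: "geodesic T A q I \<gamma>"
  then have I: "open_interval I" by (simp add: geodesic_def)
  obtain x where x: "\<And>t. t \<in> I \<Longrightarrow> log_deriv_at \<gamma> t (x t)"
    "\<And>t. t \<in> I \<Longrightarrow> \<forall>W. ((\<lambda>s. B (x s) W) has_real_derivative B (x t) (lie_bracket G c (x t) W)) (at t)"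
    using geodesic_imp_euler[OF geo] by blast
  have "solves F I (\<lambda>s. P (x s))"
    using x(2) I unfolding solves_def euler_iff_solution by blast
  then obtain y where y: "solves F UNIV y" "\<And>t. t \<in> I \<Longrightarrow> y t = P (x t)"
    using assms unfolding complete_field_def by blast
  let ?y = "\<lambda>t. N (y t)"
  have N: "bounded_linear N" using N_linear by (simp add: linear_conv_bounded_linear)
  have sm: "smooth_on UNIV ?y"
    unfolding smooth_on_def
    by (intro allI Ck_on_bounded_linear_compose[OF N] solution_smooth[OF y(1), unfolded smooth_on_def, rule_format])
  have euler: "((\<lambda>s. B (?y s) W) has_real_derivative B (?y t) (lie_bracket G c (?y t) W)) (at t)" for t W
    using euler_iff_solution[of ?y t] y(1) by (simp add: solves_def)
  obtain t0 where t0: "t0 \<in> I" using I by (auto simp: open_interval_def)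
  have "\<gamma> t0 \<in> carrier G" using x(1)[OF t0] by (simp add: log_deriv_at_def cont_at_def)
  then obtain \<delta> where \<delta>: "\<delta> t0 = \<gamma> t0" "\<And>t. log_deriv_at \<delta> t (?y t)"
    using log_deriv_existence[OF smooth_on_imp_continuous_on[OF sm]] by blast
  have "geodesic T A q UNIV \<delta>"
    by (rule euler_imp_geodesic[OF _ \<delta>(2) sm euler]) (simp add: open_interval_def)
  moreover have "\<delta> t = \<gamma> t" if t: "t \<in> I" for t
  proof (rule log_deriv_unique[where x = ?y and \<gamma> = \<delta> and \<delta> = \<gamma>, OF I t0 \<delta>(1)])
    show "log_deriv_at \<delta> t (?y t)" for t by (rule \<delta>(2))
    show "log_deriv_at \<gamma> t (?y t)" if "t \<in> I" for t using x(1)[OF that] y(2)[OF that] by simp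
    show "continuous_on I ?y" using smooth_on_imp_continuous_on[OF sm] by (rule continuous_on_subset) simp
  qed (rule t)
  ultimately show "\<exists>\<delta>. geodesic T A q UNIV \<delta> \<and> (\<forall>t\<in>I. \<delta> t = \<gamma> t)" by blast
qed

text \<open>An idempotent \<open>v\<close> with \<open>F v = k v\<close> gives the solution \<open>v / (1 - k t)\<close>, which stays on a
  line. The corresponding geodesic is a reparametrization of a one-parameter subgroup and cannot be
  continued beyond \<open>t = 1 / k\<close>.\<close>

lemma incomplete_geodesic_of_idempotent:
  assumes v: "F v = k *\<^sub>R v" "k \<noteq> 0" "v \<noteq> 0"
  shows "\<exists>I \<gamma>. geodesic T A q I \<gamma> \<and> runs_on_one_parameter_subgroup G T A c I \<gamma> \<and> \<not> complete_geodesic T A q I \<gamma>"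
proof -
  obtain \<sigma> where \<sigma>: "\<sigma> 0 = \<one>" "\<And>t. log_deriv_at \<sigma> t (N v)"
    using log_deriv_existence[of "\<lambda>_. N v" \<one> 0] by auto
  define I where "I = {t. k * t < 1}"
  have "open I" unfolding I_def by (intro open_Collect_less continuous_intros)
  moreover have "is_interval I"
  proof -
    have "k * t < 1" if "a \<le> t" "t \<le> b" "k * a < 1" "k * b < 1" for a b t
    proof (cases "k \<ge> 0")
      case True
      then show ?thesis using mult_left_mono[OF that(2), of k] that(4) by linarith
    next
      case False
      then show ?thesis using mult_left_mono_neg[OF that(1), of k] that(3) by linarith
    qed
    then show ?thesis by (auto simp: is_interval_1 I_def)
  qed
  moreover have "0 \<in> I" by (simp add: I_def)
  ultimately have I: "open_interval I" by (auto simp: open_interval_def)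
  define r where "r t = 1 / (1 - k * t)" for t
  have r': "(r has_real_derivative k * (r t * r t)) (at t)" if "t \<in> I" for t
  proof -
    have "1 - k * t \<noteq> 0" using that by (simp add: I_def)
    then show ?thesis
      unfolding r_def by (auto intro!: derivative_eq_intros simp: power2_eq_square field_simps)
  qed
  have "Ck_on j r I" for j
  proof (induction j)
    case 0
    show ?case unfolding Ck_on.simps
      using r' by (intro continuous_at_imp_continuous_on ballI) (rule DERIV_isCont)
  next
    case (Suc j)
    have "Ck_on j (\<lambda>t. k * (r t * r t)) I"
      by (intro Ck_on_bilinear[OF bounded_bilinear_mult] Ck_on_const Suc)
    then show ?case
      by (rule Ck_on_Suc_real[rotated]) (use r' in \<open>simp add: has_real_derivative_iff_has_vector_derivative\<close>)
  qed
  then have smooth: "smooth_on I (\<lambda>t. r t *\<^sub>R N v)"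
    unfolding smooth_on_def by (intro allI Ck_on_bilinear[OF bounded_bilinear_scaleR] Ck_on_const) auto
  \<comment> \<open>The primitive of \<open>r\<close>: the subgroup \<open>\<sigma>\<close>, run through with speed \<open>r\<close>, has logarithmic
    derivative \<open>r t N v\<close>.\<close>
  define s where "s t = - (ln (1 - k * t) / k)" for t
  have s': "(s has_real_derivative r t) (at t)" if "t \<in> I" for t
  proof -
    have "1 - k * t > 0" using that by (simp add: I_def)
    then show ?thesis
      unfolding s_def r_def using v(2) by (auto intro!: derivative_eq_intros)
  qed
  have ld: "log_deriv_at (\<sigma> \<circ> s) t (r t *\<^sub>R N v)" if "t \<in> I" for t
    by (rule log_deriv_at_compose[OF \<sigma>(2) s'[OF that]])
  have BP: "B (a *\<^sub>R N v) W = a * (v \<bullet> W)" for a W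
    by (simp add: P_inner[symmetric] linear_scale[OF P_linear])
  have euler: "((\<lambda>t. B (r t *\<^sub>R N v) W) has_real_derivative B (r t *\<^sub>R N v) (lie_bracket G c (r t *\<^sub>R N v) W)) (at t)"
    if "t \<in> I" for t W
  proof -
    have "v \<bullet> lie_bracket G c (r t *\<^sub>R N v) W = r t * (k * (v \<bullet> W))"
      using F_inner[of v W] v(1) linear_scale[OF bracket_linear(2)] by simp
    then have eq: "B (r t *\<^sub>R N v) (lie_bracket G c (r t *\<^sub>R N v) W) = k * (r t * r t) * (v \<bullet> W)"
      by (simp add: BP)
    then show ?thesis
      unfolding eq unfolding BP using DERIV_cmult_right[OF r'[OF that], of "v \<bullet> W"] by simp
  qed
  have geo: "geodesic T A q I (\<sigma> \<circ> s)"
    by (rule euler_imp_geodesic[OF I ld smooth euler])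
  moreover have "runs_on_one_parameter_subgroup G T A c I (\<sigma> \<circ> s)"
    unfolding runs_on_one_parameter_subgroup_def one_parameter_subgroup_def
    by (intro exI[of _ "N v"]) (auto simp: lie_exp_eq[OF \<sigma>])
  moreover have "\<not> complete_geodesic T A q I (\<sigma> \<circ> s)"
  proof
    assume "complete_geodesic T A q I (\<sigma> \<circ> s)"
    then obtain \<delta> where \<delta>: "geodesic T A q UNIV \<delta>" "\<And>t. t \<in> I \<Longrightarrow> \<delta> t = (\<sigma> \<circ> s) t"
      unfolding complete_geodesic_def by blast
    obtain x where x: "\<And>t. log_deriv_at \<delta> t (x t)"
      "\<And>t W. ((\<lambda>s. B (x s) W) has_real_derivative B (x t) (lie_bracket G c (x t) W)) (at t)"
      using geodesic_imp_euler[OF \<delta>(1)] by blast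
    have x_eq: "x t = r t *\<^sub>R N v" if t: "t \<in> I" for t
    proof -
      have "\<forall>\<^sub>F u in nhds t. u \<in> I" using \<open>open I\<close> t by (rule eventually_nhds_in_open)
      then have "\<forall>\<^sub>F u in nhds t. (\<sigma> \<circ> s) u = \<delta> u" by eventually_elim (simp add: \<delta>(2))
      from log_deriv_at_cong[OF this ld[OF t]] show ?thesis
        using x(1) log_deriv_at_value_unique by blast
    qed
    \<comment> \<open>This function would be continuous at \<open>1 / k\<close>, vanish there and be a positive constant on \<open>I\<close>.\<close>
    define g where "g t = B (x t) v * (1 - k * t)" for t
    have "isCont g (1 / k)"
      unfolding g_def using DERIV_isCont[OF x(2)] by (intro continuous_intros) auto
    moreover have "(\<lambda>n. (1 - inverse (real (Suc n))) / k) \<longlonglongrightarrow> (1 - 0) / k"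
      using v(2) by (intro tendsto_intros LIMSEQ_inverse_real_of_nat) auto
    ultimately have "(\<lambda>n. g ((1 - inverse (real (Suc n))) / k)) \<longlonglongrightarrow> g (1 / k)"
      using isCont_tendsto_compose[of "1 / k" g] by simp
    moreover have "g ((1 - inverse (real (Suc n))) / k) = v \<bullet> v" for n
    proof -
      let ?t = "(1 - inverse (real (Suc n))) / k"
      have kt: "k * ?t = 1 - inverse (real (Suc n))" using v(2) by simp
      have t: "?t \<in> I" unfolding I_def mem_Collect_eq kt by simp
      have ne: "1 - k * ?t \<noteq> 0" unfolding kt by simp
      show ?thesis unfolding g_def x_eq[OF t] BP using ne by (simp add: r_def)
    qed
    ultimately have "(\<lambda>n::nat. v \<bullet> v) \<longlonglongrightarrow> g (1 / k)" by simp
    then have "g (1 / k) = v \<bullet> v" by (simp add: LIMSEQ_const_iff)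
    moreover have "g (1 / k) = 0" using v(2) by (simp add: g_def)
    ultimately show False using v(3) by simp
  qed
  ultimately show ?thesis by blast
qed

lemma no_idempotent_if_subgroup_geodesics_complete:
  assumes "\<And>I \<gamma>. geodesic T A q I \<gamma> \<Longrightarrow> runs_on_one_parameter_subgroup G T A c I \<gamma> \<Longrightarrow> complete_geodesic T A q I \<gamma>"
  shows "\<not> idempotent_of F v"
proof
  assume "idempotent_of F v"
  then obtain a b where v: "v \<noteq> 0" "F v \<noteq> 0" and ab: "a \<noteq> 0 \<or> b \<noteq> 0" "a *\<^sub>R v + b *\<^sub>R F v = 0"
    unfolding idempotent_of_def by blast
  have b: "b \<noteq> 0" using ab v(1) by auto
  have "b *\<^sub>R F v = - (a *\<^sub>R v)" using ab(2) by (simp add: eq_neg_iff_add_eq_0 add.commute)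
  then have "(1 / b) *\<^sub>R (b *\<^sub>R F v) = (1 / b) *\<^sub>R (- (a *\<^sub>R v))" by simp
  then have eq: "F v = (- (a / b)) *\<^sub>R v" using b by simp
  moreover have "- (a / b) \<noteq> 0" using eq v(2) by auto
  ultimately show False
    using incomplete_geodesic_of_idempotent[of v "- (a / b)"] v(1) assms by blast
qed

end

section \<open>Unimodular Lie algebras of dimension three\<close>

unbundle cross3_syntax

text \<open>An antisymmetric product on \<open>\<real>\<^sup>3\<close> factors through the cross product by a matrix \<open>M\<close>, and the
  traces of its left multiplications are the coefficients of the antisymmetric part of \<open>M\<close>.\<close>

lemma antisymmetric_product_cross:
  fixes \<beta> :: "real^3 \<Rightarrow> real^3 \<Rightarrow> real^3"
  assumes bil: "bilinear \<beta>" and anti: "\<And>x y. \<beta> x y = - \<beta> y x"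
    and tr: "\<And>x. trace (matrix (\<beta> x)) = 0"
  shows "\<exists>M::real^3^3. (\<forall>x y. \<beta> x y = M *v (x \<times> y)) \<and> (\<forall>x y. x \<bullet> (M *v y) = y \<bullet> (M *v x))"
proof -
  let ?e1 = "axis 1 1 :: real^3" and ?e2 = "axis 2 1 :: real^3" and ?e3 = "axis 3 1 :: real^3"
  define M :: "real^3^3" where "M = transpose (vector [\<beta> ?e2 ?e3, \<beta> ?e3 ?e1, \<beta> ?e1 ?e2])"
  have M: "M *v w = w$1 *\<^sub>R \<beta> ?e2 ?e3 + w$2 *\<^sub>R \<beta> ?e3 ?e1 + w$3 *\<^sub>R \<beta> ?e1 ?e2" for w
    by (simp add: M_def vec_eq_iff matrix_vector_mult_def transpose_def sum_3 vector_3 mult.commute)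
  have exp: "x = x$1 *\<^sub>R ?e1 + x$2 *\<^sub>R ?e2 + x$3 *\<^sub>R ?e3" for x :: "real^3"
    by (simp add: vec_eq_iff forall_3 axis_def)
  have self: "\<beta> x x = 0" for x
  proof -
    have "2 *\<^sub>R \<beta> x x = 0" using anti[of x x] by (metis add.right_inverse scaleR_2)
    then show ?thesis by (metis scaleR_eq_0_iff zero_neq_numeral)
  qed
  have lin: "linear (\<lambda>x. \<beta> x y)" "linear (\<beta> x)" for x y using bil by (simp_all add: bilinear_def)
  have \<beta>: "\<beta> x y = M *v (x \<times> y)" for x y
  proof -
    have "\<beta> x y = \<beta> (x$1 *\<^sub>R ?e1 + x$2 *\<^sub>R ?e2 + x$3 *\<^sub>R ?e3) (y$1 *\<^sub>R ?e1 + y$2 *\<^sub>R ?e2 + y$3 *\<^sub>R ?e3)"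
      using exp[of x] exp[of y] by simp
    also have "\<dots> = (x$2 * y$3 - x$3 * y$2) *\<^sub>R \<beta> ?e2 ?e3 + (x$3 * y$1 - x$1 * y$3) *\<^sub>R \<beta> ?e3 ?e1
        + (x$1 * y$2 - x$2 * y$1) *\<^sub>R \<beta> ?e1 ?e2"
      using anti[of ?e3 ?e2] anti[of ?e1 ?e3] anti[of ?e2 ?e1]
      by (simp add: linear_add[OF lin(1)] linear_add[OF lin(2)] linear_scale[OF lin(1)] linear_scale[OF lin(2)]
          self algebra_simps)
    also have "\<dots> = M *v (x \<times> y)"
      by (simp add: M cross_components mult.commute)
    finally show ?thesis .
  qed
  have "trace (matrix (\<beta> x)) = (M *v (x \<times> ?e1))$1 + (M *v (x \<times> ?e2))$2 + (M *v (x \<times> ?e3))$3" for x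
    by (simp add: trace_def sum_3 matrix_def \<beta>)
  then have t: "(M *v (x \<times> ?e1))$1 + (M *v (x \<times> ?e2))$2 + (M *v (x \<times> ?e3))$3 = 0" for x
    using tr by metis
  have "M$2$3 = M$3$2" "M$1$3 = M$3$1" "M$1$2 = M$2$1"
    using t[of ?e1] t[of ?e2] t[of ?e3]
    by (simp_all add: cross_components matrix_vector_mult_def sum_3 axis_def)
  then have "\<forall>x y. x \<bullet> (M *v y) = y \<bullet> (M *v x)"
    by (simp add: inner_vec_def matrix_vector_mult_def sum_3 algebra_simps)
  then show ?thesis using \<beta> by blast
qed

lemma euler_complete_if_no_idempotent:
  fixes G :: "'g monoid" (structure) and c :: "('g, real ^ 3) chart"
  assumes "left_invariant_metric G T A c q" and uni: "unimodular G c"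
    and no: "\<nexists>v. idempotent_of (left_invariant_metric.F G c q) v"
  shows "complete_field (left_invariant_metric.F G c q)"
proof -
  interpret left_invariant_metric G T A c q by (rule assms(1))
  obtain M :: "real^3^3" where M: "\<And>x y. lie_bracket G c x y = M *v (x \<times> y)"
    and M_sym: "\<And>x y. x \<bullet> (M *v y) = y \<bullet> (M *v x)"
    using antisymmetric_product_cross[OF lie_bracket_bilinear lie_bracket_antisym] uni
    unfolding unimodular_def by metis
  have N: "matrix N *v v = N v" for v using matrix_works[of N] N_linear unfolding linear_matrix_vector_mul_eq by blast
  have "x \<bullet> N y = B (N x) (N y)" for x y by (simp add: P_inner[symmetric])
  then have N_sym: "x \<bullet> N y = y \<bullet> N x" for x y using B_props(2) by metis
  interpret s: symmetric_pair M "matrix N"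
  proof
    show "x = 0" if "matrix N *v x = 0" for x
    proof -
      have "P (N x) = 0" using that linear_0[OF P_linear] by (simp add: N)
      then show ?thesis by simp
    qed
  qed (simp_all add: N M_sym N_sym)
  have "F v = s.F v" for v
  proof (rule vector_eq_rdot[THEN iffD1], rule allI)
    fix z
    have "F v \<bullet> z = v \<bullet> (M *v (N v \<times> z))" by (simp add: F_inner M)
    also have "\<dots> = (N v \<times> z) \<bullet> (M *v v)" by (rule M_sym)
    also have "\<dots> = ((M *v v) \<times> N v) \<bullet> z" by (simp add: cross3_simps)
    also have "\<dots> = s.F v \<bullet> z" by (simp add: s.F_def N)
    finally show "F v \<bullet> z = s.F v \<bullet> z" .
  qed
  then have "F = s.F" by (rule ext)
  then show ?thesis using s.complete_if_no_idempotent no by simp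
qed

unbundle no cross3_syntax

theorem theorem2:
  fixes G :: "'g monoid"
    and T :: "'g topology"
    and A :: "('g, real ^ 3) chart set"
    and c :: "('g, real ^ 3) chart"
    and q :: "('g, real ^ 3) metric"
  assumes "lie_group G T A"
    and "c \<in> A" and "\<one>\<^bsub>G\<^esub> \<in> fst c"
    and "unimodular G c"
    and "pseudo_riemannian_metric A q"
    and "left_invariant G A q"
  shows "(complete_field (euler_field G c q) \<longleftrightarrow> geodesically_complete T A q) \<and>
    (complete_field (euler_field G c q) \<longleftrightarrow>
       (\<forall>I \<gamma>. geodesic T A q I \<gamma> \<and> runs_on_one_parameter_subgroup G T A c I \<gamma>
          \<longrightarrow> complete_geodesic T A q I \<gamma>)) \<and>
    (complete_field (euler_field G c q) \<longleftrightarrow> (\<nexists>\<xi>. idempotent_of (euler_field G c q) \<xi>))"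
proof -
  have "group G" using assms(1) by (simp add: lie_group_def)
  then have lim: "left_invariant_metric G T A c q"
    using assms
    by (simp add: left_invariant_metric_def left_invariant_metric_axioms_def
        lie_group_chart_def lie_group_chart_axioms_def)
  interpret left_invariant_metric G T A c q by (rule lim)
  let ?subgroups = "\<forall>I \<gamma>. geodesic T A q I \<gamma> \<and> runs_on_one_parameter_subgroup G T A c I \<gamma>
          \<longrightarrow> complete_geodesic T A q I \<gamma>"
  have 1: "complete_field F \<Longrightarrow> geodesically_complete T A q"
    by (rule geodesically_complete_if_euler_complete)
  have 2: "geodesically_complete T A q \<Longrightarrow> ?subgroups"
    by (simp add: geodesically_complete_def)
  have 3: "?subgroups \<Longrightarrow> \<nexists>v. idempotent_of F v"
    using no_idempotent_if_subgroup_geodesics_complete by blast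
  have 4: "\<nexists>v. idempotent_of F v \<Longrightarrow> complete_field F"
    by (rule euler_complete_if_no_idempotent[OF lim assms(4)])
  have 5: "(\<nexists>\<xi>. idempotent_of (euler_field G c q) \<xi>) \<longleftrightarrow> (\<nexists>v. idempotent_of F v)"
    by (metis idempotent_euler_iff coords_covector)
  show ?thesis
    unfolding complete_euler_iff 5 using 1 2 3 4 by blast
qed

end
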